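(* Let $X_0\in\mathbb{R}^{n+1}$, let $t_0\neq 0$ be a real number, and let $X:M\to\mathbb{R}^{n+1}$ be an immersed hypersurface. The following statements are equivalent: (1) $X:M\to\mathbb{R}^{n+1}$ is a $\lambda$-hypersurface (for some constant $\lambda$), i.e. $\langle \frac{X-X_0}{t_0},N\rangle+H=\lambda$ on $M$; (2) $X:M\to\mathbb{R}^{n+1}$ is a critical point of the weighted area functional $A(t)$ for all weighted volume-preserving variations, i.e. $A'(0)=0$ for every weighted volume-preserving variation of $X$; (3) $X:M\to\mathbb{R}^{n+1}$ is a hypersurface with constant weighted mean curvature $H_w=\lambda$ (for some constant $\lambda$) in $\mathbb{R}^{n+1}$ with respect to the metric $g_{AB}=e^{-\frac{|X-X_0|^2}{nt_0}}\delta_{AB}$, where $H_w=e^{-\frac{|X-X_0|^2}{2nt_0}}H_g$ and $H_g$ denotes the mean curvature of the hypersurface with respect to the metric $g$ (and the $g$-unit normal that is a positive multiple of $N$). Moreover the constants $\lambda$ in (1) and (3) agree.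
   Context: $X:M\to\mathbb{R}^{n+1}$ is a smooth immersion of a connected $n$-dimensional manifold with unit normal $N$ and induced area element $d\mu$. The second fundamental form is $h_{ij}=-\langle D_{e_i}N,e_j\rangle$ for a local orthonormal tangent frame $e_1,\dots,e_n$ ($D$ the Euclidean derivative), and $H=\sum_i h_{ii}$ is the mean curvature, so the mean curvature vector is $\Delta X=HN$. The same sign convention is used for the mean curvature with respect to $g$ (trace, not average). A variation of $X$ is a smooth family of immersions $X(t):M\to\mathbb{R}^{n+1}$, $t\in(-\varepsilon,\varepsilon)$, with $X(0)=X$; only compactly supported variations with normal variation vector field $\frac{\partial X(t)}{\partial t}|_{t=0}=fN$ are considered. The weighted area is $A(t)=\int_M e^{-\frac{|X(t)-X_0|^2}{2t_0}}d\mu_t$, with $d\mu_t$ the area element induced by $X(t)$, and the weighted volume is $V(t)=\int_M\langle X(t)-X_0,N\rangle e^{-\frac{|X-X_0|^2}{2t_0}}d\mu$, with $N,d\mu$ those of $X=X(0)$. The variation is weighted volume-preserving if $V(t)=V(0)$ for all $t$. *)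

theory Defs
  imports "HOL-Analysis.Analysis"
begin

section \<open>Smooth maps between Euclidean spaces\<close>

text \<open>On an open subset of a Euclidean space, having continuous iterated directional derivatives
  of order up to \<open>k\<close> is the same as being of class \<open>C\<^sup>k\<close>.\<close>

primrec Ck_on :: "nat \<Rightarrow> 'a::euclidean_space set \<Rightarrow> ('a \<Rightarrow> 'b::euclidean_space) \<Rightarrow> bool" where
  "Ck_on 0 S f \<longleftrightarrow> continuous_on S f"
| "Ck_on (Suc k) S f \<longleftrightarrow>
     (\<forall>x\<in>S. f differentiable (at x)) \<and>
     (\<forall>v. Ck_on k S (\<lambda>x. frechet_derivative f (at x) v))"

definition smooth_on :: "'a::euclidean_space set \<Rightarrow> ('a \<Rightarrow> 'b::euclidean_space) \<Rightarrow> bool" where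
  "smooth_on S f \<longleftrightarrow> (\<forall>k. Ck_on k S f)"


section \<open>Smooth manifolds\<close>

text \<open>A manifold is given by its topology (the type \<open>'m\<close>, Hausdorff and second countable by its
  sort) and a smooth atlas, not required to be maximal. A chart is a pair of its domain and
  its coordinate map; values of the coordinate map outside the domain are irrelevant.\<close>

type_synonym ('m, 'n) chart = "'m set \<times> ('m \<Rightarrow> (real, 'n) vec)"

abbreviation chart_inv :: "('m, 'n) chart \<Rightarrow> real ^ 'n \<Rightarrow> 'm" where
  "chart_inv c \<equiv> inv_into (fst c) (snd c)"

definition smooth_atlas ::
    "('m::{t2_space,second_countable_topology}, 'n::finite) chart set \<Rightarrow> bool" where
  "smooth_atlas \<A> \<longleftrightarrow>
     (\<forall>c\<in>\<A>. open (fst c) \<and> open (snd c ` fst c) \<and>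
        homeomorphism (fst c) (snd c ` fst c) (snd c) (chart_inv c)) \<and>
     (\<Union>c\<in>\<A>. fst c) = UNIV \<and>
     (\<forall>c\<in>\<A>. \<forall>d\<in>\<A>. smooth_on (snd c ` (fst c \<inter> fst d)) (snd d \<circ> chart_inv c))"

definition smooth_map :: "('m, 'n::finite) chart set \<Rightarrow> ('m \<Rightarrow> 'e::euclidean_space) \<Rightarrow> bool" where
  "smooth_map \<A> F \<longleftrightarrow> (\<forall>c\<in>\<A>. smooth_on (snd c ` fst c) (F \<circ> chart_inv c))"

text \<open>The differential of \<open>F\<close> at \<open>p\<close>, applied to the tangent vector with components \<open>v\<close>
  in the chart \<open>c\<close>.\<close>

definition chart_deriv ::
    "('m, 'n::finite) chart \<Rightarrow> ('m \<Rightarrow> 'e::euclidean_space) \<Rightarrow> 'm \<Rightarrow> real ^ 'n \<Rightarrow> 'e" where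
  "chart_deriv c F p v = frechet_derivative (F \<circ> chart_inv c) (at (snd c p)) v"

definition immersion :: "('m, 'n::finite) chart set \<Rightarrow> ('m \<Rightarrow> 'e::euclidean_space) \<Rightarrow> bool" where
  "immersion \<A> X \<longleftrightarrow>
     smooth_map \<A> X \<and> (\<forall>c\<in>\<A>. \<forall>p\<in>fst c. inj (chart_deriv c X p))"

definition unit_normal ::
    "('m, 'n::finite) chart set \<Rightarrow> ('m \<Rightarrow> 'e::euclidean_space) \<Rightarrow> ('m \<Rightarrow> 'e) \<Rightarrow> bool" where
  "unit_normal \<A> X N \<longleftrightarrow>
     smooth_map \<A> N \<and> (\<forall>p. norm (N p) = 1) \<and>
     (\<forall>c\<in>\<A>. \<forall>p\<in>fst c. \<forall>v. chart_deriv c X p v \<bullet> N p = 0)"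


section \<open>The induced area element\<close>

definition gram_matrix ::
    "('m, 'n::finite) chart \<Rightarrow> ('m \<Rightarrow> 'e::euclidean_space) \<Rightarrow> 'm \<Rightarrow> real ^ 'n ^ 'n" where
  "gram_matrix c X p =
     (\<chi> i j. chart_deriv c X p (axis i 1) \<bullet> chart_deriv c X p (axis j 1))"

text \<open>The Borel measure on the manifold whose density in each chart is \<open>sqrt (det g\<^sub>i\<^sub>j)\<close>. For an
  immersion it exists by the change of variables formula, and it is unique because countably
  many chart domains cover the manifold.\<close>

definition area_measure ::
    "('m::{t2_space,second_countable_topology}, 'n::finite) chart set \<Rightarrow>
     ('m \<Rightarrow> 'e::euclidean_space) \<Rightarrow> 'm measure" where
  "area_measure \<A> X = (SOME \<mu>. sets \<mu> = sets borel \<and>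
     (\<forall>c\<in>\<A>. \<forall>B\<in>sets borel. B \<subseteq> fst c \<longrightarrow>
        emeasure \<mu> B = (\<integral>\<^sup>+x\<in>snd c ` B. ennreal (sqrt (det (gram_matrix c X (chart_inv c x)))) \<partial>lborel)))"


section \<open>Mean curvature\<close>

text \<open>The chart and the orthonormal frame below are chosen arbitrarily: the trace of the second
  fundamental form depends on neither choice.\<close>

definition chart_at :: "('m, 'n::finite) chart set \<Rightarrow> 'm \<Rightarrow> ('m, 'n) chart" where
  "chart_at \<A> p = (SOME c. c \<in> \<A> \<and> p \<in> fst c)"

text \<open>An orthonormal frame at \<open>p\<close> for the metric induced by the bilinear form \<open>b\<close> on the ambient
  space: \<open>dX (v i)\<close> are the vectors \<open>e\<^sub>i\<close>.\<close>

definition orthonormal_frame ::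
    "('m, 'n::finite) chart \<Rightarrow> ('e::euclidean_space \<Rightarrow> 'e \<Rightarrow> real) \<Rightarrow> ('m \<Rightarrow> 'e) \<Rightarrow> 'm \<Rightarrow>
     ('n \<Rightarrow> real ^ 'n) \<Rightarrow> bool" where
  "orthonormal_frame c b X p v \<longleftrightarrow>
     (\<forall>i j. b (chart_deriv c X p (v i)) (chart_deriv c X p (v j)) = (if i = j then 1 else 0))"

definition second_fundamental_form ::
    "('m, 'n::finite) chart \<Rightarrow> ('m \<Rightarrow> 'e::euclidean_space) \<Rightarrow> ('m \<Rightarrow> 'e) \<Rightarrow> 'm \<Rightarrow>
     real ^ 'n \<Rightarrow> real ^ 'n \<Rightarrow> real" where
  "second_fundamental_form c X N p v w = - (chart_deriv c N p v \<bullet> chart_deriv c X p w)"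

definition mean_curvature ::
    "('m, 'n::finite) chart set \<Rightarrow> ('m \<Rightarrow> 'e::euclidean_space) \<Rightarrow> ('m \<Rightarrow> 'e) \<Rightarrow> 'm \<Rightarrow> real" where
  "mean_curvature \<A> X N p =
     (let c = chart_at \<A> p; v = (SOME v. orthonormal_frame c (\<bullet>) X p v)
      in \<Sum>i\<in>UNIV. second_fundamental_form c X N p (v i) (v i))"


section \<open>Mean curvature with respect to a Riemannian metric on the ambient space\<close>

text \<open>A metric on the ambient space is given by its coefficient matrices \<open>G y = (g\<^sub>A\<^sub>B(y))\<close>.\<close>

definition metric_inner ::
    "(real ^ 'm \<Rightarrow> real ^ 'm ^ 'm::finite) \<Rightarrow> real ^ 'm \<Rightarrow> real ^ 'm \<Rightarrow> real ^ 'm \<Rightarrow> real" where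
  "metric_inner G y u w = u \<bullet> (G y *v w)"

definition partial_deriv :: "'m::finite \<Rightarrow> (real ^ 'm \<Rightarrow> real) \<Rightarrow> real ^ 'm \<Rightarrow> real" where
  "partial_deriv A f y = frechet_derivative f (at y) (axis A 1)"

definition christoffel ::
    "(real ^ 'm \<Rightarrow> real ^ 'm ^ 'm::finite) \<Rightarrow> real ^ 'm \<Rightarrow> 'm \<Rightarrow> 'm \<Rightarrow> 'm \<Rightarrow> real" where
  "christoffel G y C A B =
     (1/2) * (\<Sum>D\<in>UNIV. matrix_inv (G y) $ C $ D *
        (partial_deriv A (\<lambda>z. G z $ B $ D) y + partial_deriv B (\<lambda>z. G z $ A $ D) y
         - partial_deriv D (\<lambda>z. G z $ A $ B) y))"

text \<open>The Levi-Civita derivative, in the tangent direction \<open>v\<close>, of a field \<open>\<nu>\<close> of ambient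
  vectors along \<open>X\<close>.\<close>

definition covariant_deriv ::
    "(real ^ 'm \<Rightarrow> real ^ 'm ^ 'm::finite) \<Rightarrow> ('p, 'n::finite) chart \<Rightarrow> ('p \<Rightarrow> real ^ 'm) \<Rightarrow>
     ('p \<Rightarrow> real ^ 'm) \<Rightarrow> 'p \<Rightarrow> real ^ 'n \<Rightarrow> real ^ 'm" where
  "covariant_deriv G c X \<nu> p v =
     (\<chi> C. chart_deriv c \<nu> p v $ C +
        (\<Sum>A\<in>UNIV. \<Sum>B\<in>UNIV. christoffel G (X p) C A B * chart_deriv c X p v $ A * \<nu> p $ B))"

definition metric_second_fundamental_form ::
    "(real ^ 'm \<Rightarrow> real ^ 'm ^ 'm::finite) \<Rightarrow> ('p, 'n::finite) chart \<Rightarrow> ('p \<Rightarrow> real ^ 'm) \<Rightarrow>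
     ('p \<Rightarrow> real ^ 'm) \<Rightarrow> 'p \<Rightarrow> real ^ 'n \<Rightarrow> real ^ 'n \<Rightarrow> real" where
  "metric_second_fundamental_form G c X \<nu> p v w =
     - metric_inner G (X p) (covariant_deriv G c X \<nu> p v) (chart_deriv c X p w)"

definition metric_mean_curvature ::
    "(real ^ 'm \<Rightarrow> real ^ 'm ^ 'm::finite) \<Rightarrow> ('p, 'n::finite) chart set \<Rightarrow> ('p \<Rightarrow> real ^ 'm) \<Rightarrow>
     ('p \<Rightarrow> real ^ 'm) \<Rightarrow> 'p \<Rightarrow> real" where
  "metric_mean_curvature G \<A> X \<nu> p =
     (let c = chart_at \<A> p; v = (SOME v. orthonormal_frame c (metric_inner G (X p)) X p v)
      in \<Sum>i\<in>UNIV. metric_second_fundamental_form G c X \<nu> p (v i) (v i))"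

definition metric_normalize ::
    "(real ^ 'm \<Rightarrow> real ^ 'm ^ 'm::finite) \<Rightarrow> ('p \<Rightarrow> real ^ 'm) \<Rightarrow> ('p \<Rightarrow> real ^ 'm) \<Rightarrow>
     'p \<Rightarrow> real ^ 'm" where
  "metric_normalize G X N p = (1 / sqrt (metric_inner G (X p) (N p) (N p))) *\<^sub>R N p"


section \<open>\<open>\<lambda>\<close>-hypersurfaces and weighted mean curvature\<close>

definition lambda_hypersurface ::
    "('p, 'n::finite) chart set \<Rightarrow> ('p \<Rightarrow> 'e::euclidean_space) \<Rightarrow> ('p \<Rightarrow> 'e) \<Rightarrow> 'e \<Rightarrow> real \<Rightarrow>
     real \<Rightarrow> bool" where
  "lambda_hypersurface \<A> X N X0 t0 lam \<longleftrightarrow>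
     (\<forall>p. ((1 / t0) *\<^sub>R (X p - X0)) \<bullet> N p + mean_curvature \<A> X N p = lam)"

definition gauss_metric :: "nat \<Rightarrow> real ^ 'm \<Rightarrow> real \<Rightarrow> real ^ 'm \<Rightarrow> real ^ 'm ^ 'm::finite" where
  "gauss_metric n X0 t0 y = exp (- (norm (y - X0))\<^sup>2 / (real n * t0)) *\<^sub>R mat 1"

definition weighted_mean_curvature ::
    "('p, 'n::finite) chart set \<Rightarrow> ('p \<Rightarrow> real ^ 'm::finite) \<Rightarrow> ('p \<Rightarrow> real ^ 'm) \<Rightarrow>
     real ^ 'm \<Rightarrow> real \<Rightarrow> 'p \<Rightarrow> real" where
  "weighted_mean_curvature \<A> X N X0 t0 p =
     (let n = CARD('n); G = gauss_metric n X0 t0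
      in exp (- (norm (X p - X0))\<^sup>2 / (2 * real n * t0)) *
         metric_mean_curvature G \<A> X (metric_normalize G X N) p)"


section \<open>Variations and the weighted functionals\<close>

text \<open>A smooth family of immersions \<open>F t\<close>, \<open>\<bar>t\<bar> < \<epsilon>\<close>, with \<open>F 0 = X\<close> and normal variation vector
  field, which agrees with \<open>X\<close> outside the compact set \<open>K\<close>.\<close>

definition normal_variation ::
    "('p::{t2_space,second_countable_topology}, 'n::finite) chart set \<Rightarrow>
     ('p \<Rightarrow> 'e::euclidean_space) \<Rightarrow> ('p \<Rightarrow> 'e) \<Rightarrow> 'p set \<Rightarrow> real \<Rightarrow> (real \<Rightarrow> 'p \<Rightarrow> 'e) \<Rightarrow> bool" where
  "normal_variation \<A> X N K \<epsilon> F \<longleftrightarrow>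
     0 < \<epsilon> \<and> compact K \<and> F 0 = X \<and>
     (\<forall>c\<in>\<A>. smooth_on ({-\<epsilon><..<\<epsilon>} \<times> snd c ` fst c) (\<lambda>(t, x). F t (chart_inv c x))) \<and>
     (\<forall>t\<in>{-\<epsilon><..<\<epsilon>}. immersion \<A> (F t)) \<and>
     (\<forall>t\<in>{-\<epsilon><..<\<epsilon>}. \<forall>p. p \<notin> K \<longrightarrow> F t p = X p) \<and>
     (\<exists>f. \<forall>p. ((\<lambda>t. F t p) has_vector_derivative f p *\<^sub>R N p) (at 0))"

text \<open>Over a noncompact manifold the weighted area and volume may be infinite. They are therefore
  taken over a compact set \<open>K\<close> outside which the variation is constant; outside \<open>K\<close> both
  integrands do not depend on \<open>t\<close>, so that differences and derivatives in \<open>t\<close> do not depend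
  on \<open>K\<close> and are those of the full integrals whenever these are finite.\<close>

definition weighted_area ::
    "('p::{t2_space,second_countable_topology}, 'n::finite) chart set \<Rightarrow> 'p set \<Rightarrow>
     'e::euclidean_space \<Rightarrow> real \<Rightarrow> (real \<Rightarrow> 'p \<Rightarrow> 'e) \<Rightarrow> real \<Rightarrow> real" where
  "weighted_area \<A> K X0 t0 F t =
     (LINT p:K|area_measure \<A> (F t). exp (- (norm (F t p - X0))\<^sup>2 / (2 * t0)))"

definition weighted_volume ::
    "('p::{t2_space,second_countable_topology}, 'n::finite) chart set \<Rightarrow>
     ('p \<Rightarrow> 'e::euclidean_space) \<Rightarrow> ('p \<Rightarrow> 'e) \<Rightarrow> 'p set \<Rightarrow> 'e \<Rightarrow> real \<Rightarrow> (real \<Rightarrow> 'p \<Rightarrow> 'e) \<Rightarrow>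
     real \<Rightarrow> real" where
  "weighted_volume \<A> X N K X0 t0 F t =
     (LINT p:K|area_measure \<A> X.
        ((F t p - X0) \<bullet> N p) * exp (- (norm (X p - X0))\<^sup>2 / (2 * t0)))"

definition critical_weighted_area ::
    "('p::{t2_space,second_countable_topology}, 'n::finite) chart set \<Rightarrow>
     ('p \<Rightarrow> 'e::euclidean_space) \<Rightarrow> ('p \<Rightarrow> 'e) \<Rightarrow> 'e \<Rightarrow> real \<Rightarrow> bool" where
  "critical_weighted_area \<A> X N X0 t0 \<longleftrightarrow>
     (\<forall>K \<epsilon> F. normal_variation \<A> X N K \<epsilon> F \<and>
        (\<forall>t\<in>{-\<epsilon><..<\<epsilon>}.
           weighted_volume \<A> X N K X0 t0 F t = weighted_volume \<A> X N K X0 t0 F 0) \<longrightarrow>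
        (weighted_area \<A> K X0 t0 F has_real_derivative 0) (at 0))"

end

theory Submission
  imports Defs
begin

text \<open>Write \<open>w = exp (- |X - X0|\<^sup>2 / (2 t0))\<close> and \<open>\<phi> = \<langle>(X - X0) / t0, N\<rangle> + H\<close>, so that the
  \<open>\<lambda>\<close>-hypersurfaces are the hypersurfaces on which \<open>\<phi>\<close> is constant.

  The weighted mean curvature equals \<open>\<phi>\<close> at every point (\<open>weighted_mean_curvature_eq\<close>). Indeed the
  ambient metric is \<open>exp (2 u)\<close> times the Euclidean one, with \<open>u y = - |y - X0|\<^sup>2 / (2 n t0)\<close>. The
  Levi-Civita derivative of a conformal metric gives \<open>h\<^sub>g = exp u (h - du(N) \<langle>\<cdot>, \<cdot>\<rangle>)\<close>; tracing over a
  \<open>g\<close>-orthonormal frame yields \<open>H\<^sub>g = exp (- u) (H - n du(N))\<close>, and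
  \<open>- n du(N) = \<langle>(X - X0) / t0, N\<rangle>\<close>. This relates (1) and (3), with the same constant.

  For (1) and (2), a variation with velocity \<open>f N\<close> satisfies
  \<open>A'(0) = - \<integral> f \<phi> w d\<mu>\<close> and \<open>V'(0) = \<integral> f w d\<mu>\<close> (\<open>first_variation_weighted_area\<close>,
  \<open>first_variation_weighted_volume\<close>). Since the velocity is normal, the first formula holds already
  for the integrands: \<open>\<partial>\<^sub>t g\<^sub>i\<^sub>j = - 2 f h\<^sub>i\<^sub>j\<close> at \<open>t = 0\<close>, and Jacobi's formula for the
  derivative of a determinant turns this into \<open>- f H\<close> for the logarithmic derivative of the area
  element.

  If \<open>\<phi> = \<lambda>\<close> is constant, then \<open>A'(0) = - \<lambda> V'(0)\<close>, which vanishes when \<open>V\<close> is constant.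
  Conversely, the volume \<open>V\<close> is affine in the varied immersion, so \<open>X + t f N\<close> preserves it exactly
  for every smooth compactly supported \<open>f\<close> with \<open>\<integral> f w d\<mu> = 0\<close>. If \<open>\<phi>\<close> took two different
  values in the domain of one chart, a combination \<open>f\<close> of two bump functions concentrated near the
  two points would satisfy \<open>\<integral> f w d\<mu> = 0\<close> and \<open>\<integral> f \<phi> w d\<mu> \<noteq> 0\<close>, contradicting criticality
  (\<open>critical_imp_equal_in_chart\<close>). Thus \<open>\<phi>\<close> is constant on every chart domain, hence locally
  constant, hence constant on the connected manifold.

  The integrals require the area measure, which is characterized by its densities in charts. By the
  change of variables formula the densities in different charts fit together, and a countable
  partition into pieces of chart domains produces the measure (\<open>area_measure_exists\<close>). The area
  measures along a variation are all densities over the one of \<open>X\<close> (\<open>area_measure_density\<close>), so the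
  weighted area is one integral depending on the parameter \<open>t\<close>, which is differentiated under the
  integral sign (\<open>has_real_derivative_area_integral\<close>).\<close>

section \<open>Calculus of continuously differentiable maps\<close>

lemma Ck_on_subset: "Ck_on k S f \<Longrightarrow> T \<subseteq> S \<Longrightarrow> Ck_on k T f"
  by (induction k arbitrary: f) (auto intro: continuous_on_subset)

lemma Ck_on_Suc_has_derivative:
  "Ck_on (Suc k) S f \<Longrightarrow> x \<in> S \<Longrightarrow> (f has_derivative frechet_derivative f (at x)) (at x)"
  by (simp add: frechet_derivative_works)

lemma Ck_on_Suc_D: "Ck_on (Suc k) S f \<Longrightarrow> Ck_on k S f"
proof (induction k arbitrary: f)
  case 0
  then show ?case
    by (auto intro!: continuous_at_imp_continuous_on differentiable_imp_continuous_within)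
qed auto

lemma Ck_on_le:
  assumes "Ck_on k S f" "j \<le> k"
  shows "Ck_on j S f"
  using assms(2,1) by (induction rule: inc_induct) (blast dest: Ck_on_Suc_D)+

lemma Ck_on_imp_continuous_on: "Ck_on k S f \<Longrightarrow> continuous_on S f"
  using Ck_on_le[of k S f 0] by simp

lemma Ck_on_cong:
  assumes "open S" "\<And>x. x \<in> S \<Longrightarrow> f x = g x" "Ck_on k S f"
  shows "Ck_on k S g"
  using assms(2,3)
proof (induction k arbitrary: f g)
  case 0
  then show ?case using continuous_on_cong[of S S f g] by simp
next
  case (Suc k)
  have D: "(f has_derivative frechet_derivative f (at x)) (at x)" if "x \<in> S" for x
    using Suc.prems(2) that by (rule Ck_on_Suc_has_derivative)
  then have D': "(g has_derivative frechet_derivative f (at x)) (at x)" if "x \<in> S" for x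
    using has_derivative_transform_within_open[OF D assms(1)] that Suc.prems(1) by auto
  then have eq: "frechet_derivative g (at x) = frechet_derivative f (at x)" if "x \<in> S" for x
    using that frechet_derivative_at[OF D'] by simp
  have "Ck_on k S (\<lambda>x. frechet_derivative g (at x) v)" for v
  proof (rule Suc.IH)
    show "Ck_on k S (\<lambda>x. frechet_derivative f (at x) v)" using Suc.prems(2) by simp
  qed (simp add: eq)
  then show ?case using D' by (auto simp: differentiable_def)
qed

text \<open>Any derivative may be exhibited in place of the chosen \<open>frechet_derivative\<close>: on an open set
  the two agree at every point.\<close>

lemma Ck_on_SucI:
  assumes "open S" "\<And>x. x \<in> S \<Longrightarrow> (f has_derivative f' x) (at x)"
    and "\<And>v. Ck_on k S (\<lambda>x. f' x v)"
  shows "Ck_on (Suc k) S f"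
proof -
  have eq: "f' x v = frechet_derivative f (at x) v" if "x \<in> S" for x v
    using frechet_derivative_at[OF assms(2)[OF that]] by simp
  have "Ck_on k S (\<lambda>x. frechet_derivative f (at x) v)" for v
    using Ck_on_cong[OF assms(1) eq assms(3)] by simp
  then show ?thesis using assms(2) by (auto simp: differentiable_def)
qed

text \<open>The definition speaks of derivatives at points of the ambient space, so being of class
  \<open>C\<^sup>k\<close> is a local property. This is used to glue a function on a chart with zero outside its
  support.\<close>

lemma Ck_on_locally:
  assumes "\<And>x. x \<in> S \<Longrightarrow> \<exists>U. open U \<and> x \<in> U \<and> Ck_on k U f"
  shows "Ck_on k S f"
  using assms
proof (induction k arbitrary: f)
  case 0
  have "continuous (at x) f" if "x \<in> S" for x
    using 0[OF that] by (auto simp: continuous_on_eq_continuous_at)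
  then show ?case by (simp add: continuous_at_imp_continuous_on)
next
  case (Suc k)
  have "f differentiable (at x)" if "x \<in> S" for x
    using Suc.prems[OF that] by auto
  moreover have "Ck_on k S (\<lambda>x. frechet_derivative f (at x) v)" for v
    by (rule Suc.IH) (use Suc.prems in force)
  ultimately show ?case by simp
qed

lemma Ck_on_const: "Ck_on k S (\<lambda>x. c)"
  by (induction k arbitrary: c) auto

lemma Ck_on_bounded_linear:
  assumes "bounded_linear f"
  shows "Ck_on k S f"
proof (cases k)
  case 0
  then show ?thesis using assms by (simp add: linear_continuous_on)
next
  case (Suc j)
  have D: "(f has_derivative f) (at x)" for x
    using bounded_linear.has_derivative[OF assms has_derivative_ident] by simp
  have "Ck_on (Suc j) UNIV f"
    by (rule Ck_on_SucI[where f' = "\<lambda>x. f"]) (auto intro: D Ck_on_const)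
  then show ?thesis using Suc Ck_on_subset by blast
qed

lemma Ck_on_add:
  assumes "open S" "Ck_on k S f" "Ck_on k S g"
  shows "Ck_on k S (\<lambda>x. f x + g x)"
  using assms(2,3)
proof (induction k arbitrary: f g)
  case 0
  then show ?case by (simp add: continuous_on_add)
next
  case (Suc k)
  show ?case
    by (rule Ck_on_SucI[OF assms(1) has_derivative_add[OF Ck_on_Suc_has_derivative
          Ck_on_Suc_has_derivative], OF Suc.prems(1) _ Suc.prems(2)])
       (use Suc in auto)
qed

text \<open>By the product rule a directional derivative is a sum of two products of the same kind, with one
  degree of differentiability less.\<close>

lemma Ck_on_bilinear:
  assumes "bounded_bilinear h" "open S" "Ck_on k S f" "Ck_on k S g"
  shows "Ck_on k S (\<lambda>x. h (f x) (g x))"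
  using assms(3,4)
proof (induction k arbitrary: f g)
  case 0
  then show ?case by (simp add: bounded_bilinear.continuous_on[OF assms(1)])
next
  case (Suc k)
  note fg = Suc.prems[THEN Ck_on_Suc_D]
  show ?case
    by (rule Ck_on_SucI[OF assms(2) bounded_bilinear.FDERIV[OF assms(1) Ck_on_Suc_has_derivative
          Ck_on_Suc_has_derivative], OF Suc.prems(1) _ Suc.prems(2)])
       (use Suc fg in \<open>auto intro!: Ck_on_add[OF assms(2)]\<close>)
qed

lemmas Ck_on_mult = Ck_on_bilinear[OF bounded_bilinear_mult]
lemmas Ck_on_scaleR = Ck_on_bilinear[OF bounded_bilinear_scaleR]
lemmas Ck_on_inner = Ck_on_bilinear[OF bounded_bilinear_inner]

lemma Ck_on_diff:
  assumes "open S" "Ck_on k S f" "Ck_on k S g"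
  shows "Ck_on k S (\<lambda>x. f x - g x)"
  using Ck_on_add[OF assms(1,2) Ck_on_scaleR[OF assms(1) Ck_on_const[of k S "-1"] assms(3)]]
  by simp

lemma Ck_on_sum:
  assumes "open S" "\<And>i. i \<in> I \<Longrightarrow> Ck_on k S (f i)"
  shows "Ck_on k S (\<lambda>x. \<Sum>i\<in>I. f i x)"
  using assms(2)
  by (induction I rule: infinite_finite_induct) (auto intro: Ck_on_const Ck_on_add[OF assms(1)])

lemma Ck_on_prod:
  fixes f :: "'i \<Rightarrow> 'a::euclidean_space \<Rightarrow> real"
  assumes "open S" "\<And>i. i \<in> I \<Longrightarrow> Ck_on k S (f i)"
  shows "Ck_on k S (\<lambda>x. \<Prod>i\<in>I. f i x)"
  using assms(2)
  by (induction I rule: infinite_finite_induct) (auto intro: Ck_on_const Ck_on_mult[OF assms(1)])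

text \<open>Expanding \<open>Df(x) v\<close> in the standard basis writes the directional derivative of the composite as
  a sum of products of a component of \<open>Df(x) v\<close> with a partial derivative of \<open>g\<close> composed with
  \<open>f\<close>; the induction hypothesis applies to the latter.\<close>

lemma Ck_on_compose:
  fixes f :: "'a::euclidean_space \<Rightarrow> 'b::euclidean_space" and g :: "'b \<Rightarrow> 'c::euclidean_space"
  assumes "open S" "open T" "f ` S \<subseteq> T" "Ck_on k S f" "Ck_on k T g"
  shows "Ck_on k S (\<lambda>x. g (f x))"
  using assms(4,5)
proof (induction k arbitrary: g)
  case 0
  then show ?case using continuous_on_compose2 assms(3) by auto
next
  case (Suc k)
  let ?Df = "\<lambda>x. frechet_derivative f (at x)" and ?Dg = "\<lambda>y. frechet_derivative g (at y)"
  have Df: "(f has_derivative ?Df x) (at x)" if "x \<in> S" for x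
    using Ck_on_Suc_has_derivative[OF Suc.prems(1) that] .
  have Dg: "(g has_derivative ?Dg (f x)) (at (f x))" if "x \<in> S" for x
    using Ck_on_Suc_has_derivative[OF Suc.prems(2)] that assms(3) by auto
  have D: "((\<lambda>x. g (f x)) has_derivative (\<lambda>v. \<Sum>b\<in>Basis. (?Df x v \<bullet> b) *\<^sub>R ?Dg (f x) b)) (at x)"
    if "x \<in> S" for x
  proof -
    have lin: "linear (?Dg (f x))" using Dg[OF that] has_derivative_linear by blast
    have "?Dg (f x) (?Df x v) = (\<Sum>b\<in>Basis. (?Df x v \<bullet> b) *\<^sub>R ?Dg (f x) b)" for v
    proof -
      have "?Dg (f x) (?Df x v) = ?Dg (f x) (\<Sum>b\<in>Basis. (?Df x v \<bullet> b) *\<^sub>R b)"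
        by (simp add: euclidean_representation)
      then show ?thesis by (simp add: linear_sum[OF lin] linear_cmul[OF lin])
    qed
    then show ?thesis
      using has_derivative_compose[OF Df[OF that] Dg[OF that]] by simp
  qed
  show ?case
  proof (rule Ck_on_SucI[OF assms(1) D])
    fix v
    have "Ck_on k S (\<lambda>x. ?Df x v \<bullet> b)" for b
      by (rule Ck_on_inner[OF assms(1)]) (use Suc.prems(1) Ck_on_const in auto)
    moreover have "Ck_on k S (\<lambda>x. ?Dg (f x) b)" for b
      by (rule Suc.IH) (use Suc.prems Ck_on_Suc_D in auto)
    ultimately show "Ck_on k S (\<lambda>x. \<Sum>b\<in>Basis. (?Df x v \<bullet> b) *\<^sub>R ?Dg (f x) b)"
      by (intro Ck_on_sum[OF assms(1)] Ck_on_scaleR[OF assms(1)])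
  qed
qed

lemma Ck_on_Suc_real:
  fixes g :: "real \<Rightarrow> real"
  assumes "open T" "\<And>x. x \<in> T \<Longrightarrow> (g has_real_derivative g' x) (at x)" "Ck_on k T g'"
  shows "Ck_on (Suc k) T g"
  by (rule Ck_on_SucI[OF assms(1), of _ "\<lambda>x v. g' x * v"])
     (use assms in \<open>auto simp: has_field_derivative_def intro: Ck_on_mult Ck_on_const\<close>)

lemma Ck_on_exp: "Ck_on k (UNIV :: real set) exp"
proof (induction k)
  case (Suc k)
  then show ?case by (intro Ck_on_Suc_real[where g' = exp] open_UNIV) (auto intro: DERIV_exp)
qed (simp add: continuous_on_exp)

lemma smooth_on_imp_Ck_on: "smooth_on S f \<Longrightarrow> Ck_on k S f"
  by (simp add: smooth_on_def)

lemma smooth_on_imp_continuous_on: "smooth_on S f \<Longrightarrow> continuous_on S f"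
  by (meson Ck_on_imp_continuous_on smooth_on_imp_Ck_on)

lemma smooth_on_has_derivative:
  "smooth_on S f \<Longrightarrow> x \<in> S \<Longrightarrow> (f has_derivative frechet_derivative f (at x)) (at x)"
  using Ck_on_Suc_has_derivative smooth_on_imp_Ck_on by blast

lemma smooth_on_derivative:
  assumes "smooth_on S f"
  shows "smooth_on S (\<lambda>x. frechet_derivative f (at x) v)"
  unfolding smooth_on_def
proof
  fix k
  show "Ck_on k S (\<lambda>x. frechet_derivative f (at x) v)"
    using smooth_on_imp_Ck_on[OF assms, of "Suc k"] by simp
qed

section \<open>Symmetry of second derivatives\<close>

text \<open>The second difference of \<open>u\<close> over a square of side \<open>e\<close> is \<open>e\<^sup>2\<close> times a value of either mixed
  derivative inside the square: apply the mean value theorem in one variable and then in the other,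
  in both orders. Then let \<open>e\<close> tend to zero.\<close>

lemma mixed_partials_commute_real:
  fixes u :: "real \<Rightarrow> real \<Rightarrow> real"
  assumes d: "0 < d"
    and us: "\<And>s t. \<bar>s\<bar> < d \<Longrightarrow> \<bar>t\<bar> < d \<Longrightarrow> ((\<lambda>s. u s t) has_real_derivative us s t) (at s)"
    and ut: "\<And>s t. \<bar>s\<bar> < d \<Longrightarrow> \<bar>t\<bar> < d \<Longrightarrow> (u s has_real_derivative ut s t) (at t)"
    and ust: "\<And>s t. \<bar>s\<bar> < d \<Longrightarrow> \<bar>t\<bar> < d \<Longrightarrow> (us s has_real_derivative ust s t) (at t)"
    and uts: "\<And>s t. \<bar>s\<bar> < d \<Longrightarrow> \<bar>t\<bar> < d \<Longrightarrow> ((\<lambda>s. ut s t) has_real_derivative uts s t) (at s)"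
    and cst: "isCont (\<lambda>(s, t). ust s t) (0, 0)"
    and cts: "isCont (\<lambda>(s, t). uts s t) (0, 0)"
  shows "ust 0 0 = uts 0 0"
proof -
  have ex: "\<exists>p q. norm p \<le> 2 * e \<and> norm q \<le> 2 * e \<and> (\<lambda>(s, t). ust s t) p = (\<lambda>(s, t). uts s t) q"
    if e: "0 < e" "e < d" for e
  proof -
    let ?D = "u e e - u e 0 - (u 0 e - u 0 0)"
    have "\<exists>s>0. s < e \<and> (u e e - u e 0) - (u 0 e - u 0 0) = (e - 0) * (us s e - us s 0)"
      by (rule MVT2[where f = "\<lambda>s. u s e - u s 0" and f' = "\<lambda>s. us s e - us s 0"])
         (use e in \<open>auto intro!: DERIV_diff us\<close>)
    then obtain s where s: "0 < s" "s < e" "?D = e * (us s e - us s 0)" by auto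
    have "\<exists>t>0. t < e \<and> us s e - us s 0 = (e - 0) * ust s t"
      by (rule MVT2) (use e s in \<open>auto intro!: ust\<close>)
    then obtain t where t: "0 < t" "t < e" "us s e - us s 0 = e * ust s t" by auto
    have "\<exists>t>0. t < e \<and> (u e e - u 0 e) - (u e 0 - u 0 0) = (e - 0) * (ut e t - ut 0 t)"
      by (rule MVT2[where f = "\<lambda>t. u e t - u 0 t" and f' = "\<lambda>t. ut e t - ut 0 t"])
         (use e d in \<open>auto intro!: DERIV_diff ut\<close>)
    then obtain t' where t': "0 < t'" "t' < e" "?D = e * (ut e t' - ut 0 t')"
      by (auto simp: algebra_simps)
    have "\<exists>s>0. s < e \<and> ut e t' - ut 0 t' = (e - 0) * uts s t'"
      by (rule MVT2) (use e t' in \<open>auto intro!: uts\<close>)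
    then obtain s' where s': "0 < s'" "s' < e" "ut e t' - ut 0 t' = e * uts s' t'" by auto
    have "ust s t = uts s' t'" using s(3) t(3) t'(3) s'(3) e by auto
    moreover have "norm (s, t) \<le> 2 * e"
      using norm_Pair_le[of s t] s t by auto
    moreover have "norm (s', t') \<le> 2 * e"
      using norm_Pair_le[of s' t'] s' t' by auto
    ultimately show ?thesis
      by (intro exI[of _ "(s, t)"] exI[of _ "(s', t')"]) simp
  qed
  define e where "e n = d / (real n + 2)" for n :: nat
  have e: "0 < e n" "e n < d" for n using d by (auto simp: e_def divide_simps)
  have "e \<longlonglongrightarrow> 0" unfolding e_def using LIMSEQ_ignore_initial_segment[OF lim_const_over_n[of d], of 2] by (simp add: add.commute)
  then have e0: "(\<lambda>n. 2 * e n) \<longlonglongrightarrow> 0" using tendsto_mult_right_zero by blast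
  obtain p q where pq: "\<And>n. norm (p n) \<le> 2 * e n" "\<And>n. norm (q n) \<le> 2 * e n"
      "\<And>n. (\<lambda>(s, t). ust s t) (p n) = (\<lambda>(s, t). uts s t) (q n)"
    using ex[OF e] by metis
  have "p \<longlonglongrightarrow> (0, 0)" "q \<longlonglongrightarrow> (0, 0)"
    using Lim_null_comparison[OF _ e0, of p] Lim_null_comparison[OF _ e0, of q] pq(1,2)
    by (auto simp: zero_prod_def)
  then have "(\<lambda>n. (\<lambda>(s, t). ust s t) (p n)) \<longlonglongrightarrow> ust 0 0" "(\<lambda>n. (\<lambda>(s, t). uts s t) (q n)) \<longlonglongrightarrow> uts 0 0"
    using isCont_tendsto_compose[OF cst] isCont_tendsto_compose[OF cts] by auto
  then show ?thesis using pq(3) LIMSEQ_unique by simp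
qed

text \<open>Restrict \<open>f\<close> to the plane through \<open>x\<close> spanned by \<open>v\<close> and \<open>w\<close>, and take one component.\<close>

lemma second_derivative_symmetric:
  fixes f :: "'a::euclidean_space \<Rightarrow> 'b::euclidean_space"
  assumes S: "open S" "x \<in> S" and f: "Ck_on 2 S f"
  shows "frechet_derivative (\<lambda>y. frechet_derivative f (at y) v) (at x) w =
         frechet_derivative (\<lambda>y. frechet_derivative f (at y) w) (at x) v"
proof (rule euclidean_eqI)
  fix b :: 'b
  assume "b \<in> Basis"
  let ?D = "\<lambda>v y. frechet_derivative f (at y) v"
  let ?DD = "\<lambda>v w y. frechet_derivative (?D v) (at y) w"
  have 2: "Ck_on (Suc (Suc 0)) S f" using f by (simp add: numeral_2_eq_2)
  have D: "(f has_derivative (\<lambda>v. ?D v y)) (at y)" if "y \<in> S" for y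
    using Ck_on_Suc_has_derivative[OF 2 that] .
  have DD: "(?D v has_derivative (\<lambda>w. ?DD v w y)) (at y)" if "y \<in> S" for y v
    using Ck_on_Suc_has_derivative[of 0 S "?D v" y] 2 that by simp
  have cDD: "continuous_on S (?DD v w)" for v w using 2 by simp
  define M where "M = norm v + norm w + 1"
  have M: "0 < M" by (simp add: M_def add_nonneg_pos)
  obtain r where r: "0 < r" "ball x r \<subseteq> S" using S open_contains_ball by blast
  define d where "d = r / (2 * M)"
  have d: "0 < d" using r M by (simp add: d_def)
  let ?y = "\<lambda>s t. x + s *\<^sub>R v + t *\<^sub>R w"
  have y: "?y s t \<in> S" if "\<bar>s\<bar> < d" "\<bar>t\<bar> < d" for s t
  proof -
    have "norm (s *\<^sub>R v + t *\<^sub>R w) \<le> \<bar>s\<bar> * norm v + \<bar>t\<bar> * norm w"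
      using norm_triangle_ineq[of "s *\<^sub>R v" "t *\<^sub>R w"] by simp
    also have "\<dots> \<le> d * norm v + d * norm w"
      using that by (intro add_mono mult_right_mono) auto
    also have "\<dots> < d * M + d * M" 
      using d mult_nonneg_nonneg[OF less_imp_le[OF d] norm_ge_zero[of v]]
        mult_nonneg_nonneg[OF less_imp_le[OF d] norm_ge_zero[of w]]
      unfolding M_def distrib_left mult_1_right by linarith
    also have "\<dots> = r" using M by (simp add: d_def field_simps)
    finally have "?y s t \<in> ball x r" using norm_minus_cancel[of "s *\<^sub>R v + t *\<^sub>R w"]
      by (simp add: dist_norm)
    then show ?thesis using r by blast
  qed
  have ds: "((\<lambda>s. ?y s t) has_derivative (\<lambda>h. h *\<^sub>R v)) (at s)" for s t
    by (auto intro!: derivative_eq_intros)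
  have dt: "((\<lambda>t. ?y s t) has_derivative (\<lambda>h. h *\<^sub>R w)) (at t)" for s t
    by (auto intro!: derivative_eq_intros)
  have chain: "((\<lambda>s. g (c s) \<bullet> b) has_real_derivative g' z \<bullet> b) (at s)"
    if "(g has_derivative g') (at (c s))" "(c has_derivative (\<lambda>h. h *\<^sub>R z)) (at s)"
    for g g' c z s
  proof -
    have "((\<lambda>s. g (c s)) has_derivative (\<lambda>h. g' (h *\<^sub>R z))) (at s)"
      using has_derivative_compose[OF that(2,1)] .
    then have "((\<lambda>s. g (c s)) has_derivative (\<lambda>h. h *\<^sub>R g' z)) (at s)"
      using has_derivative_linear[OF that(1)] by (simp add: linear_cmul)
    from has_derivative_inner_left[OF this, of b] show ?thesis
      by (simp add: has_field_derivative_def mult_commute_abs)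
  qed
  have cont: "isCont (\<lambda>(s, t). ?DD v' w' (?y s t) \<bullet> b) (0, 0)" for v' w'
  proof -
    have "isCont (?DD v' w') x" using cDD S continuous_on_eq_continuous_at by blast
    then have *: "isCont (?DD v' w') (?y (fst (0, 0)) (snd (0, 0)))" by simp
    have "isCont (\<lambda>z. ?DD v' w' (?y (fst z) (snd z)) \<bullet> b) (0, 0)"
      by (intro continuous_intros isCont_o2[where f = "\<lambda>z. ?y (fst z) (snd z)" and g = "?DD v' w'", OF _ *])
    then show ?thesis by (simp add: case_prod_unfold)
  qed
  have "?DD v w (?y 0 0) \<bullet> b = ?DD w v (?y 0 0) \<bullet> b"
  proof (rule mixed_partials_commute_real[where u = "\<lambda>s t. f (?y s t) \<bullet> b" and
        us = "\<lambda>s t. ?D v (?y s t) \<bullet> b" and ut = "\<lambda>s t. ?D w (?y s t) \<bullet> b"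
        and ust = "\<lambda>s t. ?DD v w (?y s t) \<bullet> b" and uts = "\<lambda>s t. ?DD w v (?y s t) \<bullet> b", OF d])
    fix s t :: real
    assume st: "\<bar>s\<bar> < d" "\<bar>t\<bar> < d"
    show "((\<lambda>s. f (?y s t) \<bullet> b) has_real_derivative ?D v (?y s t) \<bullet> b) (at s)"
      by (rule chain[OF D[OF y[OF st]] ds])
    show "((\<lambda>t. f (?y s t) \<bullet> b) has_real_derivative ?D w (?y s t) \<bullet> b) (at t)"
      by (rule chain[OF D[OF y[OF st]] dt])
    show "((\<lambda>t. ?D v (?y s t) \<bullet> b) has_real_derivative ?DD v w (?y s t) \<bullet> b) (at t)"
      by (rule chain[OF DD[OF y[OF st]] dt])
    show "((\<lambda>s. ?D w (?y s t) \<bullet> b) has_real_derivative ?DD w v (?y s t) \<bullet> b) (at s)"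
      by (rule chain[OF DD[OF y[OF st]] ds])
  qed (rule cont)+
  then show "?DD v w x \<bullet> b = ?DD w v x \<bullet> b" by simp
qed

section \<open>Smooth bump functions\<close>

text \<open>The classical function that vanishes to infinite order at zero. The powers of \<open>1 / s\<close> make
  the family closed under differentiation, up to linear combinations, which is how smoothness is
  proved.\<close>

definition flat :: "nat \<Rightarrow> real \<Rightarrow> real" where
  "flat m s = (if s > 0 then (1 / s) ^ m * exp (- (1 / s)) else 0)"

lemma flat_tendsto_0: "(flat m \<longlongrightarrow> 0) (at 0)"
proof -
  have "((\<lambda>s. (1 / s) ^ m * exp (- (1 / s))) \<longlongrightarrow> 0) (at_right (0::real))"
  proof -
    have "((\<lambda>s. inverse s ^ m / exp (inverse s)) \<longlongrightarrow> 0) (at_right (0::real))"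
      by (rule filterlim_compose[OF tendsto_power_div_exp_0 filterlim_inverse_at_top_right])
    then show ?thesis by (simp add: exp_minus divide_inverse)
  qed
  moreover have "\<forall>\<^sub>F s in at_right 0. (1 / s) ^ m * exp (- (1 / s)) = flat m s"
    using eventually_at_right_less[of "0::real"] by eventually_elim (simp add: flat_def)
  ultimately have "(flat m \<longlongrightarrow> 0) (at_right 0)"
    by (rule Lim_transform_eventually)
  moreover have "\<forall>\<^sub>F s in at_left 0. 0 = flat m s"
    by (auto simp: flat_def eventually_at_left_field intro!: exI[of _ "-1"])
  then have "(flat m \<longlongrightarrow> 0) (at_left 0)"
    by (rule Lim_transform_eventually[OF tendsto_const])
  ultimately show ?thesis by (simp add: filterlim_split_at)
qed

lemma flat_has_derivative:
  "(flat m has_real_derivative (flat (m + 2) s - real m * flat (m + 1) s)) (at s)"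
proof -
  consider "s > 0" | "s < 0" | "s = 0" by linarith
  then show ?thesis
  proof cases
    case 1
    have "((\<lambda>s. (1 / s) ^ m * exp (- (1 / s))) has_real_derivative
        (flat (m + 2) s - real m * flat (m + 1) s)) (at s)"
      using 1 by (auto intro!: derivative_eq_intros simp: flat_def field_simps power2_eq_square)
         (cases m; simp add: field_simps)
    then show ?thesis
      by (rule has_field_derivative_transform_within_open[where S = "{0<..}"]) (use 1 in \<open>auto simp: flat_def\<close>)
  next
    case 2
    have "((\<lambda>s. 0) has_real_derivative (flat (m + 2) s - real m * flat (m + 1) s)) (at s)"
      using 2 by (simp add: flat_def)
    then show ?thesis
      by (rule has_field_derivative_transform_within_open[where S = "{..<0}"]) (use 2 in \<open>auto simp: flat_def\<close>)
  next
    case 3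
    have flat0: "flat j 0 = 0" for j by (simp add: flat_def)
    have "(flat m h - flat m 0) / h = flat (m + 1) h" for h :: real
      by (simp add: flat_def)
    then show ?thesis
      using 3 flat_tendsto_0[of "m + 1"] by (simp add: has_field_derivative_iff flat0)
  qed
qed

lemma Ck_on_flat: "Ck_on k UNIV (flat m)"
proof (induction k arbitrary: m)
  case 0
  then show ?case
    using DERIV_isCont[OF flat_has_derivative] by (simp add: continuous_at_imp_continuous_on)
next
  case (Suc k)
  show ?case
    by (rule Ck_on_Suc_real[OF open_UNIV flat_has_derivative])
       (intro Ck_on_diff Ck_on_mult Ck_on_const Suc open_UNIV)
qed

definition bump :: "'a::euclidean_space \<Rightarrow> real \<Rightarrow> 'a \<Rightarrow> real" where
  "bump a r x = flat 0 (r\<^sup>2 - (x - a) \<bullet> (x - a))"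

lemma smooth_on_bump: "smooth_on UNIV (bump a r)"
  unfolding smooth_on_def
proof
  fix k
  have d: "Ck_on k UNIV (\<lambda>x. x - a)"
    by (intro Ck_on_diff Ck_on_const Ck_on_bounded_linear bounded_linear_ident open_UNIV)
  have "Ck_on k UNIV (\<lambda>x. r\<^sup>2 - (x - a) \<bullet> (x - a))"
    by (rule Ck_on_diff[OF open_UNIV Ck_on_const Ck_on_inner[OF open_UNIV d d]])
  from Ck_on_compose[OF open_UNIV open_UNIV subset_UNIV this Ck_on_flat]
  show "Ck_on k UNIV (bump a r)" by (simp add: bump_def[abs_def])
qed

lemma bump_nonneg: "0 \<le> bump a r x"
  by (simp add: bump_def flat_def)

lemma bump_pos_iff: "0 < r \<Longrightarrow> 0 < bump a r x \<longleftrightarrow> x \<in> ball a r"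
  by (simp add: bump_def flat_def dist_norm norm_minus_commute flip: power2_norm_eq_inner)
     (metis power2_less_imp_less less_eq_real_def norm_ge_zero power_strict_mono zero_less_numeral)


section \<open>Orthonormal frames and determinants\<close>

definition form_matrix :: "(real ^ 'n \<Rightarrow> real ^ 'n \<Rightarrow> real) \<Rightarrow> real ^ 'n::finite ^ 'n" where
  "form_matrix b = (\<chi> i j. b (axis i 1) (axis j 1))"

text \<open>The matrix of a bilinear form in a new basis, given by the columns of \<open>A\<close>.\<close>

lemma form_matrix_congruence:
  assumes "bilinear b"
  shows "transpose A ** form_matrix b ** A = (\<chi> i j. b (column i A) (column j A))"
proof -
  have exp: "x = (\<Sum>k\<in>UNIV. x $ k *\<^sub>R axis k 1)" for x :: "real ^ 'n"
    using basis_expansion[of x] by (simp add: scalar_mult_eq_scaleR)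
  have lin: "linear (\<lambda>x. b x y)" "linear (b x)" for x y
    using assms by (auto simp: bilinear_def)
  have expand: "b x y = (\<Sum>l\<in>UNIV. \<Sum>k\<in>UNIV. y $ l * (x $ k * b (axis k 1) (axis l 1)))" for x y
  proof -
    have "b x y = b (\<Sum>k\<in>UNIV. x $ k *\<^sub>R axis k 1) (\<Sum>l\<in>UNIV. y $ l *\<^sub>R axis l 1)"
      using exp[of x] exp[of y] by simp
    then show ?thesis
      by (simp add: linear_sum[OF lin(1)] linear_sum[OF lin(2)] linear_cmul[OF lin(1)]
          linear_cmul[OF lin(2)] sum_distrib_left)
  qed
  have "b (column i A) (column j A) = (transpose A ** form_matrix b ** A) $ i $ j" for i j
    unfolding expand[of "column i A" "column j A"]
    by (simp add: matrix_matrix_mult_def transpose_def column_def form_matrix_def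
        sum_distrib_left mult.assoc mult.commute)
  then show ?thesis by (simp add: vec_eq_iff)
qed

definition orthonormal_for :: "(real ^ 'n \<Rightarrow> real ^ 'n \<Rightarrow> real) \<Rightarrow> ('n \<Rightarrow> real ^ 'n::finite) \<Rightarrow> bool" where
  "orthonormal_for g v \<longleftrightarrow> (\<forall>i j. g (v i) (v j) = (if i = j then 1 else 0))"

text \<open>For invertible \<open>G\<close> this is \<open>det G\<close> times the trace of the inverse of \<open>G\<close> times \<open>M\<close>. In
  this form it is visibly a polynomial in the entries, hence continuous.\<close>

definition row_trace :: "real ^ 'n ^ 'n \<Rightarrow> real ^ 'n::finite ^ 'n \<Rightarrow> real" where
  "row_trace G M = (\<Sum>k\<in>UNIV. det (\<chi> i. if i = k then M $ i else G $ i))"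

text \<open>Jacobi's formula: differentiate the products in the Leibniz expansion and collect, for each row,
  the terms in which the entry of that row is differentiated.\<close>

lemma det_has_real_derivative:
  fixes G :: "real \<Rightarrow> real ^ 'n::finite ^ 'n"
  assumes "\<And>i j. ((\<lambda>t. G t $ i $ j) has_real_derivative M $ i $ j) (at t)"
  shows "((\<lambda>t. det (G t)) has_real_derivative row_trace (G t) M) (at t)"
proof -
  have "((\<lambda>t. det (G t)) has_real_derivative
      (\<Sum>p\<in>{p. p permutes (UNIV :: 'n set)}. of_int (sign p) *
        (\<Sum>k\<in>UNIV. M $ k $ p k * (\<Prod>i\<in>UNIV - {k}. G t $ i $ p i)))) (at t)"
    unfolding det_def
    by (intro DERIV_sum DERIV_cmult has_field_derivative_prod assms)
  also have "(\<Sum>p\<in>{p. p permutes (UNIV :: 'n set)}. of_int (sign p) *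
        (\<Sum>k\<in>UNIV. M $ k $ p k * (\<Prod>i\<in>UNIV - {k}. G t $ i $ p i))) = row_trace (G t) M"
  proof -
    have "M $ k $ p k * (\<Prod>i\<in>UNIV - {k}. G t $ i $ p i) =
        (\<Prod>i\<in>UNIV. (if i = k then M $ i else G t $ i) $ p i)" for k p
      by (subst (2) prod.remove[of _ k]) (auto intro!: prod.cong)
    then show ?thesis
      unfolding row_trace_def det_def
      by (subst sum.swap) (simp add: sum_distrib_left)
  qed
  finally show ?thesis .
qed

text \<open>Let \<open>P\<close> have the frame vectors as columns and let \<open>G\<close> be the matrix of \<open>g\<close>. Orthonormality reads
  \<open>P\<^sup>T G P = 1\<close>, so \<open>P P\<^sup>T\<close> is the inverse of \<open>G\<close> and the trace of \<open>M P P\<^sup>T\<close> is the sum over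
  the frame; Cramer's rule identifies it with the sum of determinants.

  The lemma is used for the second fundamental form, whose trace is thereby independent of the
  frame and continuous, and for the time derivative of the Gram matrix, where Jacobi's formula
  becomes the mean curvature.\<close>

lemma row_trace_frame:
  assumes g: "bilinear g" and b: "bilinear b" and v: "orthonormal_for g v"
  shows "0 < det (form_matrix g)"
    and "row_trace (form_matrix g) (form_matrix b) = det (form_matrix g) * (\<Sum>i\<in>UNIV. b (v i) (v i))"
proof -
  let ?G = "form_matrix g" and ?M = "form_matrix b"
  define P where "P = (\<chi> k i. v i $ k)"
  have col: "column i P = v i" for i by (simp add: P_def column_def vec_eq_iff)
  have PGP: "transpose P ** ?G ** P = mat 1"
    using form_matrix_congruence[OF g, of P] v by (simp add: col orthonormal_for_def mat_def)
  have detP: "det P * det P * det ?G = 1"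
    using arg_cong[OF PGP, of det] by (simp add: det_mul mult_ac)
  have "0 < det P * det P"
    using detP by (metis mult_zero_left not_real_square_gt_zero zero_neq_one)
  then show "0 < det ?G"
    using detP by (metis zero_less_mult_pos zero_less_one)
  have "P ** (transpose P ** ?G) = mat 1" using PGP matrix_left_right_inverse by blast
  then have inv: "(P ** transpose P) ** ?G = mat 1" by (simp add: matrix_mul_assoc)
  define A where "A = ?M ** (P ** transpose P)"
  have "A ** ?G = ?M ** ((P ** transpose P) ** ?G)" by (simp only: A_def matrix_mul_assoc)
  then have MA: "?M = A ** ?G" by (simp add: inv)
  have "det (\<chi> i. if i = k then ?M $ i else ?G $ i) = A $ k $ k * det ?G" for k
  proof -
    have "?M $ k = (\<Sum>i\<in>UNIV. A $ k $ i *s row i ?G)"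
      by (subst MA) (simp add: matrix_matrix_mult_def row_def vec_eq_iff sum_component)
    then have "(\<chi> i. if i = k then ?M $ i else ?G $ i) =
        (\<chi> i. if i = k then (\<Sum>i\<in>UNIV. (A $ k) $ i *s row i ?G) else row i ?G)"
      by (simp add: vec_eq_iff row_def)
    then show ?thesis using cramer_lemma_transpose[of k "A $ k" ?G] by simp
  qed
  then have "row_trace ?G ?M = trace A * det ?G"
    by (simp add: row_trace_def trace_def sum_distrib_right)
  also have "trace A = trace (transpose P ** ?M ** P)"
    unfolding A_def matrix_mul_assoc by (subst trace_mul_sym) (simp add: matrix_mul_assoc)
  also have "\<dots> = (\<Sum>i\<in>UNIV. b (v i) (v i))"
    by (simp add: form_matrix_congruence[OF b] col trace_def)
  finally show "row_trace ?G ?M = det ?G * (\<Sum>i\<in>UNIV. b (v i) (v i))" by simp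
qed

lemma bilinear_pullback_inner:
  assumes "linear L" "linear L'"
  shows "bilinear (\<lambda>v w. L v \<bullet> L' w)"
  using assms by (auto simp: bilinear_def linear_iff inner_add inner_simps)

text \<open>Pull back an orthonormal basis of the range of \<open>L\<close>.\<close>

lemma exists_orthonormal_for:
  fixes L :: "real ^ 'n::finite \<Rightarrow> 'e::euclidean_space"
  assumes "linear L" "inj L"
  obtains v where "orthonormal_for (\<lambda>v w. L v \<bullet> L w) v"
proof -
  have "subspace (range L)" using assms(1) subspace_UNIV linear_subspace_image by blast
  then have "\<exists>B \<subseteq> range L. pairwise orthogonal B \<and> (\<forall>x\<in>B. norm x = 1) \<and> independent B \<and>
      card B = dim (range L)"
    by (metis orthonormal_basis_subspace)
  then obtain B where B: "B \<subseteq> range L" "pairwise orthogonal B" "\<And>x. x \<in> B \<Longrightarrow> norm x = 1"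
    "independent B" "card B = dim (range L)"
    by blast
  have "card B = CARD('n)" using B(5) dim_image_eq[OF assms(1), of UNIV] assms(2) by simp
  moreover have "finite B" using B(4) independent_imp_finite by blast
  ultimately obtain h where h: "bij_betw h (UNIV :: 'n set) B"
    using finite_same_card_bij[of "UNIV :: 'n set" B] by auto
  have hB: "h i \<in> B" for i using h by (auto simp: bij_betw_def)
  have "L (inv L (h i)) = h i" for i using hB B(1) by (meson f_inv_into_f subsetD)
  moreover have "h i \<bullet> h j = (if i = j then 1 else 0)" for i j
  proof (cases "i = j")
    case True
    then show ?thesis using B(3)[OF hB] by (simp add: norm_eq_1)
  next
    case False
    then have "h i \<noteq> h j" using h by (auto simp: bij_betw_def inj_on_def)
    then show ?thesis using False B(2) hB by (auto simp: pairwise_def orthogonal_def)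
  qed
  ultimately show ?thesis
    by (intro that[of "\<lambda>i. inv L (h i)"]) (simp add: orthonormal_for_def)
qed

lemma det_gram_compose:
  assumes "linear L"
  shows "det (form_matrix (\<lambda>v w. L (A *v v) \<bullet> L (A *v w))) =
    (det A)\<^sup>2 * det (form_matrix (\<lambda>v w. L v \<bullet> L w))"
proof -
  have "form_matrix (\<lambda>v w. L (A *v v) \<bullet> L (A *v w)) =
      transpose A ** form_matrix (\<lambda>v w. L v \<bullet> L w) ** A"
    unfolding form_matrix_congruence[OF bilinear_pullback_inner[OF assms assms]]
    by (simp add: form_matrix_def matrix_vector_mult_basis)
  then show ?thesis by (simp add: det_mul power2_eq_square)
qed


section \<open>Change of variables\<close>

text \<open>A copy of a finite index type that carries a well-order, taken from an arbitrary numbering of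
  the elements. Relabelling coordinates along it extends the change of variables formula from
  well-ordered index types to all finite ones.\<close>

typedef 'a ordered_copy = "UNIV :: 'a set" morphisms of_ordered to_ordered by simp

lemma bij_of_ordered: "bij of_ordered"
  by (metis UNIV_I bij_betw_def inj_onI of_ordered_inject of_ordered_inverse surj_def to_ordered_inverse)

instance ordered_copy :: (finite) finite
proof
  have "finite (of_ordered -` (UNIV :: 'a set))"
    by (rule finite_vimageI) (use bij_of_ordered in \<open>auto simp: bij_betw_def\<close>)
  then show "finite (UNIV :: 'a ordered_copy set)" by simp
qed

definition index_rank :: "'a::finite ordered_copy \<Rightarrow> nat" where
  "index_rank = (SOME f. inj f)"

lemma inj_index_rank: "inj (index_rank :: 'a::finite ordered_copy \<Rightarrow> nat)"
proof -
  have "\<exists>f :: 'a ordered_copy \<Rightarrow> nat. inj f"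
    using finite_imp_inj_to_nat_seg[of "UNIV :: 'a ordered_copy set"] by auto
  then show ?thesis unfolding index_rank_def by (rule someI_ex)
qed

instantiation ordered_copy :: (finite) linorder
begin

definition less_eq_ordered_copy :: "'a ordered_copy \<Rightarrow> 'a ordered_copy \<Rightarrow> bool" where
  "less_eq_ordered_copy x y \<longleftrightarrow> index_rank x \<le> index_rank y"

definition less_ordered_copy :: "'a ordered_copy \<Rightarrow> 'a ordered_copy \<Rightarrow> bool" where
  "less_ordered_copy x y \<longleftrightarrow> index_rank x < index_rank y"

instance
  by standard (auto simp: less_eq_ordered_copy_def less_ordered_copy_def
      dest: injD[OF inj_index_rank])

end

instance ordered_copy :: (finite) wellorder
proof (rule wf_wellorderI)
  have "{(x, y :: 'a ordered_copy). x < y} = inv_image less_than index_rank"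
    by (auto simp: less_ordered_copy_def inv_image_def)
  then show "wf {(x, y :: 'a ordered_copy). x < y}" by simp
qed intro_classes

text \<open>Conjugation with \<open>f\<close> is a sign-preserving bijection between the permutations of the two index
  types.\<close>

lemma det_reindex:
  fixes A :: "real ^ 'n::finite ^ 'n" and f :: "'m::finite \<Rightarrow> 'n"
  assumes "bij f"
  shows "det (\<chi> i j. A $ f i $ f j) = det A"
proof -
  let ?g = "inv f"
  have fg: "f (?g x) = x" "?g (f y) = y" for x y
    using assms by (simp_all add: bij_is_inj bij_is_surj surj_f_inv_f)
  have perm: "q permutes UNIV \<longleftrightarrow> bij q" for q :: "'k \<Rightarrow> 'k"
    by (auto intro: permutes_bij bij_imp_permutes)
  have conj: "f \<circ> (?g \<circ> p \<circ> f) \<circ> ?g = p" "?g \<circ> (f \<circ> q \<circ> ?g) \<circ> f = q" for p q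
    by (simp_all add: fun_eq_iff fg)
  have "det A = (\<Sum>q\<in>{q. q permutes (UNIV :: 'm set)}.
      of_int (sign (f \<circ> q \<circ> ?g)) * (\<Prod>i\<in>UNIV. A $ i $ (f \<circ> q \<circ> ?g) i))"
    unfolding det_def
    by (rule sum.reindex_bij_witness[where i = "\<lambda>q. f \<circ> q \<circ> ?g" and j = "\<lambda>p. ?g \<circ> p \<circ> f"])
       (auto simp: conj perm simp del: o_apply intro!: bij_comp assms bij_imp_bij_inv)
  also have "\<dots> = det (\<chi> i j. A $ f i $ f j)"
    unfolding det_def
  proof (rule sum.cong)
    fix q :: "'m \<Rightarrow> 'm"
    assume "q \<in> {q. q permutes UNIV}"
    then have q: "q permutes UNIV" by simp
    have "map_permutation UNIV f q = f \<circ> q \<circ> ?g"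
      using assms by (simp add: map_permutation_def restrict_id_def bij_is_surj fun_eq_iff)
    then have "sign (f \<circ> q \<circ> ?g) = sign q"
      using sign_map_permutation[of f UNIV q] q assms by (simp add: bij_is_inj)
    moreover have "(\<Prod>i\<in>UNIV. A $ i $ (f \<circ> q \<circ> ?g) i) = (\<Prod>i\<in>UNIV. A $ f i $ f (q i))"
      by (rule prod.reindex_bij_witness[where i = f and j = ?g]) (simp_all add: fg)
    ultimately show "of_int (sign (f \<circ> q \<circ> ?g)) * (\<Prod>i\<in>UNIV. A $ i $ (f \<circ> q \<circ> ?g) i) =
        of_int (sign q) * (\<Prod>i\<in>UNIV. (\<chi> i j. A $ f i $ f j) $ i $ q i)"
      by simp
  qed simp
  finally show ?thesis by simp
qed

definition reindex :: "('m \<Rightarrow> 'n) \<Rightarrow> real ^ 'n \<Rightarrow> real ^ 'm" where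
  "reindex f x = (\<chi> i. x $ f i)"

lemma linear_reindex: "linear (reindex f)"
  by (rule linearI) (simp_all add: reindex_def vec_eq_iff)

lemma measurable_reindex: "reindex (f :: 'm::finite \<Rightarrow> 'n::finite) \<in> borel_measurable borel"
  by (intro borel_measurable_continuous_onI linear_continuous_on linear_conv_bounded_linear[THEN iffD1] linear_reindex)

text \<open>Boxes go to boxes with the same side lengths in another order.\<close>

lemma distr_lborel_reindex:
  fixes f :: "'m::finite \<Rightarrow> 'n::finite"
  assumes "bij f"
  shows "distr lborel borel (reindex f) = lborel"
proof (rule lborel_eqI[symmetric])
  fix l u :: "real ^ 'm"
  assume le: "\<And>b. b \<in> Basis \<Longrightarrow> l \<bullet> b \<le> u \<bullet> b"
  have Basis: "(\<Prod>b\<in>Basis. x \<bullet> b) = (\<Prod>i\<in>UNIV. x $ i)" for x :: "real ^ 'k::finite"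
  proof -
    have B: "(Basis :: (real ^ 'k) set) = range (\<lambda>i. axis i 1)" by (auto simp: Basis_vec_def)
    show ?thesis
      unfolding B by (subst prod.reindex) (auto simp: inj_on_def axis_eq_axis inner_axis)
  qed
  let ?h = "reindex (inv f)"
  have le': "?h l \<bullet> b \<le> ?h u \<bullet> b" if "b \<in> Basis" for b :: "real ^ 'n"
  proof -
    have "l $ i \<le> u $ i" for i using le[of "axis i 1"] by (auto simp: Basis_vec_def inner_axis)
    then show ?thesis using that by (auto simp: Basis_vec_def inner_axis reindex_def)
  qed
  have fg: "f (inv f x) = x" "inv f (f y) = y" for x y
    using assms by (simp_all add: bij_is_inj bij_is_surj surj_f_inv_f)
  have "reindex f -` box l u = box (?h l) (?h u)"
    by (auto simp: mem_box_cart reindex_def fg) (metis fg)+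
  then have "emeasure (distr lborel borel (reindex f)) (box l u) = emeasure lborel (box (?h l) (?h u))"
    by (simp add: emeasure_distr measurable_reindex)
  also have "\<dots> = (\<Prod>b\<in>Basis. (?h u - ?h l) \<bullet> b)"
    by (rule emeasure_lborel_box[OF le'])
  also have "(\<Prod>b\<in>Basis. (?h u - ?h l) \<bullet> b) = (\<Prod>b\<in>Basis. (u - l) \<bullet> b)"
    unfolding Basis
    by (rule prod.reindex_bij_witness[where i = f and j = "inv f"]) (simp_all add: reindex_def fg)
  finally show "emeasure (distr lborel borel (reindex f)) (box l u) = (\<Prod>b\<in>Basis. (u - l) \<bullet> b)" .
qed simp

lemma nn_integral_eq_of_absolutely_integrable:
  fixes f :: "'a::euclidean_space \<Rightarrow> real"
  assumes "f absolutely_integrable_on S" "\<And>x. 0 \<le> f x" "f \<in> borel_measurable borel" "S \<in> sets borel"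
  shows "(\<integral>\<^sup>+x\<in>S. ennreal (f x) \<partial>lborel) = ennreal (integral S f)"
proof -
  have "(\<integral>\<^sup>+x\<in>S. ennreal (f x) \<partial>lborel) = (\<integral>\<^sup>+x. ennreal (indicator S x *\<^sub>R f x) \<partial>lebesgue)"
    by (subst nn_integral_completion)
       (use assms in \<open>auto intro!: nn_integral_cong split: split_indicator\<close>)
  also have "\<dots> = ennreal (LINT x|lebesgue. indicator S x *\<^sub>R f x)"
    by (rule nn_integral_eq_integral) (use assms in \<open>auto simp: set_integrable_def\<close>)
  also have "\<dots> = ennreal (integral S f)"
    using set_lebesgue_integral_eq_integral(2)[OF assms(1)] by (simp add: set_lebesgue_integral_def)
  finally show ?thesis .
qed

text \<open>Both sides may be infinite. On the part of \<open>S\<close> where \<open>x\<close> and \<open>h x\<close> are bounded by \<open>m\<close>, the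
  integrand is absolutely integrable and the change of variables formula for such functions
  applies; monotone convergence in \<open>m\<close> gives the claim.\<close>

lemma nn_integral_change_of_variables_wellorder:
  fixes f h :: "real ^ 'm::{finite,wellorder} \<Rightarrow> real" and \<psi> :: "real ^ 'm::_ \<Rightarrow> real ^ 'm::_"
  assumes S: "S \<in> sets borel"
    and im: "\<And>T. T \<in> sets borel \<Longrightarrow> T \<subseteq> S \<Longrightarrow> \<psi> ` T \<in> sets borel"
    and der: "\<And>x. x \<in> S \<Longrightarrow> (\<psi> has_derivative \<psi>' x) (at x)"
    and inj: "inj_on \<psi> S"
    and f: "f \<in> borel_measurable borel" "\<And>x. 0 \<le> f x"
    and h: "h \<in> borel_measurable borel" "\<And>x. 0 \<le> h x"
    and eq: "\<And>x. x \<in> S \<Longrightarrow> h x = \<bar>det (matrix (\<psi>' x))\<bar> * f (\<psi> x)"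
  shows "(\<integral>\<^sup>+y\<in>\<psi> ` S. ennreal (f y) \<partial>lborel) = (\<integral>\<^sup>+x\<in>S. ennreal (h x) \<partial>lborel)"
proof -
  define T where "T m = {x \<in> S. h x \<le> real m \<and> norm x \<le> real m}" for m :: nat
  have TS: "T m \<subseteq> S" for m by (auto simp: T_def)
  have T: "T m \<in> sets borel" for m
  proof -
    have "T m = S \<inter> {x \<in> space borel. h x \<le> real m} \<inter> cball 0 (real m)" by (auto simp: T_def)
    moreover have "{x \<in> space borel. h x \<le> real m} \<in> sets borel" using h(1) by measurable
    ultimately show ?thesis using S by auto
  qed
  have piece: "(\<integral>\<^sup>+y\<in>\<psi> ` T m. ennreal (f y) \<partial>lborel) = (\<integral>\<^sup>+x\<in>T m. ennreal (h x) \<partial>lborel)" for m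
  proof -
    have "bounded (T m)" unfolding bounded_iff T_def by blast
    then have "(\<lambda>x. real m) integrable_on T m"
      using T by (intro integrable_on_const bounded_set_imp_lmeasurable) auto
    then have ai: "h absolutely_integrable_on T m"
      by (rule measurable_bounded_by_integrable_imp_absolutely_integrable[rotated 2])
         (use T h in \<open>auto simp: T_def intro!: measurable_restrict_space1 measurable_completion\<close>)
    let ?D = "\<lambda>x. \<bar>det (matrix (\<psi>' x))\<bar> *\<^sub>R (vec (f (\<psi> x)) :: real ^ 1)"
    have Dh: "?D x = vec (h x)" if "x \<in> T m" for x
      using eq[OF subsetD[OF TS that]] by (simp add: vec_eq_iff)
    have "(\<lambda>x. vec (h x) :: real ^ 1) absolutely_integrable_on T m"
      using ai by (simp add: absolutely_integrable_on_1_iff)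
    then have "?D absolutely_integrable_on T m"
      by (rule set_integrable_cong[THEN iffD1, rotated -1]) (use Dh in auto)
    moreover have "integral (T m) ?D = integral (T m) (\<lambda>x. vec (h x) :: real ^ 1)"
      by (rule integral_cong) (use Dh in auto)
    ultimately have "(\<lambda>x. vec (f x) :: real ^ 1) absolutely_integrable_on (\<psi> ` T m) \<and>
        integral (\<psi> ` T m) (\<lambda>x. vec (f x) :: real ^ 1) = integral (T m) (\<lambda>x. vec (h x) :: real ^ 1)"
      by (intro has_absolute_integral_change_of_variables[where g' = \<psi>', THEN iffD1])
         (use T TS inj_on_subset[OF inj] has_derivative_at_withinI[OF der[OF subsetD[OF TS]]] in auto)
    then have "f absolutely_integrable_on (\<psi> ` T m)" "integral (\<psi> ` T m) f = integral (T m) h"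
      by (simp_all add: absolutely_integrable_on_1_iff integral_on_1_eq)
    then show ?thesis
      using ai f h im[OF T TS] T by (simp add: nn_integral_eq_of_absolutely_integrable)
  qed
  have incT: "T m \<subseteq> T n" if "m \<le> n" for m n using that by (force simp: T_def)
  have UT: "(\<Union>m. T m) = S"
  proof -
    have "\<exists>m. x \<in> T m" if "x \<in> S" for x
    proof -
      obtain m :: nat where "max (h x) (norm x) \<le> real m" using real_arch_simple by blast
      then show ?thesis using that by (intro exI[of _ m]) (auto simp: T_def)
    qed
    then show ?thesis using TS by blast
  qed
  have mono: "(\<integral>\<^sup>+x\<in>(\<Union>m. B m). ennreal (k x) \<partial>lborel) = (SUP m. \<integral>\<^sup>+x\<in>B m. ennreal (k x) \<partial>lborel)"
    if "\<And>m. B m \<in> sets borel" "\<And>m n. m \<le> n \<Longrightarrow> B m \<subseteq> B n" "k \<in> borel_measurable borel"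
    for B :: "nat \<Rightarrow> (real ^ 'm::_) set" and k :: "real ^ 'm::_ \<Rightarrow> real"
  proof -
    have "ennreal (k x) * indicator (\<Union>m. B m) x = (SUP m. ennreal (k x) * indicator (B m) x)" for x
    proof (cases "x \<in> (\<Union>m. B m)")
      case True
      then obtain m where "x \<in> B m" by blast
      then show ?thesis
        by (intro antisym SUP_least SUP_upper2[of m]) (auto split: split_indicator)
    qed (auto simp: indicator_def)
    then have "(\<integral>\<^sup>+x\<in>(\<Union>m. B m). ennreal (k x) \<partial>lborel) =
        (\<integral>\<^sup>+x. (SUP m. ennreal (k x) * indicator (B m) x) \<partial>lborel)" by simp
    also have "\<dots> = (SUP m. \<integral>\<^sup>+x\<in>B m. ennreal (k x) \<partial>lborel)"
      by (rule nn_integral_monotone_convergence_SUP)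
         (use that in \<open>auto simp: incseq_def le_fun_def indicator_def split: if_splits\<close>)
    finally show ?thesis .
  qed
  have "(\<integral>\<^sup>+y\<in>\<psi> ` S. ennreal (f y) \<partial>lborel) = (SUP m. \<integral>\<^sup>+y\<in>\<psi> ` T m. ennreal (f y) \<partial>lborel)"
    unfolding UT[symmetric] image_UN
    by (rule mono[OF im[OF T TS] image_mono[OF incT] f(1)])
  also have "\<dots> = (SUP m. \<integral>\<^sup>+x\<in>T m. ennreal (h x) \<partial>lborel)" by (simp add: piece)
  also have "\<dots> = (\<integral>\<^sup>+x\<in>S. ennreal (h x) \<partial>lborel)"
    unfolding UT[symmetric] by (rule mono[OF T incT h(1), symmetric])
  finally show ?thesis .
qed

text \<open>The transformed integrand is prescribed as a Borel function \<open>h\<close>, which is tied to the Jacobian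
  on \<open>S\<close> only.\<close>

theorem nn_integral_change_of_variables:
  fixes f h :: "real ^ 'n::finite \<Rightarrow> real" and \<psi> :: "real ^ 'n \<Rightarrow> real ^ 'n"
  assumes S: "S \<in> sets borel"
    and im: "\<And>T. T \<in> sets borel \<Longrightarrow> T \<subseteq> S \<Longrightarrow> \<psi> ` T \<in> sets borel"
    and der: "\<And>x. x \<in> S \<Longrightarrow> (\<psi> has_derivative \<psi>' x) (at x)"
    and inj: "inj_on \<psi> S"
    and f: "f \<in> borel_measurable borel" "\<And>x. 0 \<le> f x"
    and h: "h \<in> borel_measurable borel" "\<And>x. 0 \<le> h x"
    and eq: "\<And>x. x \<in> S \<Longrightarrow> h x = \<bar>det (matrix (\<psi>' x))\<bar> * f (\<psi> x)"
  shows "(\<integral>\<^sup>+y\<in>\<psi> ` S. ennreal (f y) \<partial>lborel) = (\<integral>\<^sup>+x\<in>S. ennreal (h x) \<partial>lborel)"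
proof -
  let ?R = "reindex of_ordered :: real ^ 'n \<Rightarrow> real ^ 'n ordered_copy"
  let ?U = "reindex to_ordered :: real ^ 'n ordered_copy \<Rightarrow> real ^ 'n"
  have RU[simp]: "?R (?U y) = y" "?U (?R x) = x" for x y
    by (simp_all add: reindex_def vec_eq_iff of_ordered_inverse to_ordered_inverse)
  have R_eq: "?R ` A = ?U -` A" for A
    by (auto intro!: image_eqI[where x = "?U _"])
  have U_eq: "?U ` A = ?R -` A" for A
    by (auto intro!: image_eqI[where x = "?R _"])
  have bij: "bij (of_ordered :: 'n ordered_copy \<Rightarrow> 'n)" "bij (to_ordered :: 'n \<Rightarrow> 'n ordered_copy)"
    using bij_of_ordered
    by (auto intro!: o_bij[of of_ordered to_ordered] simp: fun_eq_iff of_ordered_inverse to_ordered_inverse)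
  have meas: "?R ` A \<in> sets borel" if "A \<in> sets borel" for A
    unfolding R_eq using measurable_sets[OF measurable_reindex that] by simp
  have measU: "?U ` A \<in> sets borel" if "A \<in> sets borel" for A
    unfolding U_eq using measurable_sets[OF measurable_reindex that] by simp
  have transport: "(\<integral>\<^sup>+y\<in>?R ` A. ennreal (k (?U y)) \<partial>lborel) = (\<integral>\<^sup>+x\<in>A. ennreal (k x) \<partial>lborel)"
    if "A \<in> sets borel" "k \<in> borel_measurable borel" for A and k :: "real ^ 'n \<Rightarrow> real"
  proof -
    have "(\<integral>\<^sup>+x\<in>A. ennreal (k x) \<partial>lborel) = (\<integral>\<^sup>+x\<in>A. ennreal (k x) \<partial>distr lborel borel ?U)"
      by (simp add: distr_lborel_reindex bij)
    also have "\<dots> = (\<integral>\<^sup>+y. ennreal (k (?U y)) * indicator A (?U y) \<partial>lborel)"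
      by (subst nn_integral_distr) (use that measurable_reindex in auto)
    also have "\<dots> = (\<integral>\<^sup>+y\<in>?R ` A. ennreal (k (?U y)) \<partial>lborel)"
      by (simp add: R_eq indicator_vimage)
    finally show ?thesis by simp
  qed
  let ?\<psi> = "\<lambda>y. ?R (\<psi> (?U y))" and ?\<psi>' = "\<lambda>y v. ?R (\<psi>' (?U y) (?U v))"
  have bl: "bounded_linear ?R" "bounded_linear ?U"
    using linear_reindex linear_conv_bounded_linear by auto
  have "(\<integral>\<^sup>+y\<in>?\<psi> ` (?R ` S). ennreal (f (?U y)) \<partial>lborel) = (\<integral>\<^sup>+y\<in>?R ` S. ennreal (h (?U y)) \<partial>lborel)"
  proof (rule nn_integral_change_of_variables_wellorder[where \<psi>' = ?\<psi>'])
    show "?R ` S \<in> sets borel" using S by (rule meas)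
    show "?\<psi> ` T \<in> sets borel" if "T \<in> sets borel" "T \<subseteq> ?R ` S" for T
    proof -
      have "?\<psi> ` T = ?R ` (\<psi> ` (?U ` T))" by (simp add: image_image)
      moreover have "?U ` T \<subseteq> S" using that(2) by auto
      ultimately show ?thesis using im[OF measU[OF that(1)]] meas by simp
    qed
    show "(?\<psi> has_derivative ?\<psi>' y) (at y)" if "y \<in> ?R ` S" for y
    proof -
      have "?U y \<in> S" using that by auto
      from has_derivative_compose[OF bounded_linear.has_derivative[OF bl(2) has_derivative_ident] der[OF this]]
      show ?thesis by (rule bounded_linear.has_derivative[OF bl(1)])
    qed
    show "inj_on ?\<psi> (?R ` S)"
    proof (rule inj_onI)
      fix y z assume "y \<in> ?R ` S" "z \<in> ?R ` S" "?\<psi> y = ?\<psi> z"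
      then have "\<psi> (?U y) = \<psi> (?U z)" "?U y \<in> S" "?U z \<in> S" using RU(2) by (metis, auto)
      then show "y = z" using inj by (metis RU(1) inj_onD)
    qed
    show "h (?U y) = \<bar>det (matrix (?\<psi>' y))\<bar> * f (?U (?\<psi> y))" if "y \<in> ?R ` S" for y
    proof -
      have axis: "?U (axis j 1) = axis (of_ordered j) 1" for j
        by (auto simp: reindex_def axis_def vec_eq_iff to_ordered_inverse of_ordered_inverse)
      have "matrix (?\<psi>' y) = (\<chi> i j. matrix (\<psi>' (?U y)) $ of_ordered i $ of_ordered j)"
        by (simp add: matrix_def vec_eq_iff axis) (simp add: reindex_def)
      then have "det (matrix (?\<psi>' y)) = det (matrix (\<psi>' (?U y)))"
        using det_reindex[OF bij(1)] by metis
      then show ?thesis using eq[of "?U y"] that by auto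
    qed
  qed (use f h measurable_compose[OF measurable_reindex] in auto)
  moreover have "?\<psi> ` (?R ` S) = ?R ` (\<psi> ` S)" by (simp add: image_image)
  ultimately show ?thesis using transport[OF S h(1)] transport[OF im[OF S order_refl] f(1)] by simp
qed


section \<open>Manifolds in charts\<close>

abbreviation coords :: "('p, 'n) chart \<Rightarrow> (real ^ 'n) set" where
  "coords c \<equiv> snd c ` fst c"

lemma chart_inv_mem: "x \<in> coords c \<Longrightarrow> chart_inv c x \<in> fst c"
  by (rule inv_into_into)

lemma chart_chart_inv: "x \<in> coords c \<Longrightarrow> snd c (chart_inv c x) = x"
  by (rule f_inv_into_f)

locale smooth_manifold =
  fixes \<A> :: "('p::{t2_space,second_countable_topology}, 'n::finite) chart set"
  assumes atlas: "smooth_atlas \<A>"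
begin

lemma open_chart: "c \<in> \<A> \<Longrightarrow> open (fst c)" "c \<in> \<A> \<Longrightarrow> open (coords c)"
  and chart_homeomorphism: "c \<in> \<A> \<Longrightarrow> homeomorphism (fst c) (coords c) (snd c) (chart_inv c)"
  and chart_transition_smooth:
    "c \<in> \<A> \<Longrightarrow> d \<in> \<A> \<Longrightarrow> smooth_on (snd c ` (fst c \<inter> fst d)) (snd d \<circ> chart_inv c)"
  and charts_cover: "(\<Union>c\<in>\<A>. fst c) = UNIV"
  using atlas by (auto simp: smooth_atlas_def)

lemma chart_inv_chart: "c \<in> \<A> \<Longrightarrow> p \<in> fst c \<Longrightarrow> chart_inv c (snd c p) = p"
  using chart_homeomorphism by (simp add: homeomorphism_def)

lemma continuous_on_chart: "c \<in> \<A> \<Longrightarrow> continuous_on (fst c) (snd c)"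
  and continuous_on_chart_inv: "c \<in> \<A> \<Longrightarrow> continuous_on (coords c) (chart_inv c)"
  using chart_homeomorphism by (auto simp: homeomorphism_def)

lemma inj_on_chart: "c \<in> \<A> \<Longrightarrow> inj_on (snd c) (fst c)"
  using chart_inv_chart by (metis inj_on_inverseI)

lemma chart_at: "chart_at \<A> p \<in> \<A>" "p \<in> fst (chart_at \<A> p)"
proof -
  have "\<exists>c. c \<in> \<A> \<and> p \<in> fst c" using charts_cover by blast
  then have "chart_at \<A> p \<in> \<A> \<and> p \<in> fst (chart_at \<A> p)"
    unfolding chart_at_def by (rule someI_ex)
  then show "chart_at \<A> p \<in> \<A>" "p \<in> fst (chart_at \<A> p)" by auto
qed

lemma chart_image_eq: "c \<in> \<A> \<Longrightarrow> B \<subseteq> fst c \<Longrightarrow> snd c ` B = coords c \<inter> chart_inv c -` B"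
  using chart_inv_chart by (force simp: chart_chart_inv image_iff)

lemma chart_inv_image_eq:
  assumes c: "c \<in> \<A>" and S: "S \<subseteq> coords c"
  shows "chart_inv c ` S = fst c \<inter> snd c -` S"
proof (intro equalityI subsetI)
  fix p
  assume "p \<in> chart_inv c ` S"
  then obtain x where x: "x \<in> S" "p = chart_inv c x" by blast
  then have "x \<in> coords c" using S by blast
  then show "p \<in> fst c \<inter> snd c -` S" using x chart_inv_mem[of x c] chart_chart_inv[of x c] by simp
next
  fix p
  assume p: "p \<in> fst c \<inter> snd c -` S"
  then have "p = chart_inv c (snd c p)" using chart_inv_chart[OF c] by simp
  then show "p \<in> chart_inv c ` S" using p by blast
qed

lemma open_chart_image:
  assumes "c \<in> \<A>" "open U" "U \<subseteq> fst c"
  shows "open (snd c ` U)"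
  unfolding chart_image_eq[OF assms(1,3)]
  by (rule continuous_open_preimage[OF continuous_on_chart_inv open_chart(2)]) (use assms in auto)

lemma borel_chart_image:
  assumes "c \<in> \<A>" "B \<in> sets borel" "B \<subseteq> fst c"
  shows "snd c ` B \<in> sets borel"
proof -
  have "chart_inv c \<in> borel_measurable (restrict_space borel (coords c))"
    using continuous_on_chart_inv[OF assms(1)] by (rule borel_measurable_continuous_on_restrict)
  from measurable_sets[OF this assms(2)] show ?thesis
    using open_chart(2)[OF assms(1)]
    by (simp add: chart_image_eq[OF assms(1,3)] space_restrict_space sets_restrict_space_iff Int_commute)
qed

definition transition :: "('p, 'n) chart \<Rightarrow> ('p, 'n) chart \<Rightarrow> 'p \<Rightarrow> real ^ 'n \<Rightarrow> real ^ 'n" where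
  "transition c d p = frechet_derivative (snd d \<circ> chart_inv c) (at (snd c p))"

lemma open_chart_overlap: "c \<in> \<A> \<Longrightarrow> d \<in> \<A> \<Longrightarrow> open (snd c ` (fst c \<inter> fst d))"
  by (rule open_chart_image) (auto intro: open_chart)

lemma transition_has_derivative:
  assumes "c \<in> \<A>" "d \<in> \<A>" "p \<in> fst c" "p \<in> fst d"
  shows "((snd d \<circ> chart_inv c) has_derivative transition c d p) (at (snd c p))"
  unfolding transition_def
  by (rule smooth_on_has_derivative[OF chart_transition_smooth[OF assms(1,2)]]) (use assms in auto)

lemma chart_has_derivative:
  assumes "smooth_map \<A> F" "c \<in> \<A>" "p \<in> fst c"
  shows "((F \<circ> chart_inv c) has_derivative chart_deriv c F p) (at (snd c p))"
proof -
  have "((F \<circ> chart_inv c) has_derivative frechet_derivative (F \<circ> chart_inv c) (at (snd c p))) (at (snd c p))"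
    by (rule smooth_on_has_derivative[of "coords c"]) (use assms in \<open>auto simp: smooth_map_def\<close>)
  then show ?thesis by (simp add: chart_deriv_def[abs_def])
qed

lemma linear_chart_deriv:
  "smooth_map \<A> F \<Longrightarrow> c \<in> \<A> \<Longrightarrow> p \<in> fst c \<Longrightarrow> linear (chart_deriv c F p)"
  using chart_has_derivative has_derivative_linear by blast

lemma chart_deriv_transition:
  assumes F: "smooth_map \<A> F" and c: "c \<in> \<A>" "p \<in> fst c" and d: "d \<in> \<A>" "p \<in> fst d"
  shows "chart_deriv c F p v = chart_deriv d F p (transition c d p v)"
proof -
  have p: "snd d p = (snd d \<circ> chart_inv c) (snd c p)" using c by (simp add: chart_inv_chart)
  have "((\<lambda>x. (F \<circ> chart_inv d) ((snd d \<circ> chart_inv c) x)) has_derivative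
      (\<lambda>v. chart_deriv d F p (transition c d p v))) (at (snd c p))"
    using chart_has_derivative[OF F d] unfolding p
    by (rule has_derivative_compose[OF transition_has_derivative[OF c(1) d(1) c(2) d(2)]])
  then have "((F \<circ> chart_inv c) has_derivative (\<lambda>v. chart_deriv d F p (transition c d p v))) (at (snd c p))"
    by (rule has_derivative_transform_within_open[OF _ open_chart_overlap[OF c(1) d(1)]])
       (use c d chart_inv_chart[OF c(1)] chart_inv_chart[OF d(1)] in auto)
  from has_derivative_unique[OF this chart_has_derivative[OF F c]] show ?thesis
    by (metis)
qed

section \<open>The area measure\<close>

lemma gram_matrix_eq:
  "gram_matrix c Y p = form_matrix (\<lambda>v w. chart_deriv c Y p v \<bullet> chart_deriv c Y p w)"
  by (simp add: gram_matrix_def form_matrix_def)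

lemma immersion_smooth: "immersion \<A> Y \<Longrightarrow> smooth_map \<A> Y"
  by (simp add: immersion_def)

lemma immersion_frame:
  assumes "immersion \<A> Y" "c \<in> \<A>" "p \<in> fst c"
  obtains v where "orthonormal_for (\<lambda>v w. chart_deriv c Y p v \<bullet> chart_deriv c Y p w) v"
proof -
  have "inj (chart_deriv c Y p)" using assms by (simp add: immersion_def)
  then show ?thesis
    using exists_orthonormal_for[OF linear_chart_deriv[OF immersion_smooth[OF assms(1)] assms(2,3)]] that
    by blast
qed

lemma det_gram_pos:
  assumes "immersion \<A> Y" "c \<in> \<A>" "p \<in> fst c"
  shows "0 < det (gram_matrix c Y p)"
proof -
  have "bilinear (\<lambda>v w. chart_deriv c Y p v \<bullet> chart_deriv c Y p w)"
    using linear_chart_deriv[OF immersion_smooth[OF assms(1)] assms(2,3)]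
    by (intro bilinear_pullback_inner)
  then show ?thesis
    using row_trace_frame(1) immersion_frame[OF assms] unfolding gram_matrix_eq by metis
qed

text \<open>The Gram matrices in two charts are congruent through the Jacobian of the coordinate change.
  Hence the area densities transform as required by the change of variables formula.\<close>

lemma sqrt_det_gram_transition:
  assumes F: "smooth_map \<A> F" and c: "c \<in> \<A>" "p \<in> fst c" and d: "d \<in> \<A>" "p \<in> fst d"
  shows "sqrt (det (gram_matrix c F p)) =
    \<bar>det (matrix (transition c d p))\<bar> * sqrt (det (gram_matrix d F p))"
proof -
  have "linear (transition c d p)"
    using transition_has_derivative c d has_derivative_linear by blast
  then have "chart_deriv c F p v = chart_deriv d F p (matrix (transition c d p) *v v)" for v
    using chart_deriv_transition[OF F c d] by (simp add: matrix_works)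
  then show ?thesis
    unfolding gram_matrix_eq
    by (simp add: det_gram_compose linear_chart_deriv F d real_sqrt_mult)
qed

lemma smooth_on_chart_deriv:
  assumes "smooth_map \<A> F" "c \<in> \<A>"
  shows "smooth_on (coords c) (\<lambda>x. chart_deriv c F (chart_inv c x) v)"
proof -
  have "smooth_on (coords c) (\<lambda>x. frechet_derivative (F \<circ> chart_inv c) (at x) v)"
    using assms by (intro smooth_on_derivative) (simp add: smooth_map_def)
  then show ?thesis
    unfolding smooth_on_def chart_deriv_def
    using Ck_on_cong[OF open_chart(2)[OF assms(2)]] chart_chart_inv by (smt (verit))
qed

text \<open>The value 0 outside of the coordinate domain makes this a Borel function on the whole
  space.\<close>

definition area_density :: "('p, 'n) chart \<Rightarrow> ('p \<Rightarrow> 'e::euclidean_space) \<Rightarrow> real ^ 'n \<Rightarrow> real" where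
  "area_density c Y x = (if x \<in> coords c then sqrt (det (gram_matrix c Y (chart_inv c x))) else 0)"

definition chart_area :: "('p, 'n) chart \<Rightarrow> ('p \<Rightarrow> 'e::euclidean_space) \<Rightarrow> (real ^ 'n) measure" where
  "chart_area c Y = density lborel (\<lambda>x. ennreal (area_density c Y x))"

lemma continuous_on_gram:
  assumes "smooth_map \<A> Y" "c \<in> \<A>"
  shows "continuous_on (coords c) (\<lambda>x. det (gram_matrix c Y (chart_inv c x)))"
proof -
  have "continuous_on (coords c) (\<lambda>x. chart_deriv c Y (chart_inv c x) v)" for v
    using smooth_on_imp_continuous_on[OF smooth_on_chart_deriv[OF assms]] .
  then show ?thesis
    unfolding det_def gram_matrix_def by (auto intro!: continuous_intros)
qed

lemma area_density_borel:
  assumes "smooth_map \<A> Y" "c \<in> \<A>"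
  shows "area_density c Y \<in> borel_measurable borel"
  unfolding area_density_def[abs_def]
  by (rule borel_measurable_continuous_on_if)
     (use open_chart(2)[OF assms(2)] continuous_on_gram[OF assms] in \<open>auto intro!: continuous_intros\<close>)

lemma area_density_pos: "immersion \<A> Y \<Longrightarrow> c \<in> \<A> \<Longrightarrow> x \<in> coords c \<Longrightarrow> 0 < area_density c Y x"
  unfolding area_density_def using det_gram_pos[OF _ _ chart_inv_mem, of Y c x] by simp

lemma area_density_nonneg: "immersion \<A> Y \<Longrightarrow> c \<in> \<A> \<Longrightarrow> 0 \<le> area_density c Y x"
  using area_density_pos[of Y c x] by (cases "x \<in> coords c") (simp_all add: area_density_def)

lemma sets_chart_area[simp]: "sets (chart_area c Y) = sets borel"
  and space_chart_area[simp]: "space (chart_area c Y) = UNIV"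
  by (simp_all add: chart_area_def)

lemma emeasure_chart_area:
  assumes "immersion \<A> Y" "c \<in> \<A>" "S \<in> sets borel"
  shows "emeasure (chart_area c Y) S = (\<integral>\<^sup>+x\<in>S. ennreal (area_density c Y x) \<partial>lborel)"
  unfolding chart_area_def
  using area_density_borel[OF immersion_smooth[OF assms(1)] assms(2)] assms(3)
  by (intro emeasure_density) auto

lemma chart_area_change:
  assumes Y: "immersion \<A> Y" and cd: "c \<in> \<A>" "d \<in> \<A>" and B: "B \<in> sets borel" "B \<subseteq> fst c" "B \<subseteq> fst d"
  shows "emeasure (chart_area d Y) (snd d ` B) = emeasure (chart_area c Y) (snd c ` B)"
proof -
  let ?\<psi> = "snd d \<circ> chart_inv c"
  have \<psi>: "?\<psi> (snd c p) = snd d p" if "p \<in> B" for p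
    using that B(2) chart_inv_chart[OF cd(1)] by auto
  have im: "?\<psi> ` (snd c ` B) = snd d ` B"
    unfolding image_image using \<psi> by (rule image_cong[OF refl])
  have inv: "chart_inv c x \<in> B" "snd c (chart_inv c x) = x" if "x \<in> snd c ` B" for x
    using that B(2) chart_inv_chart[OF cd(1)] by auto
  have "(\<integral>\<^sup>+y\<in>?\<psi> ` (snd c ` B). ennreal (area_density d Y y) \<partial>lborel) =
      (\<integral>\<^sup>+x\<in>snd c ` B. ennreal (area_density c Y x) \<partial>lborel)"
  proof (rule nn_integral_change_of_variables[where \<psi>' = "\<lambda>x. transition c d (chart_inv c x)"])
    show "snd c ` B \<in> sets borel" using borel_chart_image cd B by blast
    show "?\<psi> ` T \<in> sets borel" if T: "T \<in> sets borel" "T \<subseteq> snd c ` B" for T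
    proof -
      have "T \<subseteq> coords c" using T(2) B(2) by blast
      then have "chart_inv c ` T = fst c \<inter> snd c -` T" by (rule chart_inv_image_eq[OF cd(1)])
      moreover have "snd c \<in> borel_measurable (restrict_space borel (fst c))"
        using continuous_on_chart[OF cd(1)] by (rule borel_measurable_continuous_on_restrict)
      from measurable_sets[OF this T(1)] have "fst c \<inter> snd c -` T \<in> sets borel"
        using open_chart(1)[OF cd(1)]
        by (simp add: space_restrict_space sets_restrict_space_iff Int_commute)
      moreover have "chart_inv c ` T \<subseteq> fst d" using inv(1) T(2) B(3) by blast
      ultimately have "snd d ` (chart_inv c ` T) \<in> sets borel"
        using borel_chart_image[OF cd(2)] by simp
      then show ?thesis by (simp add: image_comp)
    qed
    show "(?\<psi> has_derivative transition c d (chart_inv c x)) (at x)" if "x \<in> snd c ` B" for x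
      using transition_has_derivative[OF cd, of "chart_inv c x"] inv[OF that] B(2,3) by auto
    show "inj_on ?\<psi> (snd c ` B)"
    proof (rule inj_onI)
      fix x y
      assume xy: "x \<in> snd c ` B" "y \<in> snd c ` B" "?\<psi> x = ?\<psi> y"
      then have "chart_inv c x = chart_inv c y"
        using inj_onD[OF inj_on_chart[OF cd(2)], of "chart_inv c x" "chart_inv c y"] inv(1) B(3)
        by auto
      then show "x = y" using inv(2) xy by metis
    qed
    show "area_density c Y x = \<bar>det (matrix (transition c d (chart_inv c x)))\<bar> * area_density d Y (?\<psi> x)"
      if x: "x \<in> snd c ` B" for x
    proof -
      obtain p where p: "p \<in> B" "x = snd c p" using x by blast
      have "p \<in> fst c" "p \<in> fst d" using p B by auto
      then show ?thesis
        using sqrt_det_gram_transition[OF immersion_smooth[OF Y] cd(1) _ cd(2)] p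
          chart_inv_chart[OF cd(1)] chart_inv_chart[OF cd(2)]
        by (simp add: area_density_def)
    qed
  qed (use area_density_borel[OF immersion_smooth[OF Y]] cd area_density_nonneg[OF Y] in blast)+
  then show ?thesis
    unfolding im emeasure_chart_area[OF Y cd(1) borel_chart_image[OF cd(1) B(1,2)]]
      emeasure_chart_area[OF Y cd(2) borel_chart_image[OF cd(2) B(1,3)]] .
qed

definition is_area_measure :: "('p \<Rightarrow> 'e::euclidean_space) \<Rightarrow> 'p measure \<Rightarrow> bool" where
  "is_area_measure Y \<mu> \<longleftrightarrow> sets \<mu> = sets borel \<and>
     (\<forall>c\<in>\<A>. \<forall>B\<in>sets borel. B \<subseteq> fst c \<longrightarrow> emeasure \<mu> B = emeasure (chart_area c Y) (snd c ` B))"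

lemma countable_cover:
  obtains C :: "nat \<Rightarrow> ('p, 'n) chart" where "range C \<subseteq> \<A>" "(\<Union>k. fst (C k)) = UNIV"
proof -
  obtain \<F> where F: "\<F> \<subseteq> fst ` \<A>" "countable \<F>" "\<Union>\<F> = \<Union>(fst ` \<A>)"
    by (rule Lindelof[of "fst ` \<A>"]) (use open_chart in auto)
  then have U: "\<Union>\<F> = UNIV" using charts_cover by simp
  then have ne: "\<F> \<noteq> {}" by auto
  have "\<forall>k. \<exists>c\<in>\<A>. fst c = from_nat_into \<F> k"
    using F(1) from_nat_into[OF ne] by (metis image_iff subsetD)
  then obtain C where C: "\<And>k. C k \<in> \<A>" "\<And>k. fst (C k) = from_nat_into \<F> k" by metis
  have "(\<Union>k. fst (C k)) = UNIV"
    using range_from_nat_into[OF ne F(2)] U by (simp add: C(2))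
  with image_subsetI[OF C(1)] show ?thesis by (rule that)
qed

lemma partition_by_charts:
  obtains C :: "nat \<Rightarrow> ('p, 'n) chart" and D :: "nat \<Rightarrow> 'p set"
  where "\<forall>k. C k \<in> \<A> \<and> D k \<in> sets borel \<and> D k \<subseteq> fst (C k)" "disjoint_family D"
    "(\<Union>k. D k) = UNIV"
proof -
  obtain C :: "nat \<Rightarrow> ('p, 'n) chart" where C: "range C \<subseteq> \<A>" "(\<Union>k. fst (C k)) = UNIV"
    by (rule countable_cover)
  let ?D = "disjointed (\<lambda>k. fst (C k))"
  have CA: "C k \<in> \<A>" for k using C(1) by auto
  have o: "fst (C k) \<in> sets borel" for k using open_chart(1)[OF CA] by simp
  have "range ?D \<subseteq> sets borel" by (rule sets.range_disjointed_sets) (use o in auto)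
  then show ?thesis
    using C(2) CA disjointed_subset[of "\<lambda>k. fst (C k)"] UN_disjointed_eq[of "\<lambda>k. fst (C k)"]
    by (intro that[of C ?D] disjoint_family_disjointed allI conjI) auto
qed

text \<open>Cut the manifold into countably many Borel pieces \<open>D k\<close>, each inside the domain of a chart
  \<open>C k\<close>, and add up the areas of the parts of a set in these charts. Any other chart gives the same
  area to each part by \<open>chart_area_change\<close>, so the sum has the right density in every chart.\<close>

lemma area_measure_exists:
  assumes Y: "immersion \<A> Y"
  shows "\<exists>\<mu>. is_area_measure Y \<mu>"
proof -
  obtain C :: "nat \<Rightarrow> ('p, 'n) chart" and D where CD: "\<forall>k. C k \<in> \<A> \<and> D k \<in> sets borel \<and> D k \<subseteq> fst (C k)"
      "disjoint_family D" "(\<Union>k. D k) = UNIV"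
    by (rule partition_by_charts)
  then have C: "\<And>k. C k \<in> \<A>" and D: "\<And>k. D k \<in> sets borel" "\<And>k. D k \<subseteq> fst (C k)"
    by auto
  note D = D CD(2,3)
  have disjD: "disjoint_family (\<lambda>k. B \<inter> D k)" for B
    using D(3) unfolding disjoint_family_on_def by blast
  define m where "m k B = emeasure (chart_area (C k) Y) (snd (C k) ` (B \<inter> D k))" for k :: nat and B
  define \<mu> where "\<mu> = measure_of UNIV (sets borel) (\<lambda>B. \<integral>\<^sup>+k. m k B \<partial>count_space UNIV)"
  have disj: "disjoint_family (\<lambda>i. snd c ` (B i))"
    if "c \<in> \<A>" "disjoint_family B" "\<And>i. B i \<subseteq> fst c" for c and B :: "nat \<Rightarrow> 'p set"
    using that inj_on_chart[OF that(1)] unfolding disjoint_family_on_def inj_on_def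
    by (auto simp: subset_iff) (metis IntI empty_iff)
  have add: "(\<Sum>i. emeasure (chart_area c Y) (snd c ` B i)) = emeasure (chart_area c Y) (snd c ` (\<Union>i. B i))"
    if "c \<in> \<A>" "disjoint_family B" "\<And>i. B i \<subseteq> fst c" "\<And>i. B i \<in> sets borel" for c and B :: "nat \<Rightarrow> 'p set"
    unfolding image_UN
    by (rule suminf_emeasure) (use disj[OF that(1-3)] borel_chart_image[OF that(1,4,3)] in auto)
  have "emeasure \<mu> B = (\<integral>\<^sup>+k. m k B \<partial>count_space UNIV)" if "B \<in> sets borel" for B
    unfolding \<mu>_def
  proof (rule emeasure_measure_of_sigma)
    show "sigma_algebra UNIV (sets (borel :: 'p measure))"
      using sets.sigma_algebra_axioms[of "borel :: 'p measure"] by simp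
    show "positive (sets borel) (\<lambda>B. \<integral>\<^sup>+k. m k B \<partial>count_space UNIV)"
      by (simp add: positive_def m_def)
    show "countably_additive (sets borel) (\<lambda>B. \<integral>\<^sup>+k. m k B \<partial>count_space UNIV)"
    proof (rule countably_additiveI)
      fix B :: "nat \<Rightarrow> 'p set"
      assume B: "range B \<subseteq> sets borel" "disjoint_family B"
      have "(\<Sum>i. m k (B i)) = m k (\<Union>i. B i)" for k
      proof -
        have "(\<Sum>i. m k (B i)) = emeasure (chart_area (C k) Y) (snd (C k) ` (\<Union>i. B i \<inter> D k))"
          unfolding m_def
          by (rule add) (use B C[of k] D(1,2)[of k] in \<open>auto simp: disjoint_family_on_def\<close>)
        then show ?thesis by (simp add: m_def)
      qed
      then show "(\<Sum>i. \<integral>\<^sup>+k. m k (B i) \<partial>count_space UNIV) = (\<integral>\<^sup>+k. m k (\<Union>i. B i) \<partial>count_space UNIV)"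
        by (subst nn_integral_suminf[symmetric]) auto
    qed
  qed (use that in auto)
  moreover have "(\<integral>\<^sup>+k. m k B \<partial>count_space UNIV) = emeasure (chart_area c Y) (snd c ` B)"
    if c: "c \<in> \<A>" and B: "B \<in> sets borel" "B \<subseteq> fst c" for c B
  proof -
    have "m k B = emeasure (chart_area c Y) (snd c ` (B \<inter> D k))" for k
      unfolding m_def by (rule chart_area_change[OF Y c C]) (use B D in auto)
    then have "(\<integral>\<^sup>+k. m k B \<partial>count_space UNIV) = (\<Sum>k. emeasure (chart_area c Y) (snd c ` (B \<inter> D k)))"
      by (simp add: nn_integral_count_space_nat)
    also have "\<dots> = emeasure (chart_area c Y) (snd c ` (\<Union>k. B \<inter> D k))"
      by (rule add[OF c disjD]) (use B D(1) in auto)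
    also have "(\<Union>k. B \<inter> D k) = B" using D(4) by (simp flip: Int_UN_distrib)
    finally show ?thesis .
  qed
  moreover have "sets \<mu> = sets borel"
    unfolding \<mu>_def using sets.sigma_sets_eq[of "borel :: 'p measure"] by simp
  ultimately show ?thesis unfolding is_area_measure_def by metis
qed

lemma area_measure_unique:
  assumes "is_area_measure Y \<mu>" "is_area_measure Y \<nu>"
  shows "\<mu> = \<nu>"
proof (rule measure_eqI)
  show s: "sets \<mu> = sets \<nu>" using assms by (simp add: is_area_measure_def)
  fix B
  assume "B \<in> sets \<mu>"
  then have B: "B \<in> sets borel" using assms by (simp add: is_area_measure_def)
  obtain C :: "nat \<Rightarrow> ('p, 'n) chart" and D where CD: "\<forall>k. C k \<in> \<A> \<and> D k \<in> sets borel \<and> D k \<subseteq> fst (C k)"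
      "disjoint_family D" "(\<Union>k. D k) = UNIV"
    by (rule partition_by_charts)
  then have C: "\<And>k. C k \<in> \<A>" and D: "\<And>k. D k \<in> sets borel" "\<And>k. D k \<subseteq> fst (C k)"
    by auto
  note D = D CD(2,3)
  have disjD: "disjoint_family (\<lambda>k. B \<inter> D k)" for B
    using D(3) unfolding disjoint_family_on_def by blast
  have split: "emeasure M B = (\<Sum>k. emeasure M (B \<inter> D k))" if "sets M = sets borel" for M
  proof -
    have "(\<Sum>k. emeasure M (B \<inter> D k)) = emeasure M (\<Union>k. B \<inter> D k)"
      by (rule suminf_emeasure[OF _ disjD]) (use that B D(1) in auto)
    also have "(\<Union>k. B \<inter> D k) = B" using D(4) by (simp flip: Int_UN_distrib)
    finally show ?thesis by simp
  qed
  have "emeasure \<mu> (B \<inter> D k) = emeasure \<nu> (B \<inter> D k)" for k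
  proof -
    have "B \<inter> D k \<in> sets borel" "B \<inter> D k \<subseteq> fst (C k)" using B D by auto
    then show ?thesis using assms C[of k] unfolding is_area_measure_def by metis
  qed
  then show "emeasure \<mu> B = emeasure \<nu> B"
    using split[of \<mu>] split[of \<nu>] assms by (simp add: is_area_measure_def)
qed

lemma area_measure:
  assumes Y: "immersion \<A> Y"
  shows "is_area_measure Y (area_measure \<A> Y)"
proof -
  have "emeasure (chart_area c Y) (snd c ` B) =
      (\<integral>\<^sup>+x\<in>snd c ` B. ennreal (sqrt (det (gram_matrix c Y (chart_inv c x)))) \<partial>lborel)"
    if "c \<in> \<A>" "B \<in> sets borel" "B \<subseteq> fst c" for c B
    unfolding emeasure_chart_area[OF Y that(1) borel_chart_image[OF that]]
    using that(3) by (intro nn_integral_cong) (auto simp: area_density_def split: split_indicator)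
  then have "(sets \<mu> = sets borel \<and> (\<forall>c\<in>\<A>. \<forall>B\<in>sets borel. B \<subseteq> fst c \<longrightarrow> emeasure \<mu> B =
      (\<integral>\<^sup>+x\<in>snd c ` B. ennreal (sqrt (det (gram_matrix c Y (chart_inv c x)))) \<partial>lborel))) \<longleftrightarrow>
      is_area_measure Y \<mu>" for \<mu>
    unfolding is_area_measure_def by (intro conj_cong ball_cong imp_cong refl) auto
  then have "area_measure \<A> Y = (SOME \<mu>. is_area_measure Y \<mu>)"
    unfolding area_measure_def by simp
  then show ?thesis using someI_ex[OF area_measure_exists[OF Y]] by simp
qed

lemma sets_area_measure: "is_area_measure Y \<mu> \<Longrightarrow> sets \<mu> = sets borel"
  by (simp add: is_area_measure_def)

text \<open>Restricted to a chart domain, the area measure is the image of the chart area under the inverse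
  of the chart; outside the coordinate domain the inverse is extended by a constant to make it
  measurable.\<close>

lemma nn_integral_area_measure:
  assumes \<mu>: "is_area_measure Y \<mu>" and Y: "immersion \<A> Y" and c: "c \<in> \<A>"
    and B: "B \<in> sets borel" "B \<subseteq> fst c" and f: "f \<in> borel_measurable borel"
  shows "(\<integral>\<^sup>+p\<in>B. f p \<partial>\<mu>) =
    (\<integral>\<^sup>+x\<in>snd c ` B. ennreal (area_density c Y x) * f (chart_inv c x) \<partial>lborel)"
proof -
  define T where "T x = (if x \<in> coords c then chart_inv c x else undefined)" for x
  have T: "T \<in> borel_measurable borel"
    unfolding T_def[abs_def]
    by (rule borel_measurable_continuous_on_if)
       (use open_chart(2)[OF c] continuous_on_chart_inv[OF c] in auto)
  have ind: "indicator (snd c ` A) x = (indicator (coords c) x * indicator A (T x) :: ennreal)"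
    if "A \<subseteq> fst c" for A x
    using chart_image_eq[OF c that] by (auto simp: T_def indicator_def)
  have sb: "sets \<mu> = sets borel" "space \<mu> = UNIV"
    using sets_area_measure[OF \<mu>] sets_eq_imp_space_eq[OF sets_area_measure[OF \<mu>]] by auto
  have "density \<mu> (indicator (fst c)) =
      distr (density lborel (\<lambda>x. ennreal (area_density c Y x) * indicator (coords c) x)) borel T"
    (is "_ = distr ?L _ _")
  proof (rule measure_eqI)
    fix A
    assume "A \<in> sets (density \<mu> (indicator (fst c)))"
    then have A: "A \<in> sets borel" by (simp add: sb)
    have Ac: "A \<inter> fst c \<in> sets borel" using A open_chart(1)[OF c] by auto
    have m: "indicator (fst c) \<in> borel_measurable \<mu>"
      using open_chart(1)[OF c] by (intro borel_measurable_indicator) (simp add: sb)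
    have "emeasure (density \<mu> (indicator (fst c))) A = (\<integral>\<^sup>+p. indicator (fst c) p * indicator A p \<partial>\<mu>)"
      by (rule emeasure_density[OF m]) (use A sb in auto)
    also have "\<dots> = (\<integral>\<^sup>+p. indicator (A \<inter> fst c) p \<partial>\<mu>)"
      by (intro nn_integral_cong) (auto split: split_indicator)
    also have "\<dots> = emeasure \<mu> (A \<inter> fst c)" using Ac by (simp add: sb)
    also have "\<dots> = emeasure (chart_area c Y) (snd c ` (A \<inter> fst c))"
      using \<mu> c Ac by (simp add: is_area_measure_def)
    also have "\<dots> = (\<integral>\<^sup>+x\<in>snd c ` (A \<inter> fst c). ennreal (area_density c Y x) \<partial>lborel)"
      by (rule emeasure_chart_area[OF Y c borel_chart_image[OF c Ac]]) simp
    also have "\<dots> = emeasure ?L (T -` A)"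
    proof -
      have "indicator (snd c ` (A \<inter> fst c)) x = (indicator (coords c) x * indicator (T -` A) x :: ennreal)" for x
        unfolding ind[OF Int_lower2] by (auto simp: T_def indicator_def chart_inv_mem)
      moreover have "T -` A \<in> sets lborel" using measurable_sets[OF T A] by simp
      moreover have "(\<lambda>x. ennreal (area_density c Y x) * indicator (coords c) x) \<in> borel_measurable lborel"
        using area_density_borel[OF immersion_smooth[OF Y] c] open_chart(2)[OF c] by simp
      ultimately show ?thesis by (simp add: emeasure_density mult.assoc)
    qed
    also have "\<dots> = emeasure (distr ?L borel T) A"
      using T A by (subst emeasure_distr) auto
    finally show "emeasure (density \<mu> (indicator (fst c))) A = emeasure (distr ?L borel T) A" .
  qed (simp add: sb)
  note eq = this
  have ad: "area_density c Y \<in> borel_measurable borel"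
    by (rule area_density_borel[OF immersion_smooth[OF Y] c])
  have "(\<integral>\<^sup>+p\<in>B. f p \<partial>\<mu>) = (\<integral>\<^sup>+p. indicator (fst c) p * (f p * indicator B p) \<partial>\<mu>)"
    using B(2) by (intro nn_integral_cong) (auto split: split_indicator)
  also have "\<dots> = (\<integral>\<^sup>+p\<in>B. f p \<partial>density \<mu> (indicator (fst c)))"
    using f B open_chart(1)[OF c] by (subst nn_integral_density) (auto simp: measurable_cong_sets[OF sb(1) refl])
  also have "\<dots> = (\<integral>\<^sup>+x. f (T x) * indicator B (T x) \<partial>?L)"
    unfolding eq using T f B by (subst nn_integral_distr) auto
  also have "\<dots> = (\<integral>\<^sup>+x. ennreal (area_density c Y x) * indicator (coords c) x * (f (T x) * indicator B (T x)) \<partial>lborel)"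
    using measurable_compose[OF T f] measurable_sets[OF T B(1)] T B ad open_chart(2)[OF c]
    by (subst nn_integral_density) auto
  also have "\<dots> = (\<integral>\<^sup>+x\<in>snd c ` B. ennreal (area_density c Y x) * f (chart_inv c x) \<partial>lborel)"
    by (intro nn_integral_cong) (auto simp: ind[OF B(2)] T_def split: split_indicator)
  finally show ?thesis .
qed

end


section \<open>Mean curvature\<close>

lemma frame_sum_independent:
  fixes b :: "real ^ 'n::finite \<Rightarrow> real ^ 'n \<Rightarrow> real"
  assumes "bilinear g" "bilinear b" "orthonormal_for g v" "orthonormal_for g w"
  shows "(\<Sum>i\<in>UNIV. b (v i) (v i)) = (\<Sum>i\<in>UNIV. b (w i) (w i))"
  using row_trace_frame[OF assms(1,2,3)] row_trace_frame[OF assms(1,2,4)] by simp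

lemma bilinear_uminus: "bilinear b \<Longrightarrow> bilinear (\<lambda>x y. - b x y)"
  by (auto simp: bilinear_def linear_iff)

abbreviation first_form :: "('p, 'n::finite) chart \<Rightarrow> ('p \<Rightarrow> 'e::euclidean_space) \<Rightarrow> 'p \<Rightarrow>
    real ^ 'n \<Rightarrow> real ^ 'n \<Rightarrow> real" where
  "first_form c X p \<equiv> (\<lambda>v w. chart_deriv c X p v \<bullet> chart_deriv c X p w)"

lemma orthonormal_frame_iff:
  "orthonormal_frame c (\<bullet>) X p v \<longleftrightarrow> orthonormal_for (first_form c X p) v"
  by (simp add: orthonormal_frame_def orthonormal_for_def)

context smooth_manifold
begin

lemma bilinear_first_form:
  "smooth_map \<A> X \<Longrightarrow> c \<in> \<A> \<Longrightarrow> p \<in> fst c \<Longrightarrow> bilinear (first_form c X p)"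
  by (intro bilinear_pullback_inner linear_chart_deriv)

lemma bilinear_second_fundamental_form:
  assumes "smooth_map \<A> X" "smooth_map \<A> N" "c \<in> \<A>" "p \<in> fst c"
  shows "bilinear (second_fundamental_form c X N p)"
  unfolding second_fundamental_form_def[abs_def]
  by (intro bilinear_uminus bilinear_pullback_inner linear_chart_deriv assms)

text \<open>The differential of a coordinate change carries orthonormal frames to orthonormal frames, and the
  trace is the same for all of them. So the chart and frame chosen in the definition can be replaced
  by any others.\<close>

lemma mean_curvature_frame:
  assumes X: "immersion \<A> X" and N: "smooth_map \<A> N" and c: "c \<in> \<A>" "p \<in> fst c"
    and v: "orthonormal_for (first_form c X p) v"
  shows "mean_curvature \<A> X N p = (\<Sum>i\<in>UNIV. second_fundamental_form c X N p (v i) (v i))"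
proof -
  let ?d = "chart_at \<A> p"
  note d = chart_at[of p]
  note Xs = immersion_smooth[OF X]
  define w where "w i = transition c ?d p (v i)" for i
  have dX: "chart_deriv ?d X p (w i) = chart_deriv c X p (v i)" for i
    using chart_deriv_transition[OF Xs c d] by (simp add: w_def)
  have dN: "chart_deriv ?d N p (w i) = chart_deriv c N p (v i)" for i
    using chart_deriv_transition[OF N c d] by (simp add: w_def)
  have w: "orthonormal_for (first_form ?d X p) w"
    using v by (simp add: orthonormal_for_def dX)
  define u where "u = (SOME u. orthonormal_frame ?d (\<bullet>) X p u)"
  have u: "orthonormal_for (first_form ?d X p) u"
    unfolding u_def orthonormal_frame_iff[symmetric]
    by (rule someI[of _ w]) (use w in \<open>simp only: orthonormal_frame_iff\<close>)
  have "mean_curvature \<A> X N p = (\<Sum>i\<in>UNIV. second_fundamental_form ?d X N p (u i) (u i))"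
    by (simp add: mean_curvature_def Let_def u_def)
  also have "\<dots> = (\<Sum>i\<in>UNIV. second_fundamental_form ?d X N p (w i) (w i))"
    by (rule frame_sum_independent[OF bilinear_first_form[OF Xs d]
          bilinear_second_fundamental_form[OF Xs N d] u w])
  also have "\<dots> = (\<Sum>i\<in>UNIV. second_fundamental_form c X N p (v i) (v i))"
    by (simp add: second_fundamental_form_def dX dN)
  finally show ?thesis .
qed

text \<open>A rational expression in the derivatives of \<open>X\<close> and \<open>N\<close>: it shows that the mean curvature is
  continuous, although its definition makes arbitrary choices at every point.\<close>

lemma mean_curvature_eq_row_trace:
  assumes X: "immersion \<A> X" and N: "smooth_map \<A> N" and c: "c \<in> \<A>" "p \<in> fst c"
  shows "mean_curvature \<A> X N p =
    row_trace (gram_matrix c X p) (form_matrix (second_fundamental_form c X N p)) / det (gram_matrix c X p)"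
proof -
  note Xs = immersion_smooth[OF X]
  obtain v where v: "orthonormal_for (first_form c X p) v"
    by (rule immersion_frame[OF X c])
  from row_trace_frame[OF bilinear_first_form[OF Xs c] bilinear_second_fundamental_form[OF Xs N c] v]
  show ?thesis
    unfolding mean_curvature_frame[OF X N c v] gram_matrix_eq by simp
qed

lemma continuous_on_chart_deriv:
  "smooth_map \<A> F \<Longrightarrow> c \<in> \<A> \<Longrightarrow> continuous_on (coords c) (\<lambda>x. chart_deriv c F (chart_inv c x) v)"
  using smooth_on_imp_continuous_on[OF smooth_on_chart_deriv] .

lemma continuous_on_mean_curvature:
  assumes X: "immersion \<A> X" and N: "smooth_map \<A> N" and c: "c \<in> \<A>"
  shows "continuous_on (coords c) (\<lambda>x. mean_curvature \<A> X N (chart_inv c x))"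
proof -
  let ?G = "\<lambda>x. gram_matrix c X (chart_inv c x)"
  let ?M = "\<lambda>x. form_matrix (second_fundamental_form c X N (chart_inv c x))"
  note dX = continuous_on_chart_deriv[OF immersion_smooth[OF X] c]
  note dN = continuous_on_chart_deriv[OF N c]
  have G: "continuous_on (coords c) (\<lambda>x. ?G x $ i $ j)" for i j
    by (simp add: gram_matrix_def) (intro continuous_intros dX)
  have M: "continuous_on (coords c) (\<lambda>x. ?M x $ i $ j)" for i j
    by (simp add: form_matrix_def second_fundamental_form_def) (intro continuous_intros dX dN)
  have entry: "continuous_on (coords c) (\<lambda>x. (if i = k then ?M x $ i else ?G x $ i) $ j)" for i j k
    using G M by (cases "i = k") simp_all
  have "continuous_on (coords c) (\<lambda>x. row_trace (?G x) (?M x) / det (?G x))"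
  proof (intro continuous_on_divide continuous_on_gram[OF immersion_smooth[OF X] c])
    show "continuous_on (coords c) (\<lambda>x. row_trace (?G x) (?M x))"
      unfolding row_trace_def det_def vec_lambda_beta
      by (intro continuous_intros entry)
    show "\<forall>x\<in>coords c. det (?G x) \<noteq> 0"
      using det_gram_pos[OF X c chart_inv_mem] by (metis less_irrefl)
  qed
  then show ?thesis
    by (rule continuous_on_cong[THEN iffD1, rotated -1])
       (simp_all add: mean_curvature_eq_row_trace[OF X N c] chart_inv_mem)
qed

end

section \<open>Mean curvature in the Gaussian conformal metric\<close>

lemma matrix_inv_scaled_identity:
  fixes a :: real
  assumes "a \<noteq> 0"
  shows "matrix_inv (a *\<^sub>R mat 1 :: real ^ 'm::finite ^ 'm) = (1 / a) *\<^sub>R mat 1"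
proof -
  let ?A = "a *\<^sub>R mat 1 :: real ^ 'm ^ 'm" and ?B = "(1 / a) *\<^sub>R mat 1 :: real ^ 'm ^ 'm"
  have AB: "?A ** ?B = mat 1" "?B ** ?A = mat 1"
    using assms
    by (simp_all add: matrix_matrix_mult_def mat_def vec_eq_iff mult_delta_left mult_delta_right)
  show ?thesis
    unfolding matrix_inv_def
  proof (rule some_equality)
    fix C
    assume "?A ** C = mat 1 \<and> C ** ?A = mat 1"
    then have "C ** (?A ** ?B) = ?B" by (simp only: matrix_mul_assoc matrix_mul_lid)
    then show "C = ?B" by (simp only: AB matrix_mul_rid)
  qed (use AB in blast)
qed

lemma gauss_metric_entry_derivative:
  fixes X0 y :: "real ^ 'm::finite"
  shows "partial_deriv A (\<lambda>z. gauss_metric n X0 t0 z $ B $ D) y =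
    (if B = D then 2 * exp (- (norm (y - X0))\<^sup>2 / (real n * t0)) *
      ((- 1 / (real n * t0)) *\<^sub>R (y - X0)) $ A else 0)"
proof (cases "B = D")
  case True
  define k where "k = - 1 / (real n * t0)"
  have "((\<lambda>z. exp (k * ((z - X0) \<bullet> (z - X0)))) has_derivative
      (\<lambda>h. 2 * exp (k * ((y - X0) \<bullet> (y - X0))) * (k * ((y - X0) \<bullet> h)))) (at y)"
    by (auto intro!: derivative_eq_intros simp: inner_commute algebra_simps)
  from frechet_derivative_at[OF this]
  have "partial_deriv A (\<lambda>z. exp (k * ((z - X0) \<bullet> (z - X0)))) y =
      2 * exp (k * ((y - X0) \<bullet> (y - X0))) * (k * ((y - X0) \<bullet> axis A 1))"
    unfolding partial_deriv_def by metis
  then show ?thesis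
    using True by (simp add: gauss_metric_def mat_def power2_norm_eq_inner inner_axis k_def)
next
  case False
  then show ?thesis
    by (simp add: partial_deriv_def gauss_metric_def mat_def)
qed

text \<open>The metric is \<open>exp (2 u)\<close> times the Euclidean one with \<open>u y = - |y - X0|\<^sup>2 / (2 n t0)\<close>, and
  \<open>a\<close> is the gradient of \<open>u\<close>.\<close>

lemma christoffel_gauss_metric:
  fixes X0 y :: "real ^ 'm::finite" and n :: nat and t0 :: real
  defines "a \<equiv> (- 1 / (real n * t0)) *\<^sub>R (y - X0)"
  shows "christoffel (gauss_metric n X0 t0) y C A B =
    (if B = C then a $ A else 0) + (if A = C then a $ B else 0) - (if A = B then a $ C else 0)"
proof -
  let ?E = "exp (- (norm (y - X0))\<^sup>2 / (real n * t0))"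
  have pd: "partial_deriv A' (\<lambda>z. gauss_metric n X0 t0 z $ B' $ D') y =
      (if B' = D' then 2 * ?E * a $ A' else 0)" for A' B' D'
    by (simp add: gauss_metric_entry_derivative a_def)
  have inv: "matrix_inv (gauss_metric n X0 t0 y) $ C $ D = (if C = D then 1 / ?E else 0)" for D
    unfolding gauss_metric_def matrix_inv_scaled_identity[OF exp_not_eq_zero] by (simp add: mat_def)
  have "christoffel (gauss_metric n X0 t0) y C A B =
      1 / 2 * (\<Sum>D\<in>UNIV. if C = D then 1 / ?E * ((if B = D then 2 * ?E * a $ A else 0) +
        (if A = D then 2 * ?E * a $ B else 0) - (if A = B then 2 * ?E * a $ D else 0)) else 0)"
    unfolding christoffel_def pd inv by (intro arg_cong2[where f = "(*)"] sum.cong) auto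
  also have "\<dots> = 1 / 2 * (1 / ?E * ((if B = C then 2 * ?E * a $ A else 0) +
        (if A = C then 2 * ?E * a $ B else 0) - (if A = B then 2 * ?E * a $ C else 0)))"
    by simp
  also have "\<dots> = (if B = C then a $ A else 0) + (if A = C then a $ B else 0) - (if A = B then a $ C else 0)"
    by (simp add: field_simps)
  finally show ?thesis .
qed

lemma covariant_deriv_gauss_metric:
  fixes X \<nu> :: "'p \<Rightarrow> real ^ 'm::finite" and X0 :: "real ^ 'm" and n :: nat and t0 :: real
  defines "a \<equiv> \<lambda>p. (- 1 / (real n * t0)) *\<^sub>R (X p - X0)"
  shows "covariant_deriv (gauss_metric n X0 t0) c X \<nu> p v = chart_deriv c \<nu> p v +
    (a p \<bullet> chart_deriv c X p v) *\<^sub>R \<nu> p + (a p \<bullet> \<nu> p) *\<^sub>R chart_deriv c X p v -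
    (chart_deriv c X p v \<bullet> \<nu> p) *\<^sub>R a p"
proof -
  let ?x = "chart_deriv c X p v"
  have "(\<Sum>A\<in>UNIV. \<Sum>B\<in>UNIV. christoffel (gauss_metric n X0 t0) (X p) C A B * ?x $ A * \<nu> p $ B) =
      (a p \<bullet> ?x) * \<nu> p $ C + (a p \<bullet> \<nu> p) * ?x $ C - (?x \<bullet> \<nu> p) * a p $ C" for C
  proof -
    have "(\<Sum>A\<in>UNIV. \<Sum>B\<in>UNIV. christoffel (gauss_metric n X0 t0) (X p) C A B * ?x $ A * \<nu> p $ B) =
        (\<Sum>A\<in>UNIV. \<Sum>B\<in>UNIV. (if B = C then a p $ A * ?x $ A * \<nu> p $ B else 0)) +
        (\<Sum>A\<in>UNIV. \<Sum>B\<in>UNIV. (if A = C then a p $ B * ?x $ A * \<nu> p $ B else 0)) -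
        (\<Sum>A\<in>UNIV. \<Sum>B\<in>UNIV. (if A = B then a p $ C * ?x $ A * \<nu> p $ B else 0))"
      unfolding christoffel_gauss_metric sum.distrib[symmetric] sum_subtractf[symmetric]
      by (intro sum.cong refl) (auto simp: a_def algebra_simps)
    also have "(\<Sum>A\<in>UNIV. \<Sum>B\<in>UNIV. (if B = C then a p $ A * ?x $ A * \<nu> p $ B else 0)) = (a p \<bullet> ?x) * \<nu> p $ C"
      by (simp add: inner_vec_def sum_distrib_right)
    also have "(\<Sum>A\<in>UNIV. \<Sum>B\<in>UNIV. (if A = C then a p $ B * ?x $ A * \<nu> p $ B else 0)) = (a p \<bullet> \<nu> p) * ?x $ C"
      by (subst sum.swap) (simp add: inner_vec_def sum_distrib_left mult_ac)
    also have "(\<Sum>A\<in>UNIV. \<Sum>B\<in>UNIV. (if A = B then a p $ C * ?x $ A * \<nu> p $ B else 0)) = (?x \<bullet> \<nu> p) * a p $ C"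
      by (simp add: inner_vec_def sum_distrib_left sum_distrib_right mult_ac)
    finally show ?thesis .
  qed
  then show ?thesis by (simp add: covariant_deriv_def vec_eq_iff)
qed

lemma metric_inner_gauss:
  "metric_inner (gauss_metric n X0 t0) y u w = exp (- (norm (y - X0))\<^sup>2 / (real n * t0)) * (u \<bullet> w)"
  by (simp add: metric_inner_def gauss_metric_def scaleR_matrix_vector_assoc[symmetric])

text \<open>With \<open>\<nu> = exp (- u) N\<close>, the covariant derivative of \<open>\<nu>\<close> along \<open>v\<close> is
  \<open>exp (- u) (dN v + \<langle>a, N\<rangle> dX v)\<close>, since \<open>dX v\<close> is orthogonal to \<open>N\<close>. Multiplying a
  \<open>g\<close>-orthonormal frame by \<open>exp u\<close> makes it orthonormal for the Euclidean metric, and the trace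
  of the second term is \<open>n \<langle>a, N\<rangle> = - \<langle>X - X0, N\<rangle> / t0\<close>.\<close>

lemma (in smooth_manifold) weighted_mean_curvature_eq:
  fixes X N :: "'p \<Rightarrow> real ^ 'm::finite"
  assumes X: "immersion \<A> X" and N: "unit_normal \<A> X N" and t0: "t0 \<noteq> 0"
  shows "weighted_mean_curvature \<A> X N X0 t0 p =
    ((1 / t0) *\<^sub>R (X p - X0)) \<bullet> N p + mean_curvature \<A> X N p"
proof -
  define n where "n = CARD('n)"
  have n: "0 < real n" by (simp add: n_def)
  define c where "c = chart_at \<A> p"
  have c: "c \<in> \<A>" "p \<in> fst c" using chart_at by (auto simp: c_def)
  have Xs: "smooth_map \<A> X" and Ns: "smooth_map \<A> N" and N1: "\<And>p. norm (N p) = 1"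
    and XN: "\<And>v. chart_deriv c X p v \<bullet> N p = 0"
    using X N c by (auto simp: immersion_def unit_normal_def)
  let ?G = "gauss_metric n X0 t0 :: real ^ 'm \<Rightarrow> real ^ 'm ^ 'm"
  define k where "k = - 1 / (2 * real n * t0)"
  define u where "u y = k * ((y - X0) \<bullet> (y - X0))" for y :: "real ^ 'm"
  have E: "exp (- (norm (y - X0))\<^sup>2 / (real n * t0)) = exp (u y) * exp (u y)" for y
    unfolding exp_add[symmetric] using n t0 by (simp add: u_def k_def power2_norm_eq_inner field_simps)
  have Eu: "exp (- (norm (y - X0))\<^sup>2 / (2 * real n * t0)) = exp (u y)" for y
    by (simp add: u_def k_def power2_norm_eq_inner)
  define \<nu> where "\<nu> = metric_normalize ?G X N"
  have \<nu>: "\<nu> q = exp (- u (X q)) *\<^sub>R N q" for q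
  proof -
    have "metric_inner ?G (X q) (N q) (N q) = exp (u (X q)) * exp (u (X q))"
      unfolding metric_inner_gauss E using N1[of q] by (simp add: norm_eq_1)
    then show ?thesis by (simp add: \<nu>_def metric_normalize_def exp_minus inverse_eq_divide)
  qed
  define a where "a = (- 1 / (real n * t0)) *\<^sub>R (X p - X0)"
  have du: "(u has_derivative (\<lambda>h. a \<bullet> h)) (at (X p))"
  proof -
    have "(u has_derivative (\<lambda>h. k * ((X p - X0) \<bullet> h + h \<bullet> (X p - X0)))) (at (X p))"
      unfolding u_def[abs_def] by (auto intro!: derivative_eq_intros)
    moreover have "k * ((X p - X0) \<bullet> h + h \<bullet> (X p - X0)) = a \<bullet> h" for h
      using n t0 by (simp add: a_def k_def inner_commute)
    ultimately show ?thesis by simp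
  qed
  let ?dX = "chart_deriv c X p" and ?dN = "chart_deriv c N p"
  have pc: "chart_inv c (snd c p) = p" using chart_inv_chart[OF c] .
  have dX: "((X \<circ> chart_inv c) has_derivative ?dX) (at (snd c p))"
    by (rule chart_has_derivative[OF Xs c])
  have dN: "((N \<circ> chart_inv c) has_derivative ?dN) (at (snd c p))"
    by (rule chart_has_derivative[OF Ns c])
  have "(u has_derivative (\<lambda>h. a \<bullet> h)) (at ((X \<circ> chart_inv c) (snd c p)))"
    using du by (simp add: pc)
  from has_derivative_compose[OF dX this]
  have duX: "((\<lambda>x. u ((X \<circ> chart_inv c) x)) has_derivative (\<lambda>v. a \<bullet> ?dX v)) (at (snd c p))" .
  have "((\<lambda>x. exp (- u ((X \<circ> chart_inv c) x)) *\<^sub>R (N \<circ> chart_inv c) x) has_derivative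
      (\<lambda>v. exp (- u (X p)) *\<^sub>R (?dN v - (a \<bullet> ?dX v) *\<^sub>R N p))) (at (snd c p))"
    by (rule derivative_eq_intros duX dN refl)+
       (simp add: pc fun_eq_iff algebra_simps)
  then have "((\<nu> \<circ> chart_inv c) has_derivative
      (\<lambda>v. exp (- u (X p)) *\<^sub>R (?dN v - (a \<bullet> ?dX v) *\<^sub>R N p))) (at (snd c p))"
    by (simp add: \<nu> o_def)
  from frechet_derivative_at[OF this, symmetric]
  have d\<nu>: "chart_deriv c \<nu> p v = exp (- u (X p)) *\<^sub>R (?dN v - (a \<bullet> ?dX v) *\<^sub>R N p)" for v
    by (simp only: chart_deriv_def[of c \<nu>])
  have sff: "metric_second_fundamental_form ?G c X \<nu> p v w =
      exp (u (X p)) * (second_fundamental_form c X N p v w - (a \<bullet> N p) * (?dX v \<bullet> ?dX w))" for v w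
  proof -
    have "covariant_deriv ?G c X \<nu> p v = exp (- u (X p)) *\<^sub>R (?dN v + (a \<bullet> N p) *\<^sub>R ?dX v)"
      unfolding covariant_deriv_gauss_metric d\<nu> \<nu> a_def[symmetric]
      by (simp add: XN algebra_simps)
    then show ?thesis
      unfolding metric_second_fundamental_form_def metric_inner_gauss E
      by (simp add: second_fundamental_form_def exp_minus inner_simps field_simps)
  qed
  have frame: "orthonormal_frame c (metric_inner ?G (X p)) X p v \<longleftrightarrow>
      orthonormal_for (first_form c X p) (\<lambda>i. exp (u (X p)) *\<^sub>R v i)" for v
    using linear_chart_deriv[OF Xs c]
    unfolding orthonormal_frame_def orthonormal_for_def metric_inner_gauss E
    by (simp add: linear_cmul mult.assoc)
  obtain w where w: "orthonormal_for (first_form c X p) w"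
    by (rule immersion_frame[OF X c])
  have "orthonormal_frame c (metric_inner ?G (X p)) X p (\<lambda>i. exp (- u (X p)) *\<^sub>R w i)"
    unfolding frame using w by (simp flip: exp_add)
  then have "\<exists>v. orthonormal_frame c (metric_inner ?G (X p)) X p v"
    by (intro exI[of _ "\<lambda>i. exp (- u (X p)) *\<^sub>R w i"])
  note ex_frame = someI_ex[OF this]
  define v where "v = (SOME v. orthonormal_frame c (metric_inner ?G (X p)) X p v)"
  have "orthonormal_frame c (metric_inner ?G (X p)) X p v"
    unfolding v_def by (rule ex_frame)
  then have v: "orthonormal_for (first_form c X p) (\<lambda>i. exp (u (X p)) *\<^sub>R v i)" (is "orthonormal_for _ ?w")
    by (simp only: frame)
  have bil: "bilinear (second_fundamental_form c X N p)"
    by (rule bilinear_second_fundamental_form[OF Xs Ns c])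
  have one: "exp (u (X p)) * exp (u (X p)) * (?dX (v i) \<bullet> ?dX (v i)) = 1" for i
    using v linear_chart_deriv[OF Xs c] by (simp add: orthonormal_for_def linear_cmul mult.assoc)
  have "weighted_mean_curvature \<A> X N X0 t0 p =
      exp (u (X p)) * (\<Sum>i\<in>UNIV. metric_second_fundamental_form ?G c X \<nu> p (v i) (v i))"
    unfolding weighted_mean_curvature_def metric_mean_curvature_def Let_def n_def[symmetric] Eu
    by (simp add: v_def c_def \<nu>_def)
  also have "\<dots> = (\<Sum>i\<in>UNIV. second_fundamental_form c X N p (?w i) (?w i) - (a \<bullet> N p))"
  proof -
    have "exp (u (X p)) * metric_second_fundamental_form ?G c X \<nu> p (v i) (v i) =
        second_fundamental_form c X N p (?w i) (?w i) - (a \<bullet> N p)" for i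
    proof -
      have "exp (u (X p)) * metric_second_fundamental_form ?G c X \<nu> p (v i) (v i) =
          exp (u (X p)) * exp (u (X p)) * second_fundamental_form c X N p (v i) (v i) -
          (a \<bullet> N p) * (exp (u (X p)) * exp (u (X p)) * (?dX (v i) \<bullet> ?dX (v i)))"
        by (simp add: sff algebra_simps)
      then show ?thesis
        unfolding one by (simp add: bilinear_lmul[OF bil] bilinear_rmul[OF bil])
    qed
    then show ?thesis by (simp add: sum_distrib_left)
  qed
  also have "\<dots> = mean_curvature \<A> X N p - real n * (a \<bullet> N p)"
    by (simp add: sum_subtractf mean_curvature_frame[OF X Ns c v] n_def)
  also have "real n * (a \<bullet> N p) = - (((1 / t0) *\<^sub>R (X p - X0)) \<bullet> N p)"
    using n t0 by (simp add: a_def)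
  finally show ?thesis by simp
qed


section \<open>Differentiation under the area integral\<close>

context smooth_manifold
begin

lemma continuous_on_manifold:
  assumes "\<And>c. c \<in> \<A> \<Longrightarrow> continuous_on (coords c) (\<lambda>x. g (chart_inv c x))"
  shows "continuous_on UNIV g"
proof -
  have "continuous_on (fst c) g" if c: "c \<in> \<A>" for c
  proof -
    have "continuous_on (fst c) (\<lambda>p. g (chart_inv c (snd c p)))"
      by (rule continuous_on_compose2[OF assms[OF c] continuous_on_chart[OF c]]) simp
    then show ?thesis
      by (rule continuous_on_cong[THEN iffD1, rotated -1]) (simp_all add: chart_inv_chart[OF c])
  qed
  then have "continuous_on (\<Union>c\<in>\<A>. fst c) g"
    by (intro continuous_on_open_UN open_chart(1))
  then show ?thesis by (simp add: charts_cover)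
qed

lemma coordinate_ball:
  obtains c r where "c \<in> \<A>" "p \<in> fst c" "0 < r" "cball (snd c p) r \<subseteq> coords c"
    "open (chart_inv c ` ball (snd c p) r)" "p \<in> chart_inv c ` ball (snd c p) r"
    "chart_inv c ` ball (snd c p) r \<subseteq> fst c"
    "snd c ` chart_inv c ` ball (snd c p) r = ball (snd c p) r"
proof -
  let ?c = "chart_at \<A> p"
  note c = chart_at[of p]
  have "snd ?c p \<in> coords ?c" using c by simp
  then obtain r where r: "0 < r" "cball (snd ?c p) r \<subseteq> coords ?c"
    using open_chart(2)[OF c(1)] open_contains_cball by blast
  let ?B = "ball (snd ?c p) r"
  have B: "?B \<subseteq> coords ?c" using r(2) ball_subset_cball by blast
  note eq = chart_inv_image_eq[OF c(1) B]
  show ?thesis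
  proof (rule that[OF c r])
    show "open (chart_inv ?c ` ?B)"
      unfolding eq
      by (rule continuous_open_preimage[OF continuous_on_chart[OF c(1)] open_chart(1)[OF c(1)] open_ball])
    show "p \<in> chart_inv ?c ` ?B" unfolding eq using c r by simp
    show "chart_inv ?c ` ?B \<subseteq> fst ?c" unfolding eq by simp
    show "snd ?c ` chart_inv ?c ` ?B = ?B"
      using B chart_chart_inv[of _ ?c] by (simp add: image_image subset_iff)
  qed
qed

text \<open>Cover \<open>K\<close> by finitely many coordinate balls on whose closures the density is bounded.\<close>

lemma area_finite_on_compact:
  assumes \<mu>: "is_area_measure Y \<mu>" and Y: "immersion \<A> Y" and K: "compact K"
  shows "emeasure \<mu> K < \<infinity>"
proof -
  have "\<exists>U. open U \<and> p \<in> U \<and> emeasure \<mu> U < \<infinity>" for p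
  proof -
    obtain c r where c: "c \<in> \<A>" "p \<in> fst c" and r: "0 < r" "cball (snd c p) r \<subseteq> coords c"
      and U: "open (chart_inv c ` ball (snd c p) r)" "p \<in> chart_inv c ` ball (snd c p) r"
        "chart_inv c ` ball (snd c p) r \<subseteq> fst c"
        "snd c ` chart_inv c ` ball (snd c p) r = ball (snd c p) r"
      by (rule coordinate_ball[of p])
    let ?C = "cball (snd c p) r"
    have "continuous_on ?C (area_density c Y)"
    proof (rule continuous_on_cong[THEN iffD1])
      show "continuous_on ?C (\<lambda>x. sqrt (det (gram_matrix c Y (chart_inv c x))))"
        by (intro continuous_on_real_sqrt continuous_on_subset[OF continuous_on_gram r(2)]
            immersion_smooth Y c)
    qed (use r(2) in \<open>auto simp: area_density_def\<close>)
    then have "bounded (area_density c Y ` ?C)"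
      by (intro compact_imp_bounded compact_continuous_image) auto
    then obtain M where "\<forall>y\<in>area_density c Y ` ?C. norm y \<le> M" unfolding bounded_iff by blast
    then have M: "area_density c Y x \<le> M" if "x \<in> ?C" for x using that by force
    have "emeasure \<mu> (chart_inv c ` ball (snd c p) r) = emeasure (chart_area c Y) (ball (snd c p) r)"
      using \<mu> c(1) U unfolding is_area_measure_def by (metis borel_open)
    also have "\<dots> = (\<integral>\<^sup>+x\<in>ball (snd c p) r. ennreal (area_density c Y x) \<partial>lborel)"
      by (rule emeasure_chart_area[OF Y c(1)]) simp
    also have "\<dots> \<le> (\<integral>\<^sup>+x. ennreal M * indicator ?C x \<partial>lborel)"
      using M by (intro nn_integral_mono) (auto intro!: ennreal_leI split: split_indicator)
    also have "\<dots> = ennreal M * emeasure lborel ?C"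
      by (simp add: nn_integral_cmult_indicator)
    also have "\<dots> < \<infinity>"
      using emeasure_bounded_finite[OF bounded_cball, of "snd c p" r] by (simp add: ennreal_mult_less_top)
    finally show ?thesis using U by blast
  qed
  then obtain U where U: "\<And>p. open (U p)" "\<And>p. p \<in> U p" "\<And>p. emeasure \<mu> (U p) < \<infinity>" by metis
  obtain C where C: "C \<subseteq> K" "finite C" "K \<subseteq> (\<Union>p\<in>C. U p)"
    by (rule compactE_image[OF K, of K U]) (use U in auto)
  have s: "sets \<mu> = sets borel" by (rule sets_area_measure[OF \<mu>])
  have "emeasure \<mu> K \<le> emeasure \<mu> (\<Union>p\<in>C. U p)"
    by (rule emeasure_mono[OF C(3)]) (simp add: s borel_open open_UN U(1))
  also have "\<dots> \<le> (\<Sum>p\<in>C. emeasure \<mu> (U p))"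
    by (rule emeasure_subadditive_finite) (use C(2) U(1) s in auto)
  also have "\<dots> < \<infinity>" using U(3) C(2) by simp
  finally show ?thesis .
qed

text \<open>The constant \<open>M\<close> bounds the derivative in \<open>t\<close> over the product of \<open>[- \<epsilon> / 2, \<epsilon> / 2]\<close> with a
  closed coordinate ball. It serves to dominate the difference quotients.\<close>

lemma C1_family_locally_lipschitz:
  fixes a :: "real \<Rightarrow> 'p \<Rightarrow> real"
  assumes \<epsilon>: "0 < \<epsilon>"
    and C1: "\<And>c. c \<in> \<A> \<Longrightarrow> Ck_on 1 ({-\<epsilon><..<\<epsilon>} \<times> coords c) (\<lambda>(t, x). a t (chart_inv c x))"
  obtains U M where "open U" "p \<in> U"
    "\<And>q t. q \<in> U \<Longrightarrow> \<bar>t\<bar> \<le> \<epsilon> / 2 \<Longrightarrow> \<bar>a t q - a 0 q\<bar> \<le> M * \<bar>t\<bar>"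
proof -
  obtain c r where c: "c \<in> \<A>" "p \<in> fst c" and r: "0 < r" "cball (snd c p) r \<subseteq> coords c"
    and U: "open (chart_inv c ` ball (snd c p) r)" "p \<in> chart_inv c ` ball (snd c p) r"
    by (rule coordinate_ball[of p])
  define b where "b = (\<lambda>(t, x). a t (chart_inv c x))"
  define D where "D z = frechet_derivative b (at z) (1, 0)" for z
  let ?S = "{-\<epsilon><..<\<epsilon>} \<times> coords c" and ?C = "{-(\<epsilon> / 2)..\<epsilon> / 2} \<times> cball (snd c p) r"
  have C1': "Ck_on (Suc 0) ?S b" using C1[OF c(1)] by (simp add: b_def)
  have CS: "?C \<subseteq> ?S" using \<epsilon> r(2) by auto
  have "continuous_on ?S D" using C1' by (simp add: D_def[abs_def])
  then have "bounded (D ` ?C)"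
    by (intro compact_imp_bounded compact_continuous_image compact_Times continuous_on_subset[OF _ CS]) auto
  then obtain M where M: "\<And>z. z \<in> ?C \<Longrightarrow> norm (D z) \<le> M" unfolding bounded_iff by blast
  show ?thesis
  proof (rule that[OF U])
    fix q t
    assume q: "q \<in> chart_inv c ` ball (snd c p) r" and t: "\<bar>t\<bar> \<le> \<epsilon> / 2"
    then obtain x where x: "q = chart_inv c x" "x \<in> ball (snd c p) r" by blast
    have "norm (b (t, x) - b (0, x)) \<le> M * norm (t - 0)"
    proof (rule field_differentiable_bound[where S = "{-(\<epsilon> / 2)..\<epsilon> / 2}" and f' = "\<lambda>t. D (t, x)"])
      fix s
      assume s: "s \<in> {-(\<epsilon> / 2)..\<epsilon> / 2}"
      have sx: "(s, x) \<in> ?C" using s x by auto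
      then show "norm (D (s, x)) \<le> M" by (rule M)
      have "(b has_derivative frechet_derivative b (at (s, x))) (at (s, x))"
        using Ck_on_Suc_has_derivative[OF C1'] sx CS by blast
      moreover have "((\<lambda>s. (s, x)) has_derivative (\<lambda>h. (h, 0))) (at s)"
        by (auto intro!: derivative_eq_intros)
      ultimately have "((\<lambda>s. b (s, x)) has_derivative (\<lambda>h. frechet_derivative b (at (s, x)) (h, 0))) (at s)"
        using has_derivative_compose by blast
      moreover have "frechet_derivative b (at (s, x)) (h, 0) = D (s, x) * h" for h
      proof -
        have "linear (frechet_derivative b (at (s, x)))"
          using \<open>(b has_derivative _) _\<close> has_derivative_linear by blast
        from linear_cmul[OF this, of h "(1, 0)"] show ?thesis by (simp add: D_def)
      qed
      ultimately show "((\<lambda>s. b (s, x)) has_field_derivative D (s, x)) (at s within {-(\<epsilon> / 2)..\<epsilon> / 2})"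
        by (simp add: has_field_derivative_def has_derivative_at_withinI)
    qed (use t \<epsilon> in auto)
    then show "\<bar>a t q - a 0 q\<bar> \<le> M * \<bar>t\<bar>" by (simp add: b_def x)
  qed
qed

lemma C1_family_continuous:
  fixes a :: "real \<Rightarrow> 'p \<Rightarrow> real"
  assumes C1: "\<And>c. c \<in> \<A> \<Longrightarrow> Ck_on 1 ({-\<epsilon><..<\<epsilon>} \<times> coords c) (\<lambda>(t, x). a t (chart_inv c x))"
    and t: "\<bar>t\<bar> < \<epsilon>"
  shows "continuous_on UNIV (a t)"
proof (rule continuous_on_manifold)
  fix c
  assume c: "c \<in> \<A>"
  have "continuous_on (coords c) (\<lambda>x. (\<lambda>(t, x). a t (chart_inv c x)) (t, x))"
    by (rule continuous_on_compose2[OF Ck_on_imp_continuous_on[OF C1[OF c]]])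
       (use t in \<open>auto simp: abs_less_iff intro!: continuous_intros\<close>)
  then show "continuous_on (coords c) (\<lambda>x. a t (chart_inv c x))" by simp
qed

lemma set_integrable_compact:
  fixes g :: "'p \<Rightarrow> real"
  assumes "sets \<mu> = sets borel" "emeasure \<mu> K < \<infinity>" "compact K" "continuous_on UNIV g"
  shows "set_integrable \<mu> K g"
proof -
  have "bounded (g ` K)"
    by (intro compact_imp_bounded compact_continuous_image continuous_on_subset[OF assms(4)] assms(3)) auto
  then obtain M where M: "\<And>p. p \<in> K \<Longrightarrow> norm (g p) \<le> M" unfolding bounded_iff by blast
  have m: "g \<in> borel_measurable \<mu>"
    using borel_measurable_continuous_onI[OF assms(4)] measurable_cong_sets[OF assms(1) refl] by blast
  have K: "K \<in> sets \<mu>" using assms(1) borel_compact[OF assms(3)] by simp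
  show ?thesis
    unfolding set_integrable_def
    by (rule integrableI_bounded_set_indicator[OF K m assms(2), of M]) (use M in auto)
qed

text \<open>Finitely many of the local Lipschitz constants give one constant \<open>B\<close> for all of \<open>K\<close>. The
  difference quotients at \<open>0\<close> are bounded by \<open>B\<close> on \<open>K\<close>, which has finite measure, so the
  limit may be taken under the integral along every sequence tending to \<open>0\<close>.\<close>

lemma has_real_derivative_area_integral:
  fixes a :: "real \<Rightarrow> 'p \<Rightarrow> real"
  assumes \<mu>: "sets \<mu> = sets borel" "emeasure \<mu> K < \<infinity>" and K: "compact K" and \<epsilon>: "0 < \<epsilon>"
    and C1: "\<And>c. c \<in> \<A> \<Longrightarrow> Ck_on 1 ({-\<epsilon><..<\<epsilon>} \<times> coords c) (\<lambda>(t, x). a t (chart_inv c x))"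
    and der: "\<And>p. ((\<lambda>t. a t p) has_real_derivative a' p) (at 0)"
  shows "((\<lambda>t. LINT p:K|\<mu>. a t p) has_real_derivative (LINT p:K|\<mu>. a' p)) (at 0)"
proof -
  have "\<exists>U M. open U \<and> p \<in> U \<and> (\<forall>q\<in>U. \<forall>t. \<bar>t\<bar> \<le> \<epsilon> / 2 \<longrightarrow> \<bar>a t q - a 0 q\<bar> \<le> M * \<bar>t\<bar>)" for p
    by (rule C1_family_locally_lipschitz[OF \<epsilon> C1, of p]) blast+
  then obtain U M where U: "\<And>p. open (U p)" "\<And>p. p \<in> U p"
    and M: "\<And>p q t. q \<in> U p \<Longrightarrow> \<bar>t\<bar> \<le> \<epsilon> / 2 \<Longrightarrow> \<bar>a t q - a 0 q\<bar> \<le> M p * \<bar>t\<bar>"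
    by metis
  obtain C where C: "C \<subseteq> K" "finite C" "K \<subseteq> (\<Union>p\<in>C. U p)"
    by (rule compactE_image[OF K, of K U]) (use U in auto)
  define B where "B = (\<Sum>p\<in>C. \<bar>M p\<bar>)"
  have B: "\<bar>a t q - a 0 q\<bar> \<le> B * \<bar>t\<bar>" if q: "q \<in> K" and t: "\<bar>t\<bar> \<le> \<epsilon> / 2" for q t
  proof -
    obtain p where p: "p \<in> C" "q \<in> U p" using C(3) q by blast
    have "M p \<le> B" unfolding B_def using member_le_sum[OF p(1), of "\<lambda>p. \<bar>M p\<bar>"] C(2) by simp
    then show ?thesis using M[OF p(2) t] mult_right_mono[of "M p" B "\<bar>t\<bar>"] by simp
  qed
  have int: "set_integrable \<mu> K (a t)" if "\<bar>t\<bar> < \<epsilon>" for t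
    by (rule set_integrable_compact[OF \<mu> K C1_family_continuous[OF C1 that]])
  have "K \<in> sets \<mu>" using \<mu>(1) borel_compact[OF K] by simp
  then have Bint: "integrable \<mu> (\<lambda>p. indicator K p *\<^sub>R B)"
    using \<mu>(2) by (intro integrable_scaleR_left integrable_real_indicator) auto
  show ?thesis
    unfolding DERIV_def tendsto_at_iff_sequentially
  proof (intro allI impI)
    fix X :: "nat \<Rightarrow> real"
    assume X0: "\<forall>i. X i \<in> UNIV - {0}" and X: "X \<longlonglongrightarrow> 0"
    \<comment> \<open>The bound by \<open>B\<close> holds for \<open>\<bar>t\<bar> \<le> \<epsilon> / 2\<close> only, so the start of the sequence is dropped.\<close>
    have "\<forall>\<^sub>F i in sequentially. \<bar>X i\<bar> < \<epsilon> / 2"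
      using tendstoD[OF X, of "\<epsilon> / 2"] \<epsilon> by (simp add: dist_norm)
    then obtain n where n: "\<And>i. i \<ge> n \<Longrightarrow> \<bar>X i\<bar> < \<epsilon> / 2" unfolding eventually_sequentially by blast
    define Y where "Y i = X (i + n)" for i
    have Y0: "Y i \<noteq> 0" and Y1: "\<bar>Y i\<bar> < \<epsilon> / 2" for i using X0 n by (auto simp: Y_def)
    have Y: "Y \<longlonglongrightarrow> 0" unfolding Y_def[abs_def] by (rule LIMSEQ_ignore_initial_segment[OF X])
    define s where "s i p = indicator K p *\<^sub>R ((a (Y i) p - a 0 p) / Y i)" for i p
    have lim: "(\<lambda>i. s i p) \<longlonglongrightarrow> indicator K p *\<^sub>R a' p" for p
    proof -
      have "((\<lambda>h. (a h p - a 0 p) / h) \<longlongrightarrow> a' p) (at 0)"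
        using der[of p] by (simp add: DERIV_def)
      then have "(\<lambda>i. (a (Y i) p - a 0 p) / Y i) \<longlonglongrightarrow> a' p"
        using Y Y0 unfolding tendsto_at_iff_sequentially comp_def by blast
      then show ?thesis unfolding s_def by (intro tendsto_intros)
    qed
    have Ye: "\<bar>Y i\<bar> < \<epsilon>" for i using Y1[of i] \<epsilon> by linarith
    have sint: "integrable \<mu> (s i)" for i
      using set_integral_diff(1)[OF int[OF Ye[of i]] int[of 0]] \<epsilon>
      unfolding set_integrable_def s_def[abs_def] by (simp add: divide_inverse flip: mult.assoc)
    have "(\<lambda>i. LINT p|\<mu>. s i p) \<longlonglongrightarrow> (LINT p|\<mu>. indicator K p *\<^sub>R a' p)"
    proof (rule integral_dominated_convergence[OF _ _ Bint])
      show "s i \<in> borel_measurable \<mu>" for i using sint by blast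
      then show "(\<lambda>p. indicator K p *\<^sub>R a' p) \<in> borel_measurable \<mu>"
        by (rule borel_measurable_LIMSEQ_real[OF lim, rotated])
      show "AE p in \<mu>. (\<lambda>i. s i p) \<longlonglongrightarrow> indicator K p *\<^sub>R a' p" using lim by simp
      show "AE p in \<mu>. norm (s i p) \<le> indicator K p *\<^sub>R B" for i
        using B[of _ "Y i"] Y0[of i] Y1[of i]
        by (auto simp: s_def abs_divide divide_le_eq split: split_indicator)
    qed
    moreover have "(LINT p|\<mu>. s i p) = ((LINT p:K|\<mu>. a (Y i) p) - (LINT p:K|\<mu>. a 0 p)) / Y i" for i
    proof -
      have "(LINT p:K|\<mu>. a (Y i) p) - (LINT p:K|\<mu>. a 0 p) = (LINT p:K|\<mu>. a (Y i) p - a 0 p)"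
        using set_integral_diff(2)[OF int[OF Ye[of i]] int[of 0]] \<epsilon> by simp
      then show ?thesis
        by (simp add: s_def set_lebesgue_integral_def)
    qed
    ultimately have "(\<lambda>i. ((LINT p:K|\<mu>. a (Y i) p) - (LINT p:K|\<mu>. a 0 p)) / Y i) \<longlonglongrightarrow> (LINT p:K|\<mu>. a' p)"
      by (simp add: set_lebesgue_integral_def)
    then have "(\<lambda>i. ((\<lambda>h. ((LINT p:K|\<mu>. a (0 + h) p) - (LINT p:K|\<mu>. a 0 p)) / h) \<circ> X) (i + n))
        \<longlonglongrightarrow> (LINT p:K|\<mu>. a' p)"
      by (simp add: Y_def comp_def)
    then show "((\<lambda>h. ((LINT p:K|\<mu>. a (0 + h) p) - (LINT p:K|\<mu>. a 0 p)) / h) \<circ> X) \<longlonglongrightarrow> (LINT p:K|\<mu>. a' p)"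
      by (rule LIMSEQ_offset)
  qed
qed

section \<open>Comparing the area measures of two immersions\<close>

text \<open>The density of the area measure of \<open>Y\<close> with respect to that of \<open>X\<close>. The Jacobians of a
  coordinate change cancel in the quotient, so the choice of the chart does not matter.\<close>

definition area_ratio :: "('p \<Rightarrow> 'e::euclidean_space) \<Rightarrow> ('p \<Rightarrow> 'e) \<Rightarrow> 'p \<Rightarrow> real" where
  "area_ratio Y X p =
     sqrt (det (gram_matrix (chart_at \<A> p) Y p)) / sqrt (det (gram_matrix (chart_at \<A> p) X p))"

lemma area_ratio_chart:
  assumes X: "immersion \<A> X" and Y: "immersion \<A> Y" and c: "c \<in> \<A>" "p \<in> fst c"
  shows "area_ratio Y X p = sqrt (det (gram_matrix c Y p)) / sqrt (det (gram_matrix c X p))"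
proof -
  note d = chart_at[of p]
  have "det (gram_matrix (chart_at \<A> p) X p) > 0" by (rule det_gram_pos[OF X d])
  then show ?thesis
    unfolding area_ratio_def sqrt_det_gram_transition[OF immersion_smooth[OF X] d c]
      sqrt_det_gram_transition[OF immersion_smooth[OF Y] d c]
    using sqrt_det_gram_transition[OF immersion_smooth[OF X] d c] by auto
qed

lemma area_ratio_nonneg:
  assumes "immersion \<A> X" "immersion \<A> Y"
  shows "0 \<le> area_ratio Y X p"
  unfolding area_ratio_def
  using det_gram_pos[OF assms(1) chart_at[of p]] det_gram_pos[OF assms(2) chart_at[of p]] by simp

lemma continuous_on_area_ratio:
  assumes X: "immersion \<A> X" and Y: "immersion \<A> Y"
  shows "continuous_on UNIV (area_ratio Y X)"
proof (rule continuous_on_manifold)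
  fix c
  assume c: "c \<in> \<A>"
  have "continuous_on (coords c) (\<lambda>x. sqrt (det (gram_matrix c Y (chart_inv c x))) /
      sqrt (det (gram_matrix c X (chart_inv c x))))"
  proof (intro continuous_on_divide continuous_on_real_sqrt continuous_on_gram immersion_smooth X Y c ballI)
    fix x
    assume "x \<in> coords c"
    then show "sqrt (det (gram_matrix c X (chart_inv c x))) \<noteq> 0"
      using det_gram_pos[OF X c chart_inv_mem, of x] by simp
  qed
  then show "continuous_on (coords c) (\<lambda>x. area_ratio Y X (chart_inv c x))"
    by (rule continuous_on_cong[THEN iffD1, rotated -1])
       (simp_all add: area_ratio_chart[OF X Y c] chart_inv_mem)
qed

text \<open>Hence all area measures along a variation are densities over the fixed measure of the initial
  immersion.\<close>

lemma area_measure_density: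
  assumes X: "immersion \<A> X" and Y: "immersion \<A> Y"
  shows "area_measure \<A> Y = density (area_measure \<A> X) (\<lambda>p. ennreal (area_ratio Y X p))"
proof (rule area_measure_unique[OF area_measure[OF Y]])
  let ?\<mu> = "area_measure \<A> X"
  have s: "sets ?\<mu> = sets borel" by (rule sets_area_measure[OF area_measure[OF X]])
  have J: "(\<lambda>p. ennreal (area_ratio Y X p)) \<in> borel_measurable borel"
    using borel_measurable_continuous_onI[OF continuous_on_area_ratio[OF X Y]] by simp
  have J': "(\<lambda>p. ennreal (area_ratio Y X p)) \<in> borel_measurable ?\<mu>"
    using J measurable_cong_sets[OF s refl] by blast
  have "emeasure (density ?\<mu> (\<lambda>p. ennreal (area_ratio Y X p))) B = emeasure (chart_area c Y) (snd c ` B)"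
    if c: "c \<in> \<A>" and B: "B \<in> sets borel" "B \<subseteq> fst c" for c B
  proof -
    have "emeasure (density ?\<mu> (\<lambda>p. ennreal (area_ratio Y X p))) B =
        (\<integral>\<^sup>+p\<in>B. ennreal (area_ratio Y X p) \<partial>?\<mu>)"
      by (rule emeasure_density[OF J']) (use B s in simp)
    also have "\<dots> = (\<integral>\<^sup>+x\<in>snd c ` B. ennreal (area_density c X x) * ennreal (area_ratio Y X (chart_inv c x)) \<partial>lborel)"
      by (rule nn_integral_area_measure[OF area_measure[OF X] X c B J])
    also have "\<dots> = (\<integral>\<^sup>+x\<in>snd c ` B. ennreal (area_density c Y x) \<partial>lborel)"
    proof (intro nn_integral_cong)
      fix x
      have "ennreal (area_density c X x) * ennreal (area_ratio Y X (chart_inv c x)) =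
          ennreal (area_density c Y x)" if "x \<in> snd c ` B"
      proof -
        have x: "x \<in> coords c" using that B(2) by blast
        have "area_density c X x * area_ratio Y X (chart_inv c x) = area_density c Y x"
          using x det_gram_pos[OF X c chart_inv_mem[OF x]]
          by (simp add: area_ratio_chart[OF X Y c chart_inv_mem] area_density_def)
        then show ?thesis
          using ennreal_mult[OF area_density_nonneg[OF X c, of x] area_ratio_nonneg[OF X Y, of "chart_inv c x"]]
          by simp
      qed
      then show "ennreal (area_density c X x) * ennreal (area_ratio Y X (chart_inv c x)) * indicator (snd c ` B) x =
          ennreal (area_density c Y x) * indicator (snd c ` B) x"
        by (auto split: split_indicator)
    qed
    also have "\<dots> = emeasure (chart_area c Y) (snd c ` B)"
      by (rule emeasure_chart_area[OF Y c borel_chart_image[OF c B], symmetric])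
    finally show ?thesis .
  qed
  then show "is_area_measure Y (density ?\<mu> (\<lambda>p. ennreal (area_ratio Y X p)))"
    unfolding is_area_measure_def using s by simp
qed

lemma area_measure_set_integral:
  fixes g :: "'p \<Rightarrow> real"
  assumes X: "immersion \<A> X" and Y: "immersion \<A> Y" and K: "compact K" and g: "continuous_on UNIV g"
  shows "(LINT p:K|area_measure \<A> Y. g p) = (LINT p:K|area_measure \<A> X. area_ratio Y X p * g p)"
proof -
  let ?\<mu> = "area_measure \<A> X"
  have s: "sets ?\<mu> = sets borel" by (rule sets_area_measure[OF area_measure[OF X]])
  have m: "h \<in> borel_measurable ?\<mu>" if "h \<in> borel_measurable borel" for h :: "'p \<Rightarrow> real"
    using that measurable_cong_sets[OF s refl] by blast
  have J: "area_ratio Y X \<in> borel_measurable ?\<mu>"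
    by (intro m borel_measurable_continuous_onI continuous_on_area_ratio X Y)
  have gK: "(\<lambda>p. indicator K p *\<^sub>R g p) \<in> borel_measurable ?\<mu>"
    using borel_compact[OF K] borel_measurable_continuous_onI[OF g] by (intro m) auto
  show ?thesis
    unfolding set_lebesgue_integral_def area_measure_density[OF X Y]
    by (subst integral_density[OF gK J])
       (auto simp: area_ratio_nonneg[OF X Y] intro!: Bochner_Integration.integral_cong split: split_indicator)
qed

end


section \<open>The first variation\<close>

lemma Ck_on_sqrt: "Ck_on 1 {0<..} sqrt"
  unfolding One_nat_def
  by (rule Ck_on_Suc_real[where g' = "\<lambda>x. inverse (sqrt x) / 2"])
     (auto intro!: DERIV_real_sqrt continuous_intros)

lemma Ck_on_inverse: "Ck_on 1 {0<..} (inverse :: real \<Rightarrow> real)"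
  unfolding One_nat_def
  by (rule Ck_on_Suc_real[where g' = "\<lambda>x. - (inverse x * inverse x)"])
     (auto intro!: derivative_eq_intros continuous_intros simp: power2_eq_square)

lemma Ck_on_compose_snd:
  assumes "open I" "open S" "Ck_on k S g"
  shows "Ck_on k (I \<times> S) (\<lambda>z. g (snd z))"
  by (rule Ck_on_compose[OF open_Times[OF assms(1,2)] assms(2) _ Ck_on_bounded_linear[OF bounded_linear_snd] assms(3)])
     auto

definition in_chart :: "(real \<Rightarrow> 'p \<Rightarrow> 'e) \<Rightarrow> ('p, 'n::finite) chart \<Rightarrow> real \<times> (real ^ 'n) \<Rightarrow> 'e" where
  "in_chart F c = (\<lambda>(t, x). F t (chart_inv c x))"

context smooth_manifold
begin

lemma smooth_map_Ck_on:
  assumes "smooth_map \<A> g" "c \<in> \<A>"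
  shows "Ck_on k (coords c) (\<lambda>x. g (chart_inv c x))"
  using assms by (simp add: smooth_map_def smooth_on_def comp_def)

lemma smooth_map_continuous_on: "smooth_map \<A> g \<Longrightarrow> continuous_on UNIV g"
  by (intro continuous_on_manifold Ck_on_imp_continuous_on[OF smooth_map_Ck_on])

lemma smooth_map_Ck_on_snd:
  assumes "smooth_map \<A> g" "c \<in> \<A>" "open I"
  shows "Ck_on k (I \<times> coords c) (\<lambda>z. g (chart_inv c (snd z)))"
  by (rule Ck_on_compose_snd[OF assms(3) open_chart(2)[OF assms(2)] smooth_map_Ck_on[OF assms(1,2)]])

lemma variation_smooth:
  "normal_variation \<A> X N K \<epsilon> F \<Longrightarrow> c \<in> \<A> \<Longrightarrow> smooth_on ({-\<epsilon><..<\<epsilon>} \<times> coords c) (in_chart F c)"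
  by (simp add: normal_variation_def in_chart_def)

lemma variation_has_derivative:
  assumes "normal_variation \<A> X N K \<epsilon> F" "c \<in> \<A>" "t \<in> {-\<epsilon><..<\<epsilon>}" "x \<in> coords c"
  shows "(in_chart F c has_derivative frechet_derivative (in_chart F c) (at (t, x))) (at (t, x))"
  by (rule smooth_on_has_derivative[OF variation_smooth[OF assms(1,2)]]) (use assms in blast)

lemma chart_deriv_variation:
  assumes V: "normal_variation \<A> X N K \<epsilon> F" and c: "c \<in> \<A>" "p \<in> fst c" and t: "t \<in> {-\<epsilon><..<\<epsilon>}"
  shows "chart_deriv c (F t) p v = frechet_derivative (in_chart F c) (at (t, snd c p)) (0, v)"
proof -
  have "((\<lambda>x. (t, x)) has_derivative (\<lambda>v. (0, v))) (at (snd c p))"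
    by (auto intro!: derivative_eq_intros)
  from has_derivative_compose[OF this variation_has_derivative[OF V c(1) t]]
  have "((F t \<circ> chart_inv c) has_derivative
      (\<lambda>v. frechet_derivative (in_chart F c) (at (t, snd c p)) (0, v))) (at (snd c p))"
    using c by (simp add: in_chart_def comp_def)
  from frechet_derivative_at[OF this, symmetric] show ?thesis
    by (simp only: chart_deriv_def)
qed

lemma variation_velocity:
  assumes V: "normal_variation \<A> X N K \<epsilon> F" and c: "c \<in> \<A>" "x \<in> coords c"
    and f: "\<And>p. ((\<lambda>t. F t p) has_vector_derivative f p *\<^sub>R N p) (at 0)"
  shows "frechet_derivative (in_chart F c) (at (0, x)) (1, 0) = f (chart_inv c x) *\<^sub>R N (chart_inv c x)"
proof -
  let ?D = "frechet_derivative (in_chart F c) (at (0, x))"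
  have \<epsilon>: "0 < \<epsilon>" using V by (simp add: normal_variation_def)
  have D: "(in_chart F c has_derivative ?D) (at (0, x))"
    using variation_has_derivative[OF V c(1) _ c(2), of 0] \<epsilon> by simp
  have "((\<lambda>t. (t, x)) has_derivative (\<lambda>h. (h, 0))) (at 0)"
    by (auto intro!: derivative_eq_intros)
  from has_derivative_compose[OF this D]
  have der: "((\<lambda>t. F t (chart_inv c x)) has_derivative (\<lambda>h. ?D (h, 0))) (at 0)"
    by (simp add: in_chart_def)
  have scale: "?D (h, 0) = h *\<^sub>R ?D (1, 0)" for h
    using linear_cmul[OF has_derivative_linear[OF D], of h "(1, 0)"] by simp
  have "((\<lambda>t. F t (chart_inv c x)) has_vector_derivative ?D (1, 0)) (at 0)"
    unfolding has_vector_derivative_def ext[OF scale, symmetric] by (rule der)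
  then show ?thesis using f vector_derivative_unique_at by blast
qed

text \<open>The time derivative of \<open>dF\<^sub>t v\<close> is the derivative of the velocity \<open>f N\<close> along \<open>v\<close>, and
  \<open>s\<close> is the derivative of \<open>f\<close>. The term with \<open>s\<close> is normal and will vanish in inner products with
  tangent vectors.\<close>

lemma variation_tangent_derivative:
  assumes V: "normal_variation \<A> X N K \<epsilon> F" and N: "unit_normal \<A> X N"
    and c: "c \<in> \<A>" "p \<in> fst c"
    and f: "\<And>p. ((\<lambda>t. F t p) has_vector_derivative f p *\<^sub>R N p) (at 0)"
  shows "\<exists>s. ((\<lambda>t. chart_deriv c (F t) p v) has_vector_derivative
    s *\<^sub>R N p + f p *\<^sub>R chart_deriv c N p v) (at 0)"
proof -
  let ?S = "{-\<epsilon><..<\<epsilon>} \<times> coords c" and ?x = "snd c p"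
  define D where "D u z = frechet_derivative (in_chart F c) (at z) u" for u z
  have \<epsilon>: "0 < \<epsilon>" using V by (simp add: normal_variation_def)
  have Ns: "smooth_map \<A> N" and N1: "\<And>p. norm (N p) = 1" using N by (auto simp: unit_normal_def)
  have oS: "open ?S" by (intro open_Times open_chart c) simp
  have x: "?x \<in> coords c" "chart_inv c ?x = p" using c chart_inv_chart[OF c] by auto
  have zS: "(0, ?x) \<in> ?S" using \<epsilon> x by simp
  have smF: "smooth_on ?S (in_chart F c)" by (rule variation_smooth[OF V c(1)])
  have smD: "smooth_on ?S (D u)" for u unfolding D_def[abs_def] by (rule smooth_on_derivative[OF smF])
  have dD: "(D u has_derivative frechet_derivative (D u) (at (0, ?x))) (at (0, ?x))" for u
    by (rule smooth_on_has_derivative[OF smD zS])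
  have sym: "frechet_derivative (D (0, v)) (at (0, ?x)) (1, 0) = frechet_derivative (D (1, 0)) (at (0, ?x)) (0, v)"
    using second_derivative_symmetric[OF oS zS smooth_on_imp_Ck_on[OF smF], of "(0, v)" "(1, 0)"]
    by (simp add: D_def[abs_def])
  have "((\<lambda>t. (t, ?x)) has_derivative (\<lambda>h. (h, 0))) (at 0)"
    by (auto intro!: derivative_eq_intros)
  from has_derivative_compose[OF this dD]
  have der: "((\<lambda>t. D (0, v) (t, ?x)) has_derivative (\<lambda>h. frechet_derivative (D (0, v)) (at (0, ?x)) (h, 0))) (at 0)" .
  have scale: "frechet_derivative (D (0, v)) (at (0, ?x)) (h, 0) =
      h *\<^sub>R frechet_derivative (D (0, v)) (at (0, ?x)) (1, 0)" for h
    using linear_cmul[OF has_derivative_linear[OF dD[of "(0, v)"]], of h "(1, 0)"] by simp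
  have "((\<lambda>t. D (0, v) (t, ?x)) has_vector_derivative
      frechet_derivative (D (1, 0)) (at (0, ?x)) (0, v)) (at 0)"
    unfolding sym[symmetric] has_vector_derivative_def ext[OF scale, symmetric] by (rule der)
  then have lhs: "((\<lambda>t. chart_deriv c (F t) p v) has_vector_derivative
      frechet_derivative (D (1, 0)) (at (0, ?x)) (0, v)) (at 0)"
    by (rule has_vector_derivative_transform_within_open[where S = "{-\<epsilon><..<\<epsilon>}"])
       (use \<epsilon> chart_deriv_variation[OF V c] in \<open>auto simp: D_def\<close>)
  \<comment> \<open>By the symmetry of second derivatives this is also the derivative along \<open>v\<close> of the velocity,
    which is \<open>f N\<close>; there \<open>f\<close> is differentiable, being the inner product of the velocity with \<open>N\<close>.\<close>
  have "((\<lambda>y. (0 :: real, y)) has_derivative (\<lambda>v. (0, v))) (at ?x)"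
    by (auto intro!: derivative_eq_intros)
  from has_derivative_compose[OF this dD]
  have vel: "((\<lambda>y. D (1, 0) (0, y)) has_derivative (\<lambda>v. frechet_derivative (D (1, 0)) (at (0, ?x)) (0, v))) (at ?x)" .
  have dN: "((\<lambda>y. N (chart_inv c y)) has_derivative chart_deriv c N p) (at ?x)"
    using chart_has_derivative[OF Ns c] by (simp add: comp_def)
  define g where "g y = D (1, 0) (0, y) \<bullet> N (chart_inv c y)" for y
  obtain g' where g': "(g has_derivative g') (at ?x)"
    unfolding g_def[abs_def] using has_derivative_inner[OF vel dN] by blast
  have Dg: "D (1, 0) (0, y) = f (chart_inv c y) *\<^sub>R N (chart_inv c y)"
    and g: "g y = f (chart_inv c y)" if "y \<in> coords c" for y
  proof -
    show *: "D (1, 0) (0, y) = f (chart_inv c y) *\<^sub>R N (chart_inv c y)"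
      unfolding D_def by (rule variation_velocity[OF V c(1) that f])
    show "g y = f (chart_inv c y)"
      using N1 by (simp add: g_def * norm_eq_1)
  qed
  have "((\<lambda>y. g y *\<^sub>R N (chart_inv c y)) has_derivative (\<lambda>v. g ?x *\<^sub>R chart_deriv c N p v + g' v *\<^sub>R N p)) (at ?x)"
    using has_derivative_scaleR[OF g' dN] x by simp
  then have "((\<lambda>y. D (1, 0) (0, y)) has_derivative (\<lambda>v. g ?x *\<^sub>R chart_deriv c N p v + g' v *\<^sub>R N p)) (at ?x)"
    by (rule has_derivative_transform_within_open[OF _ open_chart(2)[OF c(1)] x(1)]) (simp add: Dg g)
  from has_derivative_unique[OF vel this]
  have "frechet_derivative (D (1, 0)) (at (0, ?x)) (0, v) = g' v *\<^sub>R N p + f p *\<^sub>R chart_deriv c N p v"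
    using g[OF x(1)] x(2) by (metis add.commute)
  then show ?thesis using lhs by auto
qed

text \<open>By the preceding lemma the Gram matrix has the time derivative \<open>b = - 2 f h\<close>, symmetrized in its
  two arguments. Jacobi's formula, evaluated in an orthonormal frame, gives
  \<open>- 2 f H det g\<close> for the determinant, and the square root halves the factor.\<close>

lemma area_ratio_derivative:
  assumes X: "immersion \<A> X" and N: "unit_normal \<A> X N" and V: "normal_variation \<A> X N K \<epsilon> F"
    and f: "\<And>p. ((\<lambda>t. F t p) has_vector_derivative f p *\<^sub>R N p) (at 0)"
  shows "((\<lambda>t. area_ratio (F t) X p) has_real_derivative - (f p * mean_curvature \<A> X N p)) (at 0)"
proof -
  define c where "c = chart_at \<A> p"
  have c: "c \<in> \<A>" "p \<in> fst c" using chart_at by (auto simp: c_def)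
  have Xs: "smooth_map \<A> X" by (rule immersion_smooth[OF X])
  have Ns: "smooth_map \<A> N" and XN: "\<And>v. chart_deriv c X p v \<bullet> N p = 0"
    using N c by (auto simp: unit_normal_def)
  have F0: "F 0 = X" using V by (simp add: normal_variation_def)
  let ?h = "second_fundamental_form c X N p" and ?G = "gram_matrix c X p"
  define b where "b v w = - f p * (?h v w + ?h w v)" for v w
  have "((\<lambda>t. chart_deriv c (F t) p v \<bullet> chart_deriv c (F t) p w) has_real_derivative b v w) (at 0)" for v w
  proof -
    obtain s s' where s: "((\<lambda>t. chart_deriv c (F t) p v) has_vector_derivative
          s *\<^sub>R N p + f p *\<^sub>R chart_deriv c N p v) (at 0)"
        "((\<lambda>t. chart_deriv c (F t) p w) has_vector_derivative
          s' *\<^sub>R N p + f p *\<^sub>R chart_deriv c N p w) (at 0)"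
      using variation_tangent_derivative[OF V N c f] by metis
    have "((\<lambda>t. chart_deriv c (F t) p v \<bullet> chart_deriv c (F t) p w) has_real_derivative
        chart_deriv c X p v \<bullet> (s' *\<^sub>R N p + f p *\<^sub>R chart_deriv c N p w) +
        (s *\<^sub>R N p + f p *\<^sub>R chart_deriv c N p v) \<bullet> chart_deriv c X p w) (at 0)"
      using bounded_bilinear.has_vector_derivative[OF bounded_bilinear_inner s]
      by (simp add: F0 has_real_derivative_iff_has_vector_derivative)
    moreover have "chart_deriv c X p v \<bullet> (s' *\<^sub>R N p + f p *\<^sub>R chart_deriv c N p w) +
        (s *\<^sub>R N p + f p *\<^sub>R chart_deriv c N p v) \<bullet> chart_deriv c X p w = b v w"
      using XN[of v] XN[of w]
      by (simp add: b_def second_fundamental_form_def inner_simps inner_commute algebra_simps)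
    ultimately show ?thesis by simp
  qed
  then have "((\<lambda>t. gram_matrix c (F t) p $ i $ j) has_real_derivative form_matrix b $ i $ j) (at 0)" for i j
    by (simp add: gram_matrix_def form_matrix_def)
  from det_has_real_derivative[where G = "\<lambda>t. gram_matrix c (F t) p", OF this]
  have det': "((\<lambda>t. det (gram_matrix c (F t) p)) has_real_derivative row_trace ?G (form_matrix b)) (at 0)"
    by (simp add: F0)
  obtain v where v: "orthonormal_for (first_form c X p) v" by (rule immersion_frame[OF X c])
  have hbil: "bilinear ?h" by (rule bilinear_second_fundamental_form[OF Xs Ns c])
  then have bbil: "bilinear b"
    by (auto simp: bilinear_def b_def linear_iff algebra_simps)
  have "(\<Sum>i\<in>UNIV. b (v i) (v i)) = - 2 * f p * mean_curvature \<A> X N p"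
    by (simp add: mean_curvature_frame[OF X Ns c v] b_def sum_distrib_left mult_ac)
  then have tr: "row_trace ?G (form_matrix b) = det ?G * (- 2 * f p * mean_curvature \<A> X N p)"
    using row_trace_frame(2)[OF bilinear_first_form[OF Xs c] bbil v] by (simp add: gram_matrix_eq)
  have pos: "0 < det ?G" by (rule det_gram_pos[OF X c])
  have "((\<lambda>t. sqrt (det (gram_matrix c (F t) p)) / sqrt (det ?G)) has_real_derivative
      (inverse (sqrt (det ?G)) / 2 * row_trace ?G (form_matrix b)) / sqrt (det ?G)) (at 0)"
    by (intro DERIV_cdivide DERIV_chain2[where f = sqrt] det') (use pos F0 DERIV_real_sqrt in auto)
  moreover have "(inverse (sqrt (det ?G)) / 2 * row_trace ?G (form_matrix b)) / sqrt (det ?G) =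
      - (f p * mean_curvature \<A> X N p)"
    unfolding tr using pos real_sqrt_mult_self[of "det ?G"] by (simp add: field_simps)
  ultimately show ?thesis by (simp add: area_ratio_def c_def)
qed

lemma variation_integrand_C1:
  fixes X :: "'p \<Rightarrow> 'b::euclidean_space"
  assumes X: "immersion \<A> X" and V: "normal_variation \<A> X N K \<epsilon> F" and c: "c \<in> \<A>"
  shows "Ck_on 1 ({-\<epsilon><..<\<epsilon>} \<times> coords c)
    (\<lambda>(t, x). area_ratio (F t) X (chart_inv c x) * exp (- (norm (F t (chart_inv c x) - X0))\<^sup>2 / (2 * t0)))"
proof -
  let ?S = "{-\<epsilon><..<\<epsilon>} \<times> coords c"
  have oS: "open ?S" by (intro open_Times open_chart c) simp
  have Xs: "smooth_map \<A> X" by (rule immersion_smooth[OF X])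
  have im: "immersion \<A> (F t)" if "t \<in> {-\<epsilon><..<\<epsilon>}" for t
    using V that by (simp add: normal_variation_def)
  have smF: "smooth_on ?S (in_chart F c)" by (rule variation_smooth[OF V c])
  let ?D = "\<lambda>u z. frechet_derivative (in_chart F c) (at z) u"
  have D: "Ck_on 1 ?S (?D u)" for u
    by (rule smooth_on_imp_Ck_on[OF smooth_on_derivative[OF smF]])
  have gram: "gram_matrix c (F (fst z)) (chart_inv c (snd z)) $ i $ j = ?D (0, axis i 1) z \<bullet> ?D (0, axis j 1) z"
    if "z \<in> ?S" for z i j
    using that chart_deriv_variation[OF V c chart_inv_mem, of "snd z" "fst z"]
    by (auto simp: gram_matrix_def chart_chart_inv)
  have gramC: "Ck_on 1 ?S (\<lambda>z. gram_matrix c (F (fst z)) (chart_inv c (snd z)) $ i $ j)" for i j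
    by (rule Ck_on_cong[OF oS gram[symmetric] Ck_on_inner[OF oS D D]])
  have gramX: "Ck_on 1 ?S (\<lambda>z. gram_matrix c X (chart_inv c (snd z)) $ i $ j)" for i j
    unfolding gram_matrix_def vec_lambda_beta
    by (rule Ck_on_compose_snd[OF open_greaterThanLessThan open_chart(2)[OF c]
        Ck_on_inner[OF open_chart(2)[OF c] smooth_on_imp_Ck_on[OF smooth_on_chart_deriv[OF Xs c]]
          smooth_on_imp_Ck_on[OF smooth_on_chart_deriv[OF Xs c]]]])
  have det: "Ck_on 1 ?S (\<lambda>z. det (G z))" if "\<And>i j. Ck_on 1 ?S (\<lambda>z. G z $ i $ j)" for G :: "_ \<Rightarrow> real ^ 'n ^ 'n"
    unfolding det_def by (intro Ck_on_sum[OF oS] Ck_on_mult[OF oS] Ck_on_prod[OF oS] Ck_on_const that)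
  have pos: "0 < det (gram_matrix c (F (fst z)) (chart_inv c (snd z)))"
    "0 < det (gram_matrix c X (chart_inv c (snd z)))" if "z \<in> ?S" for z
    using that by (auto intro!: det_gram_pos[OF _ c chart_inv_mem] X im)
  have pc: "open {0::real<..}" by simp
  have sqrtF: "Ck_on 1 ?S (\<lambda>z. sqrt (det (gram_matrix c (F (fst z)) (chart_inv c (snd z)))))"
    by (rule Ck_on_compose[OF oS pc _ det[OF gramC] Ck_on_sqrt]) (use pos in auto)
  have sqrtX: "Ck_on 1 ?S (\<lambda>z. sqrt (det (gram_matrix c X (chart_inv c (snd z)))))"
    by (rule Ck_on_compose[OF oS pc _ det[OF gramX] Ck_on_sqrt]) (use pos in auto)
  have invX: "Ck_on 1 ?S (\<lambda>z. inverse (sqrt (det (gram_matrix c X (chart_inv c (snd z))))))"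
    by (rule Ck_on_compose[OF oS pc _ sqrtX Ck_on_inverse]) (use pos in auto)
  have FX0: "Ck_on 1 ?S (\<lambda>z. in_chart F c z - X0)"
    by (rule Ck_on_diff[OF oS smooth_on_imp_Ck_on[OF smF] Ck_on_const])
  have "Ck_on 1 ?S (\<lambda>z. exp (- 1 / (2 * t0) * ((in_chart F c z - X0) \<bullet> (in_chart F c z - X0))))"
    by (rule Ck_on_compose[OF oS open_UNIV subset_UNIV Ck_on_mult[OF oS Ck_on_const Ck_on_inner[OF oS FX0 FX0]] Ck_on_exp])
  from Ck_on_mult[OF oS Ck_on_mult[OF oS sqrtF invX] this]
  show ?thesis
  proof (rule Ck_on_cong[OF oS, rotated])
    fix z
    assume "z \<in> ?S"
    then obtain t x where z: "z = (t, x)" and t: "t \<in> {-\<epsilon><..<\<epsilon>}" and x: "x \<in> coords c" by blast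
    have r: "area_ratio (F t) X (chart_inv c x) = sqrt (det (gram_matrix c (F t) (chart_inv c x))) *
        inverse (sqrt (det (gram_matrix c X (chart_inv c x))))"
      unfolding area_ratio_chart[OF X im[OF t] c chart_inv_mem[OF x]] by (rule divide_inverse)
    have e: "- (norm y)\<^sup>2 / (2 * t0) = - 1 / (2 * t0) * (y \<bullet> y)" for y :: 'b
      by (simp add: power2_norm_eq_inner)
    show "sqrt (det (gram_matrix c (F (fst z)) (chart_inv c (snd z)))) *
        inverse (sqrt (det (gram_matrix c X (chart_inv c (snd z))))) *
        exp (- 1 / (2 * t0) * ((in_chart F c z - X0) \<bullet> (in_chart F c z - X0))) =
      (case z of (t, x) \<Rightarrow> area_ratio (F t) X (chart_inv c x) *
        exp (- (norm (F t (chart_inv c x) - X0))\<^sup>2 / (2 * t0)))"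
      unfolding z prod.case fst_conv snd_conv in_chart_def r e ..
  qed
qed

text \<open>The derivative of \<open>w\<close> along \<open>f N\<close> is \<open>- f w \<langle>X - X0, N\<rangle> / t0\<close>; together with \<open>- f H\<close> from the
  area element it gives the integrand.\<close>

theorem first_variation_weighted_area:
  assumes X: "immersion \<A> X" and N: "unit_normal \<A> X N" and V: "normal_variation \<A> X N K \<epsilon> F"
    and f: "\<And>p. ((\<lambda>t. F t p) has_vector_derivative f p *\<^sub>R N p) (at 0)"
  shows "(weighted_area \<A> K X0 t0 F has_real_derivative
    (LINT p:K|area_measure \<A> X. - (f p * (((1 / t0) *\<^sub>R (X p - X0)) \<bullet> N p + mean_curvature \<A> X N p)
      * exp (- (norm (X p - X0))\<^sup>2 / (2 * t0))))) (at 0)"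
proof -
  let ?\<mu> = "area_measure \<A> X"
  define w where "w t p = exp (- (norm (F t p - X0))\<^sup>2 / (2 * t0))" for t p
  have V': "0 < \<epsilon>" "compact K" "F 0 = X" "\<And>t. t \<in> {-\<epsilon><..<\<epsilon>} \<Longrightarrow> immersion \<A> (F t)"
    using V by (auto simp: normal_variation_def)
  have \<mu>: "sets ?\<mu> = sets borel" "emeasure ?\<mu> K < \<infinity>"
    using sets_area_measure[OF area_measure[OF X]] area_finite_on_compact[OF area_measure[OF X] X V'(2)]
    by auto
  have wexp: "w t p = exp (- 1 / (2 * t0) * ((F t p - X0) \<bullet> (F t p - X0)))" for t p
    by (simp add: w_def power2_norm_eq_inner)
  have dw: "((\<lambda>t. w t p) has_real_derivative - (w 0 p * (f p * (((1 / t0) *\<^sub>R (X p - X0)) \<bullet> N p)))) (at 0)" for p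
  proof -
    have "((\<lambda>t. F t p - X0) has_vector_derivative f p *\<^sub>R N p) (at 0)"
      using has_vector_derivative_diff[OF f has_vector_derivative_const] by simp
    from bounded_bilinear.has_vector_derivative[OF bounded_bilinear_inner this this]
    have "((\<lambda>t. (F t p - X0) \<bullet> (F t p - X0)) has_real_derivative 2 * (f p * ((X p - X0) \<bullet> N p))) (at 0)"
      by (simp add: has_real_derivative_iff_has_vector_derivative V'(3) inner_commute)
    from DERIV_cmult[OF this, of "- 1 / (2 * t0)"]
    have "((\<lambda>t. exp (- 1 / (2 * t0) * ((F t p - X0) \<bullet> (F t p - X0)))) has_real_derivative
        exp (- 1 / (2 * t0) * ((F 0 p - X0) \<bullet> (F 0 p - X0))) * (- 1 / (2 * t0) * (2 * (f p * ((X p - X0) \<bullet> N p))))) (at 0)"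
      by (rule DERIV_fun_exp)
    then show ?thesis by (simp add: wexp mult.commute)
  qed
  have w_cont: "continuous_on UNIV (w t)" if t: "t \<in> {-\<epsilon><..<\<epsilon>}" for t
    unfolding wexp
    by (intro continuous_intros smooth_map_continuous_on[OF immersion_smooth[OF V'(4)[OF t]]])
  have ratio0: "area_ratio (F 0) X p = 1" for p
    unfolding V'(3) area_ratio_def using det_gram_pos[OF X chart_at[of p]] by simp
  have "((\<lambda>t. area_ratio (F t) X p * w t p) has_real_derivative
      - (f p * (((1 / t0) *\<^sub>R (X p - X0)) \<bullet> N p + mean_curvature \<A> X N p) * w 0 p)) (at 0)" for p
    using DERIV_mult[OF area_ratio_derivative[OF X N V f, of p] dw[of p]]
    by (simp add: ratio0 algebra_simps)
  from has_real_derivative_area_integral[OF \<mu> V'(2,1) _ this]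
  have "((\<lambda>t. LINT p:K|?\<mu>. area_ratio (F t) X p * w t p) has_real_derivative
      (LINT p:K|?\<mu>. - (f p * (((1 / t0) *\<^sub>R (X p - X0)) \<bullet> N p + mean_curvature \<A> X N p) * w 0 p))) (at 0)"
    using variation_integrand_C1[OF X V] by (simp add: w_def)
  then have "((\<lambda>t. weighted_area \<A> K X0 t0 F t) has_real_derivative
      (LINT p:K|?\<mu>. - (f p * (((1 / t0) *\<^sub>R (X p - X0)) \<bullet> N p + mean_curvature \<A> X N p) * w 0 p))) (at 0)"
  proof (rule has_field_derivative_transform_within_open[where S = "{-\<epsilon><..<\<epsilon>}"])
    fix t
    assume t: "t \<in> {-\<epsilon><..<\<epsilon>}"
    show "(LINT p:K|?\<mu>. area_ratio (F t) X p * w t p) = weighted_area \<A> K X0 t0 F t"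
      using area_measure_set_integral[OF X V'(4)[OF t] V'(2) w_cont[OF t]]
      by (simp add: weighted_area_def w_def)
  qed (use V'(1) in auto)
  then show ?thesis by (simp add: w_def V'(3))
qed

theorem first_variation_weighted_volume:
  assumes X: "immersion \<A> X" and N: "unit_normal \<A> X N" and V: "normal_variation \<A> X N K \<epsilon> F"
    and f: "\<And>p. ((\<lambda>t. F t p) has_vector_derivative f p *\<^sub>R N p) (at 0)"
  shows "(weighted_volume \<A> X N K X0 t0 F has_real_derivative
    (LINT p:K|area_measure \<A> X. f p * exp (- (norm (X p - X0))\<^sup>2 / (2 * t0)))) (at 0)"
proof -
  let ?\<mu> = "area_measure \<A> X"
  have V': "0 < \<epsilon>" "compact K" using V by (auto simp: normal_variation_def)
  have \<mu>: "sets ?\<mu> = sets borel" "emeasure ?\<mu> K < \<infinity>"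
    using sets_area_measure[OF area_measure[OF X]] area_finite_on_compact[OF area_measure[OF X] X V'(2)]
    by auto
  have N1: "N p \<bullet> N p = 1" for p using N by (simp add: unit_normal_def norm_eq_1)
  have Ns: "smooth_map \<A> N" using N by (simp add: unit_normal_def)
  let ?w = "\<lambda>p. exp (- (norm (X p - X0))\<^sup>2 / (2 * t0))"
  have "((\<lambda>t. ((F t p - X0) \<bullet> N p) * ?w p) has_real_derivative f p * ?w p) (at 0)" for p
  proof -
    have "((\<lambda>t. F t p - X0) has_vector_derivative f p *\<^sub>R N p) (at 0)"
      using has_vector_derivative_diff[OF f has_vector_derivative_const] by simp
    from bounded_linear.has_vector_derivative[OF bounded_linear_inner_left this, of "N p"]
    have "((\<lambda>t. (F t p - X0) \<bullet> N p) has_real_derivative f p) (at 0)"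
      by (simp add: has_real_derivative_iff_has_vector_derivative N1)
    then show ?thesis by (rule DERIV_cmult_right)
  qed
  moreover have "Ck_on 1 ({-\<epsilon><..<\<epsilon>} \<times> coords c)
      (\<lambda>(t, x). ((F t (chart_inv c x) - X0) \<bullet> N (chart_inv c x)) * ?w (chart_inv c x))" if c: "c \<in> \<A>" for c
  proof -
    let ?S = "{-\<epsilon><..<\<epsilon>} \<times> coords c"
    have oS: "open ?S" by (intro open_Times open_chart c) simp
    have XX0: "Ck_on 1 ?S (\<lambda>z. X (chart_inv c (snd z)) - X0)"
      by (rule Ck_on_diff[OF oS smooth_map_Ck_on_snd[OF immersion_smooth[OF X] c open_greaterThanLessThan] Ck_on_const])
    have FX0: "Ck_on 1 ?S (\<lambda>z. in_chart F c z - X0)"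
      by (rule Ck_on_diff[OF oS smooth_on_imp_Ck_on[OF variation_smooth[OF V c]] Ck_on_const])
    have "Ck_on 1 ?S (\<lambda>z. exp (- 1 / (2 * t0) * ((X (chart_inv c (snd z)) - X0) \<bullet> (X (chart_inv c (snd z)) - X0))))"
      by (rule Ck_on_compose[OF oS open_UNIV subset_UNIV Ck_on_mult[OF oS Ck_on_const Ck_on_inner[OF oS XX0 XX0]] Ck_on_exp])
    from Ck_on_mult[OF oS Ck_on_inner[OF oS FX0 smooth_map_Ck_on_snd[OF Ns c open_greaterThanLessThan]] this]
    show ?thesis
      by (rule Ck_on_cong[OF oS, rotated]) (auto simp: in_chart_def power2_norm_eq_inner)
  qed
  ultimately show ?thesis
    unfolding weighted_volume_def[abs_def]
    by (intro has_real_derivative_area_integral[OF \<mu> V'(2,1)])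
qed

end


section \<open>Normal variations supported in a chart\<close>

context smooth_manifold
begin

definition chart_extend :: "('p, 'n) chart \<Rightarrow> (real ^ 'n \<Rightarrow> real) \<Rightarrow> 'p \<Rightarrow> real" where
  "chart_extend c g p = (if p \<in> fst c then g (snd c p) else 0)"

lemma compact_chart_inv_image:
  "c \<in> \<A> \<Longrightarrow> compact S \<Longrightarrow> S \<subseteq> coords c \<Longrightarrow> compact (chart_inv c ` S)"
  by (rule compact_continuous_image[OF continuous_on_subset[OF continuous_on_chart_inv]])

lemma chart_extend_outside:
  assumes c: "c \<in> \<A>" and g: "\<And>x. x \<notin> S \<Longrightarrow> g x = 0" and p: "p \<notin> chart_inv c ` S"
  shows "chart_extend c g p = 0"
proof (cases "p \<in> fst c")
  case True
  then have "p = chart_inv c (snd c p)" using chart_inv_chart[OF c] by simp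
  then have "snd c p \<notin> S" using p by blast
  then show ?thesis using g by (simp add: chart_extend_def)
qed (simp add: chart_extend_def)

text \<open>Near a point of the chart domain the function is \<open>g\<close> composed with a coordinate change. Any
  other point lies outside the closed set \<open>chart_inv c ` S\<close>, near which the function vanishes.\<close>

lemma smooth_map_chart_extend:
  assumes c: "c \<in> \<A>" and g: "smooth_on UNIV g" and S: "compact S" "S \<subseteq> coords c"
    and supp: "\<And>x. x \<notin> S \<Longrightarrow> g x = 0"
  shows "smooth_map \<A> (chart_extend c g)"
  unfolding smooth_map_def smooth_on_def
proof (intro ballI allI)
  fix d k
  assume d: "d \<in> \<A>"
  let ?K = "chart_inv c ` S"
  have K: "closed ?K" by (rule compact_imp_closed[OF compact_chart_inv_image[OF c S]])
  show "Ck_on k (coords d) (chart_extend c g \<circ> chart_inv d)"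
  proof (rule Ck_on_locally)
    fix y
    assume y: "y \<in> coords d"
    let ?q = "chart_inv d y"
    have q: "?q \<in> fst d" "snd d ?q = y" using chart_inv_mem[OF y] chart_chart_inv[OF y] by auto
    show "\<exists>U. open U \<and> y \<in> U \<and> Ck_on k U (chart_extend c g \<circ> chart_inv d)"
    proof (cases "?q \<in> fst c")
      case True
      let ?U = "snd d ` (fst d \<inter> fst c)"
      have U: "open ?U" by (rule open_chart_overlap[OF d c])
      have "Ck_on k ?U (\<lambda>x. g ((snd c \<circ> chart_inv d) x))"
        by (rule Ck_on_compose[OF U open_UNIV subset_UNIV smooth_on_imp_Ck_on[OF chart_transition_smooth[OF d c]]
              smooth_on_imp_Ck_on[OF g]])
      then have "Ck_on k ?U (chart_extend c g \<circ> chart_inv d)"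
        by (rule Ck_on_cong[OF U, rotated]) (auto simp: chart_extend_def chart_inv_chart[OF d])
      moreover have "y \<in> ?U" using True q by (metis IntI image_eqI)
      ultimately show ?thesis using U by blast
    next
      case False
      have "?K \<subseteq> fst c" using S(2) chart_inv_mem[of _ c] by auto
      then have "?q \<notin> ?K" using False by blast
      let ?U = "snd d ` (fst d - ?K)"
      have U: "open ?U" by (rule open_chart_image[OF d open_Diff[OF open_chart(1)[OF d] K]]) blast
      have "Ck_on k ?U (chart_extend c g \<circ> chart_inv d)"
      proof (rule Ck_on_cong[OF U _ Ck_on_const])
        fix x
        assume "x \<in> ?U"
        then obtain p where p: "p \<in> fst d" "p \<notin> ?K" "x = snd d p" by blast
        then show "0 = (chart_extend c g \<circ> chart_inv d) x"
          using chart_extend_outside[OF c supp, where S = S] chart_inv_chart[OF d] by simp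
      qed
      moreover have "y \<in> ?U" using q \<open>?q \<notin> ?K\<close> by (metis DiffI image_eqI)
      ultimately show ?thesis using U by blast
    qed
  qed
qed

lemma smooth_map_add_scaleR:
  assumes "smooth_map \<A> X" "smooth_map \<A> f" "smooth_map \<A> N"
  shows "smooth_map \<A> (\<lambda>p. X p + (t * f p) *\<^sub>R N p)"
  unfolding smooth_map_def smooth_on_def
proof (intro ballI allI)
  fix c k
  assume c: "c \<in> \<A>"
  note o = open_chart(2)[OF c]
  note C = assms[THEN smooth_map_Ck_on, OF c]
  from Ck_on_add[OF o C(1) Ck_on_scaleR[OF o Ck_on_mult[OF o Ck_on_const C(2)] C(3)]]
  show "Ck_on k (coords c) ((\<lambda>p. X p + (t * f p) *\<^sub>R N p) \<circ> chart_inv c)"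
    by (simp add: comp_def)
qed

lemma chart_deriv_add_scaleR:
  assumes X: "smooth_map \<A> X" and f: "smooth_map \<A> f" and N: "smooth_map \<A> N"
    and c: "c \<in> \<A>" "p \<in> fst c"
  shows "chart_deriv c (\<lambda>p. X p + (t * f p) *\<^sub>R N p) p v =
    chart_deriv c X p v + t *\<^sub>R (f p *\<^sub>R chart_deriv c N p v + chart_deriv c f p v *\<^sub>R N p)"
proof -
  have p: "chart_inv c (snd c p) = p" by (rule chart_inv_chart[OF c])
  have fN: "((\<lambda>x. (f \<circ> chart_inv c) x *\<^sub>R (N \<circ> chart_inv c) x) has_derivative
      (\<lambda>v. f p *\<^sub>R chart_deriv c N p v + chart_deriv c f p v *\<^sub>R N p)) (at (snd c p))"
    using has_derivative_scaleR[OF chart_has_derivative[OF f c] chart_has_derivative[OF N c]] by (simp add: p)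
  have "((\<lambda>x. (X \<circ> chart_inv c) x + t *\<^sub>R ((f \<circ> chart_inv c) x *\<^sub>R (N \<circ> chart_inv c) x)) has_derivative
      (\<lambda>v. chart_deriv c X p v + t *\<^sub>R (f p *\<^sub>R chart_deriv c N p v + chart_deriv c f p v *\<^sub>R N p))) (at (snd c p))"
    by (rule has_derivative_add[OF chart_has_derivative[OF X c] has_derivative_scaleR_right[OF fN]])
  then have "(((\<lambda>p. X p + (t * f p) *\<^sub>R N p) \<circ> chart_inv c) has_derivative
      (\<lambda>v. chart_deriv c X p v + t *\<^sub>R (f p *\<^sub>R chart_deriv c N p v + chart_deriv c f p v *\<^sub>R N p))) (at (snd c p))"
    by (simp add: comp_def)
  from frechet_derivative_at[OF this, symmetric] show ?thesis by (simp only: chart_deriv_def)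
qed

lemma continuous_on_chart_deriv_vector:
  assumes F: "smooth_map \<A> F" and c: "c \<in> \<A>"
  shows "continuous_on (coords c \<times> UNIV) (\<lambda>(x, v). chart_deriv c F (chart_inv c x) v)"
proof -
  have "continuous_on (coords c \<times> UNIV)
      (\<lambda>z. \<Sum>i\<in>UNIV. snd z $ i *\<^sub>R chart_deriv c F (chart_inv c (fst z)) (axis i 1))"
    by (intro continuous_intros continuous_on_compose2[OF continuous_on_chart_deriv[OF F c]]) auto
  then show ?thesis
  proof (rule continuous_on_cong[THEN iffD1, rotated -1])
    fix z :: "(real ^ 'n) \<times> (real ^ 'n)"
    assume "z \<in> coords c \<times> UNIV"
    then have lin: "linear (chart_deriv c F (chart_inv c (fst z)))"
      using linear_chart_deriv[OF F c chart_inv_mem] by auto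
    have "chart_deriv c F (chart_inv c (fst z)) (snd z) =
        chart_deriv c F (chart_inv c (fst z)) (\<Sum>i\<in>UNIV. snd z $ i *\<^sub>R axis i 1)"
      using basis_expansion[of "snd z"] by (simp add: scalar_mult_eq_scaleR)
    then show "(\<Sum>i\<in>UNIV. snd z $ i *\<^sub>R chart_deriv c F (chart_inv c (fst z)) (axis i 1)) =
        (case z of (x, v) \<Rightarrow> chart_deriv c F (chart_inv c x) v)"
      by (simp add: case_prod_unfold linear_sum[OF lin] linear_cmul[OF lin])
  qed simp
qed

text \<open>Over the compact set \<open>S\<close> there are \<open>m > 0\<close> and \<open>M\<close> with \<open>|dX v| \<ge> m\<close> and \<open>|d(f N) v| \<le> M\<close>
  for unit vectors \<open>v\<close>, so the differential \<open>dX + t d(f N)\<close> is injective for \<open>|t| < m / M\<close>. Away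
  from the support of \<open>f\<close> it is \<open>dX\<close>.\<close>

lemma immersion_perturbation:
  assumes X: "immersion \<A> X" and f: "smooth_map \<A> f" and N: "smooth_map \<A> N"
    and c: "c \<in> \<A>" and S: "compact S" "S \<subseteq> coords c" "S \<noteq> {}"
    and supp: "\<And>p. p \<notin> chart_inv c ` S \<Longrightarrow> f p = 0"
  shows "\<exists>\<epsilon>>0. \<forall>t\<in>{-\<epsilon><..<\<epsilon>}. immersion \<A> (\<lambda>p. X p + (t * f p) *\<^sub>R N p)"
proof -
  let ?K = "chart_inv c ` S" and ?Y = "\<lambda>t p. X p + (t * f p) *\<^sub>R N p"
  have Xs: "smooth_map \<A> X" by (rule immersion_smooth[OF X])
  have K: "closed ?K" by (rule compact_imp_closed[OF compact_chart_inv_image[OF c S(1,2)]])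
  have Kc: "?K \<subseteq> fst c" using S(2) chart_inv_mem[of _ c] by auto
  define E where "E x v = f (chart_inv c x) *\<^sub>R chart_deriv c N (chart_inv c x) v +
      chart_deriv c f (chart_inv c x) v *\<^sub>R N (chart_inv c x)" for x v
  let ?T = "S \<times> sphere (0 :: real ^ 'n) 1"
  have T: "compact ?T" "?T \<noteq> {}" using S by (auto intro: compact_Times)
  have sub: "?T \<subseteq> coords c \<times> UNIV" using S(2) by blast
  have "continuous_on ?T (\<lambda>z. norm (chart_deriv c X (chart_inv c (fst z)) (snd z)))"
    using continuous_on_subset[OF continuous_on_chart_deriv_vector[OF Xs c] sub]
    by (intro continuous_on_norm) (simp add: case_prod_unfold)
  from continuous_attains_inf[OF T this] obtain z0 where z0: "z0 \<in> ?T"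
    "\<And>z. z \<in> ?T \<Longrightarrow> norm (chart_deriv c X (chart_inv c (fst z0)) (snd z0)) \<le> norm (chart_deriv c X (chart_inv c (fst z)) (snd z))"
    by blast
  define m where "m = norm (chart_deriv c X (chart_inv c (fst z0)) (snd z0))"
  have m: "0 < m"
  proof -
    have x0: "fst z0 \<in> coords c" and v0: "snd z0 \<noteq> 0" using z0(1) S(2) by auto
    have "inj (chart_deriv c X (chart_inv c (fst z0)))"
      using X c chart_inv_mem[OF x0] by (simp add: immersion_def)
    then have "chart_deriv c X (chart_inv c (fst z0)) (snd z0) \<noteq> 0"
      using v0 linear_chart_deriv[OF Xs c chart_inv_mem[OF x0]] linear_injective_0 by blast
    then show ?thesis by (simp add: m_def)
  qed
  have cE: "continuous_on ?T (\<lambda>z. norm (E (fst z) (snd z)))"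
  proof -
    have 1: "continuous_on ?T (\<lambda>z. f (chart_inv c (fst z)))" "continuous_on ?T (\<lambda>z. N (chart_inv c (fst z)))"
      using smooth_map_continuous_on[OF f] smooth_map_continuous_on[OF N] S(2)
      by (auto intro!: continuous_on_compose2[OF _ continuous_on_compose2[OF continuous_on_chart_inv[OF c] continuous_on_fst[OF continuous_on_id]]])
    have 2: "continuous_on ?T (\<lambda>z. chart_deriv c f (chart_inv c (fst z)) (snd z))"
      "continuous_on ?T (\<lambda>z. chart_deriv c N (chart_inv c (fst z)) (snd z))"
      using continuous_on_subset[OF continuous_on_chart_deriv_vector[OF f c] sub]
        continuous_on_subset[OF continuous_on_chart_deriv_vector[OF N c] sub]
      by (simp_all add: case_prod_unfold)
    show ?thesis unfolding E_def by (intro continuous_intros 1 2)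
  qed
  from continuous_attains_sup[OF T cE] obtain z1 where z1: "\<And>z. z \<in> ?T \<Longrightarrow> norm (E (fst z) (snd z)) \<le> norm (E (fst z1) (snd z1))"
    by blast
  \<comment> \<open>The summand 1 allows division by \<open>M\<close> also when the supremum is 0.\<close>
  define M where "M = norm (E (fst z1) (snd z1)) + 1"
  have M: "0 < M" by (simp add: M_def add_nonneg_pos)
  have EM: "norm (E x v) \<le> M" if "x \<in> S" "norm v = 1" for x v
    using z1[of "(x, v)"] that by (simp add: M_def)
  define \<epsilon> where "\<epsilon> = m / M"
  have \<epsilon>: "0 < \<epsilon>" using m M by (simp add: \<epsilon>_def)
  have "immersion \<A> (?Y t)" if t: "t \<in> {-\<epsilon><..<\<epsilon>}" for t
    unfolding immersion_def
  proof (intro conjI ballI)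
    show Ys: "smooth_map \<A> (?Y t)" by (rule smooth_map_add_scaleR[OF Xs f N])
    fix d p
    assume d: "d \<in> \<A>" "p \<in> fst d"
    have Xinj: "inj (chart_deriv d X p)" using X d by (simp add: immersion_def)
    show "inj (chart_deriv d (?Y t) p)"
    proof (cases "p \<in> ?K")
      case True
      then obtain x where x: "x \<in> S" "p = chart_inv c x" by blast
      have p: "p \<in> fst c" using True Kc by blast
      have lin: "linear (chart_deriv c (?Y t) p)" by (rule linear_chart_deriv[OF Ys c p])
      have unit: "chart_deriv c (?Y t) p v \<noteq> 0" if v: "norm v = 1" for v
      proof -
        have "norm (t *\<^sub>R E x v) < m"
        proof -
          have "\<bar>t\<bar> * norm (E x v) \<le> \<bar>t\<bar> * M" by (rule mult_left_mono[OF EM[OF x(1) v]]) simp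
          also have "\<dots> < \<epsilon> * M" using t M by (intro mult_strict_right_mono) auto
          finally show ?thesis using M by (simp add: \<epsilon>_def)
        qed
        also have "m \<le> norm (chart_deriv c X p v)"
          using z0(2)[of "(x, v)"] x v by (simp add: m_def)
        finally have less: "norm (t *\<^sub>R E x v) < norm (chart_deriv c X p v)" .
        have "chart_deriv c (?Y t) p v = chart_deriv c X p v + t *\<^sub>R E x v"
          unfolding chart_deriv_add_scaleR[OF Xs f N c p] by (simp add: E_def x(2))
        then show ?thesis using less by (metis add_eq_0_iff less_irrefl norm_minus_cancel)
      qed
      have c0: "v = 0" if "chart_deriv c (?Y t) p v = 0" for v
      proof (rule ccontr)
        assume "v \<noteq> 0"
        then have "norm ((1 / norm v) *\<^sub>R v) = 1" by simp
        from unit[OF this] show False using that by (simp add: linear_cmul[OF lin])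
      qed
      have "w = 0" if w: "chart_deriv d (?Y t) p w = 0" for w
      proof -
        have "transition d c p w = 0"
          using w chart_deriv_transition[OF Ys d c p] c0 by simp
        then have "chart_deriv d X p w = 0"
          using chart_deriv_transition[OF Xs d c p, of w] linear_chart_deriv[OF Xs c p] linear_0 by metis
        then show "w = 0"
          using Xinj linear_chart_deriv[OF Xs d] linear_injective_0 by blast
      qed
      then show ?thesis using linear_chart_deriv[OF Ys d] linear_injective_0 by blast
    next
      case False
      let ?U = "snd d ` (fst d - ?K)"
      have U: "open ?U" by (rule open_chart_image[OF d(1) open_Diff[OF open_chart(1)[OF d(1)] K]]) blast
      have pU: "snd d p \<in> ?U" using False d by blast
      have "((?Y t \<circ> chart_inv d) has_derivative chart_deriv d X p) (at (snd d p))"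
      proof (rule has_derivative_transform_within_open[OF chart_has_derivative[OF Xs d] U pU])
        fix x
        assume "x \<in> ?U"
        then obtain q where "q \<in> fst d" "q \<notin> ?K" "x = snd d q" by blast
        then show "(X \<circ> chart_inv d) x = (?Y t \<circ> chart_inv d) x"
          using supp[of q] chart_inv_chart[OF d(1)] by simp
      qed
      from frechet_derivative_at[OF this] have "chart_deriv d (?Y t) p = chart_deriv d X p"
        by (simp add: chart_deriv_def[abs_def])
      then show ?thesis using Xinj by simp
    qed
  qed
  then show ?thesis using \<epsilon> by blast
qed

lemma exists_normal_variation:
  assumes X: "immersion \<A> X" and N: "unit_normal \<A> X N" and f: "smooth_map \<A> f"
    and c: "c \<in> \<A>" and S: "compact S" "S \<subseteq> coords c" "S \<noteq> {}"
    and supp: "\<And>p. p \<notin> chart_inv c ` S \<Longrightarrow> f p = 0"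
  obtains \<epsilon> where "normal_variation \<A> X N (chart_inv c ` S) \<epsilon> (\<lambda>t p. X p + (t * f p) *\<^sub>R N p)"
proof -
  let ?F = "\<lambda>t p. X p + (t * f p) *\<^sub>R N p"
  have Xs: "smooth_map \<A> X" by (rule immersion_smooth[OF X])
  have Ns: "smooth_map \<A> N" using N by (simp add: unit_normal_def)
  obtain \<epsilon> where \<epsilon>: "0 < \<epsilon>" and im: "\<forall>t\<in>{-\<epsilon><..<\<epsilon>}. immersion \<A> (?F t)"
    using immersion_perturbation[OF X f Ns c S supp] by blast
  have "smooth_on ({-\<epsilon><..<\<epsilon>} \<times> coords d) (\<lambda>(t, x). ?F t (chart_inv d x))" if d: "d \<in> \<A>" for d
    unfolding smooth_on_def
  proof
    fix k
    let ?S = "{-\<epsilon><..<\<epsilon>} \<times> coords d"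
    have oS: "open ?S" by (intro open_Times open_chart d) simp
    have t: "Ck_on k ?S fst" by (rule Ck_on_bounded_linear[OF bounded_linear_fst])
    note s = smooth_map_Ck_on_snd[OF _ d open_greaterThanLessThan]
    from Ck_on_add[OF oS s[OF Xs] Ck_on_scaleR[OF oS Ck_on_mult[OF oS t s[OF f]] s[OF Ns]]]
    show "Ck_on k ?S (\<lambda>(t, x). ?F t (chart_inv d x))" by (simp add: case_prod_unfold)
  qed
  moreover have "((\<lambda>t. ?F t p) has_vector_derivative f p *\<^sub>R N p) (at 0)" for p
    by (auto intro!: derivative_eq_intros)
  ultimately have "normal_variation \<A> X N (chart_inv c ` S) \<epsilon> ?F"
    unfolding normal_variation_def
    using \<epsilon> im compact_chart_inv_image[OF c S(1,2)] supp by auto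
  then show ?thesis by (rule that)
qed

section \<open>Criticality forces a constant\<close>

lemma area_measure_open_pos:
  assumes X: "immersion \<A> X" and \<mu>: "is_area_measure X \<mu>" and U: "open U" "q \<in> U"
  shows "emeasure \<mu> U \<noteq> 0"
proof
  assume 0: "emeasure \<mu> U = 0"
  let ?c = "chart_at \<A> q"
  note c = chart_at[of q]
  let ?W = "U \<inter> fst ?c"
  have s: "sets \<mu> = sets borel" by (rule sets_area_measure[OF \<mu>])
  have W: "open ?W" "?W \<subseteq> fst ?c" "?W \<in> sets borel" using U open_chart(1)[OF c(1)] by auto
  have oW: "open (snd ?c ` ?W)" by (rule open_chart_image[OF c(1) W(1,2)])
  have "emeasure \<mu> ?W \<le> emeasure \<mu> U" by (rule emeasure_mono) (use U s in auto)
  then have "emeasure (chart_area ?c X) (snd ?c ` ?W) = 0"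
    using 0 \<mu> c(1) W unfolding is_area_measure_def by (metis le_zero_eq)
  then have "(\<integral>\<^sup>+x\<in>snd ?c ` ?W. ennreal (area_density ?c X x) \<partial>lborel) = 0"
    using emeasure_chart_area[OF X c(1), of "snd ?c ` ?W"] oW by simp
  then have "AE x in lborel. ennreal (area_density ?c X x) * indicator (snd ?c ` ?W) x = 0"
    using area_density_borel[OF immersion_smooth[OF X] c(1)] oW
    by (subst (asm) nn_integral_0_iff_AE) auto
  then have "AE x in lborel. x \<notin> snd ?c ` ?W"
  proof (rule AE_mp, intro AE_I2 impI notI)
    fix x
    assume "ennreal (area_density ?c X x) * indicator (snd ?c ` ?W) x = 0" "x \<in> snd ?c ` ?W"
    moreover have "0 < area_density ?c X x"
      by (rule area_density_pos[OF X c(1)]) (use \<open>x \<in> snd ?c ` ?W\<close> in blast)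
    ultimately show False by simp
  qed
  then have "snd ?c ` ?W \<in> null_sets lborel"
    using oW by (subst (asm) AE_iff_null_sets[symmetric]) auto
  then have "negligible (snd ?c ` ?W)"
    by (simp add: negligible_iff_null_sets null_sets_completionI)
  moreover have "snd ?c ` ?W \<noteq> {}" using U c by blast
  ultimately show False using open_not_negligible[OF oW] by blast
qed

lemma area_integral_pos:
  fixes h :: "'p \<Rightarrow> real"
  assumes X: "immersion \<A> X" and K: "compact K" and h: "continuous_on UNIV h"
    and nonneg: "\<And>p. p \<in> K \<Longrightarrow> 0 \<le> h p"
    and U: "open U" "q \<in> U" "U \<subseteq> K" "\<And>p. p \<in> U \<Longrightarrow> 0 < h p"
  shows "0 < (LINT p:K|area_measure \<A> X. h p)"
proof -
  let ?\<mu> = "area_measure \<A> X"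
  note \<mu> = area_measure[OF X]
  have s: "sets ?\<mu> = sets borel" by (rule sets_area_measure[OF \<mu>])
  have int: "integrable ?\<mu> (\<lambda>p. indicator K p *\<^sub>R h p)"
    using set_integrable_compact[OF s area_finite_on_compact[OF \<mu> X K] K h] by (simp add: set_integrable_def)
  have nn: "AE p in ?\<mu>. 0 \<le> indicator K p *\<^sub>R h p"
    using nonneg by (auto split: split_indicator)
  have "(LINT p|?\<mu>. indicator K p *\<^sub>R h p) \<noteq> 0"
  proof
    assume "(LINT p|?\<mu>. indicator K p *\<^sub>R h p) = 0"
    then have "AE p in ?\<mu>. indicator K p *\<^sub>R h p = 0"
      using integral_nonneg_eq_0_iff_AE[OF int nn] by simp
    then have "AE p in ?\<mu>. p \<notin> U"
    proof (rule AE_mp, intro AE_I2 impI notI)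
      fix p
      assume "indicator K p *\<^sub>R h p = 0" "p \<in> U"
      then show False using U(3) U(4)[of p] by (auto simp: indicator_def)
    qed
    then have "U \<in> null_sets ?\<mu>"
      using U(1) s by (subst (asm) AE_iff_null_sets[symmetric]) auto
    then show False using area_measure_open_pos[OF X \<mu> U(1,2)] by (simp add: null_sets_def)
  qed
  moreover have "0 \<le> (LINT p|?\<mu>. indicator K p *\<^sub>R h p)" by (rule integral_nonneg_AE[OF nn])
  ultimately show ?thesis by (simp add: set_lebesgue_integral_def)
qed


lemma continuous_on_lambda_function:
  assumes X: "immersion \<A> X" and N: "smooth_map \<A> N"
  shows "continuous_on UNIV (\<lambda>p. ((1 / t0) *\<^sub>R (X p - X0)) \<bullet> N p + mean_curvature \<A> X N p)"
  by (intro continuous_intros smooth_map_continuous_on immersion_smooth X N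
      continuous_on_manifold[where g = "mean_curvature \<A> X N"] continuous_on_mean_curvature)

text \<open>Otherwise choose \<open>m\<close> strictly between the two values and bump functions \<open>B1\<close>, \<open>B2\<close> supported
  in closed balls around \<open>x1\<close> and \<open>x2\<close> on which \<open>\<phi> > m\<close> and \<open>\<phi> < m\<close>. With \<open>\<alpha>i = \<integral> Bi w\<close>, the
  function \<open>f = \<alpha>2 B1 - \<alpha>1 B2\<close> has \<open>\<integral> f w = 0\<close>, so that \<open>X + t f N\<close> preserves the weighted
  volume. But \<open>\<integral> f \<phi> w = \<alpha>2 \<integral> B1 (\<phi> - m) w - \<alpha>1 \<integral> B2 (\<phi> - m) w\<close> is positive, and by the first
  variation formula it is \<open>- A'(0)\<close>.

  The two points may lie in different components of the coordinate domain.\<close>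

lemma critical_imp_equal_in_chart:
  assumes X: "immersion \<A> X" and N: "unit_normal \<A> X N" and crit: "critical_weighted_area \<A> X N X0 t0"
    and c: "c \<in> \<A>" and x: "x1 \<in> coords c" "x2 \<in> coords c"
    and \<phi>: "\<phi> = (\<lambda>p. ((1 / t0) *\<^sub>R (X p - X0)) \<bullet> N p + mean_curvature \<A> X N p)"
  shows "\<phi> (chart_inv c x1) \<le> \<phi> (chart_inv c x2)"
proof (rule ccontr)
  assume "\<not> ?thesis"
  then have less: "\<phi> (chart_inv c x2) < \<phi> (chart_inv c x1)" by simp
  let ?\<mu> = "area_measure \<A> X"
  have Ns: "smooth_map \<A> N" and N1: "\<And>p. N p \<bullet> N p = 1"
    using N by (auto simp: unit_normal_def norm_eq_1)
  have Xs: "smooth_map \<A> X" by (rule immersion_smooth[OF X])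
  have c\<phi>: "continuous_on UNIV \<phi>" unfolding \<phi> by (rule continuous_on_lambda_function[OF X Ns])
  have c\<phi>c: "continuous_on (coords c) (\<lambda>x. \<phi> (chart_inv c x))"
    by (rule continuous_on_compose2[OF c\<phi> continuous_on_chart_inv[OF c]]) simp
  note oc = open_chart(2)[OF c]
  obtain m where m: "\<phi> (chart_inv c x2) < m" "m < \<phi> (chart_inv c x1)" using dense[OF less] by blast
  define A1 where "A1 = coords c \<inter> (\<lambda>x. \<phi> (chart_inv c x)) -` {m<..}"
  define A2 where "A2 = coords c \<inter> (\<lambda>x. \<phi> (chart_inv c x)) -` {..<m}"
  have "open A1" "open A2"
    unfolding A1_def A2_def by (rule continuous_open_preimage[OF c\<phi>c oc]; simp)+
  moreover have "x1 \<in> A1" "x2 \<in> A2" using x m by (auto simp: A1_def A2_def)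
  ultimately obtain r1 r2 where r: "0 < r1" "cball x1 r1 \<subseteq> A1" "0 < r2" "cball x2 r2 \<subseteq> A2"
    by (metis open_contains_cball)
  define S where "S = cball x1 r1 \<union> cball x2 r2"
  have S: "compact S" "S \<subseteq> coords c" "S \<noteq> {}"
    using r by (auto simp: S_def A1_def A2_def intro: compact_Un)
  define K where "K = chart_inv c ` S"
  have K: "compact K" unfolding K_def by (rule compact_chart_inv_image[OF c S(1,2)])
  define w where "w p = exp (- (norm (X p - X0))\<^sup>2 / (2 * t0))" for p
  have cw: "continuous_on UNIV w"
    unfolding w_def[abs_def] divide_inverse by (intro continuous_intros smooth_map_continuous_on Xs)
  have bump: "smooth_map \<A> (chart_extend c (bump a r))"
      "\<And>p. p \<notin> K \<Longrightarrow> chart_extend c (bump a r) p = 0"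
      "\<And>g. continuous_on UNIV g \<Longrightarrow> (\<And>y. y \<in> ball a r \<Longrightarrow> 0 < g (chart_inv c y)) \<Longrightarrow>
        0 < (LINT p:K|?\<mu>. chart_extend c (bump a r) p * w p * g p)"
    if r: "0 < r" "cball a r \<subseteq> S" for a r
  proof -
    let ?B = "chart_extend c (bump a r)"
    have bS: "ball a r \<subseteq> S" using r(2) ball_subset_cball by blast
    note eq = chart_inv_image_eq[OF c order_trans[OF bS S(2)]]
    have supp: "bump a r y = 0" if "y \<notin> S" for y
      using that bS bump_pos_iff[OF r(1), of a y] bump_nonneg[of a r y] by (auto simp: less_le)
    show sm: "smooth_map \<A> ?B" by (rule smooth_map_chart_extend[OF c smooth_on_bump S(1,2) supp])
    show "?B p = 0" if "p \<notin> K" for p by (rule chart_extend_outside[OF c supp that[unfolded K_def]])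
    fix g :: "'p \<Rightarrow> real"
    assume g: "continuous_on UNIV g" and gpos: "\<And>y. y \<in> ball a r \<Longrightarrow> 0 < g (chart_inv c y)"
    have pos: "0 < ?B p * w p * g p" if p: "p \<in> chart_inv c ` ball a r" for p
    proof -
      have "0 < ?B p"
        using p bump_pos_iff[OF r(1), of a "snd c p"] unfolding eq by (simp add: chart_extend_def)
      moreover have "0 < g p" using p gpos by blast
      ultimately show ?thesis by (simp add: w_def)
    qed
    have zero: "?B p = 0" if "p \<notin> chart_inv c ` ball a r" for p
      using that bump_pos_iff[OF r(1), of a "snd c p"] bump_nonneg[of a r "snd c p"]
      unfolding eq by (auto simp: chart_extend_def less_le)
    show "0 < (LINT p:K|?\<mu>. ?B p * w p * g p)"
    proof (rule area_integral_pos[OF X K])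
      show "continuous_on UNIV (\<lambda>p. ?B p * w p * g p)"
        by (intro continuous_intros smooth_map_continuous_on[OF sm] cw g)
      show "0 \<le> ?B p * w p * g p" for p
        using pos[of p] zero[of p] by (cases "p \<in> chart_inv c ` ball a r") (auto simp: less_imp_le)
      show "open (chart_inv c ` ball a r)"
        unfolding eq by (rule continuous_open_preimage[OF continuous_on_chart[OF c] open_chart(1)[OF c] open_ball])
      show "chart_inv c a \<in> chart_inv c ` ball a r" using r by simp
      show "chart_inv c ` ball a r \<subseteq> K" unfolding K_def using bS by blast
    qed (rule pos)
  qed
  have cS: "cball x1 r1 \<subseteq> S" "cball x2 r2 \<subseteq> S" by (auto simp: S_def)
  define B1 where "B1 = chart_extend c (bump x1 r1)"
  define B2 where "B2 = chart_extend c (bump x2 r2)"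
  note bump1 = bump[OF r(1) cS(1), folded B1_def] and bump2 = bump[OF r(3) cS(2), folded B2_def]
  have cB: "continuous_on UNIV B1" "continuous_on UNIV B2"
    by (intro smooth_map_continuous_on bump1(1) bump2(1))+
  have s: "sets ?\<mu> = sets borel" by (rule sets_area_measure[OF area_measure[OF X]])
  have int: "set_integrable ?\<mu> K h" if "continuous_on UNIV h" for h :: "'p \<Rightarrow> real"
    by (rule set_integrable_compact[OF s area_finite_on_compact[OF area_measure[OF X] X K] K that])
  define \<alpha>1 where "\<alpha>1 = (LINT p:K|?\<mu>. B1 p * w p)"
  define \<alpha>2 where "\<alpha>2 = (LINT p:K|?\<mu>. B2 p * w p)"
  define \<beta>1 where "\<beta>1 = (LINT p:K|?\<mu>. B1 p * w p * \<phi> p)"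
  define \<beta>2 where "\<beta>2 = (LINT p:K|?\<mu>. B2 p * w p * \<phi> p)"
  have \<alpha>1: "0 < \<alpha>1" using bump1(3)[of "\<lambda>_. 1"] by (simp add: \<alpha>1_def)
  have \<alpha>2: "0 < \<alpha>2" using bump2(3)[of "\<lambda>_. 1"] by (simp add: \<alpha>2_def)
  have "0 < (LINT p:K|?\<mu>. B1 p * w p * (\<phi> p - m))"
    using r(2) ball_subset_cball[of x1 r1]
    by (intro bump1(3) continuous_intros c\<phi>) (auto simp: A1_def subset_iff)
  also have "\<dots> = (LINT p:K|?\<mu>. B1 p * w p * \<phi> p - m * (B1 p * w p))"
    by (simp add: algebra_simps)
  also have "\<dots> = \<beta>1 - m * \<alpha>1"
    unfolding \<beta>1_def \<alpha>1_def
    by (subst set_integral_diff(2)) (auto intro!: int continuous_intros cB cw c\<phi>)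
  finally have 1: "m * \<alpha>1 < \<beta>1" by simp
  have "0 < (LINT p:K|?\<mu>. B2 p * w p * (m - \<phi> p))"
    using r(4) ball_subset_cball[of x2 r2]
    by (intro bump2(3) continuous_intros c\<phi>) (auto simp: A2_def subset_iff)
  also have "\<dots> = (LINT p:K|?\<mu>. m * (B2 p * w p) - B2 p * w p * \<phi> p)"
    by (simp add: algebra_simps)
  also have "\<dots> = m * \<alpha>2 - \<beta>2"
    unfolding \<beta>2_def \<alpha>2_def
    by (subst set_integral_diff(2)) (auto intro!: int continuous_intros cB cw c\<phi>)
  finally have 2: "\<beta>2 < m * \<alpha>2" by simp
  define f where "f p = \<alpha>2 * B1 p - \<alpha>1 * B2 p" for p
  have f: "smooth_map \<A> f"
    unfolding smooth_map_def smooth_on_def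
  proof (intro ballI allI)
    fix d k
    assume d: "d \<in> \<A>"
    note o = open_chart(2)[OF d]
    note C = smooth_map_Ck_on[OF bump1(1) d] smooth_map_Ck_on[OF bump2(1) d]
    from Ck_on_diff[OF o Ck_on_mult[OF o Ck_on_const C(1)] Ck_on_mult[OF o Ck_on_const C(2)]]
    show "Ck_on k (coords d) (f \<circ> chart_inv d)" by (simp add: f_def comp_def)
  qed
  have fout: "f p = 0" if "p \<notin> chart_inv c ` S" for p
    using bump1(2)[of p] bump2(2)[of p] that by (simp add: f_def K_def)
  let ?F = "\<lambda>t p. X p + (t * f p) *\<^sub>R N p"
  obtain \<epsilon> where V: "normal_variation \<A> X N K \<epsilon> ?F"
    using exists_normal_variation[OF X N f c S fout] unfolding K_def by blast
  have fint: "(LINT p:K|?\<mu>. f p * w p * g p) =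
      \<alpha>2 * (LINT p:K|?\<mu>. B1 p * w p * g p) - \<alpha>1 * (LINT p:K|?\<mu>. B2 p * w p * g p)"
    if g: "continuous_on UNIV g" for g
  proof -
    have "(LINT p:K|?\<mu>. f p * w p * g p) =
        (LINT p:K|?\<mu>. \<alpha>2 * (B1 p * w p * g p) - \<alpha>1 * (B2 p * w p * g p))"
      by (simp add: f_def algebra_simps)
    also have "\<dots> = \<alpha>2 * (LINT p:K|?\<mu>. B1 p * w p * g p) - \<alpha>1 * (LINT p:K|?\<mu>. B2 p * w p * g p)"
      by (subst set_integral_diff(2)) (auto intro!: int continuous_intros cB cw g)
    finally show ?thesis .
  qed
  have fw: "(LINT p:K|?\<mu>. f p * w p) = 0"
    using fint[of "\<lambda>_. 1"] by (simp add: \<alpha>1_def \<alpha>2_def)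
  note cXNf = smooth_map_continuous_on[OF Xs] smooth_map_continuous_on[OF Ns] smooth_map_continuous_on[OF f]
  have vol: "weighted_volume \<A> X N K X0 t0 ?F t = weighted_volume \<A> X N K X0 t0 ?F 0" for t
  proof -
    have "((?F t p - X0) \<bullet> N p) * w p = ((X p - X0) \<bullet> N p) * w p + t * (f p * w p)" for p
      by (simp add: inner_simps N1 algebra_simps)
    then have "weighted_volume \<A> X N K X0 t0 ?F t =
        (LINT p:K|?\<mu>. ((X p - X0) \<bullet> N p) * w p + t * (f p * w p))"
      by (simp add: weighted_volume_def w_def)
    also have "\<dots> = (LINT p:K|?\<mu>. ((X p - X0) \<bullet> N p) * w p) + t * (LINT p:K|?\<mu>. f p * w p)"
      by (subst set_integral_add(2))
         (auto intro!: int continuous_intros cw cXNf)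
    also have "\<dots> = weighted_volume \<A> X N K X0 t0 ?F 0"
      unfolding fw by (simp add: weighted_volume_def w_def)
    finally show ?thesis .
  qed
  have zero: "(weighted_area \<A> K X0 t0 ?F has_real_derivative 0) (at 0)"
    using crit V vol unfolding critical_weighted_area_def by blast
  have "((\<lambda>t. ?F t p) has_vector_derivative f p *\<^sub>R N p) (at 0)" for p
    by (auto intro!: derivative_eq_intros)
  note variation = first_variation_weighted_area[OF X N V this, of X0 t0]
  have "(LINT p:K|?\<mu>. - (f p * (((1 / t0) *\<^sub>R (X p - X0)) \<bullet> N p + mean_curvature \<A> X N p)
      * exp (- (norm (X p - X0))\<^sup>2 / (2 * t0)))) = (LINT p:K|?\<mu>. (- 1) * (f p * w p * \<phi> p))"
    by (simp add: \<phi> w_def mult_ac)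
  also have "\<dots> = - (LINT p:K|?\<mu>. f p * w p * \<phi> p)"
    by (subst set_integral_mult_right) simp
  finally have "(LINT p:K|?\<mu>. f p * w p * \<phi> p) = 0"
    using DERIV_unique[OF zero variation] by simp
  then have "\<alpha>2 * \<beta>1 = \<alpha>1 * \<beta>2"
    using fint[OF c\<phi>] by (simp add: \<beta>1_def \<beta>2_def)
  moreover have "\<alpha>2 * (m * \<alpha>1) < \<alpha>2 * \<beta>1" using 1 \<alpha>2 by simp
  moreover have "\<alpha>1 * \<beta>2 < \<alpha>1 * (m * \<alpha>2)" using 2 \<alpha>1 by simp
  ultimately show False by (simp add: mult_ac)
qed

text \<open>Exchanging the two points shows that \<open>\<phi>\<close> is constant on each chart domain, hence locally
  constant; connectedness makes it constant.\<close>

theorem critical_imp_lambda_hypersurface: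
  assumes X: "immersion \<A> X" and N: "unit_normal \<A> X N" and crit: "critical_weighted_area \<A> X N X0 t0"
    and conn: "connected (UNIV :: 'p set)"
  shows "\<exists>lam. lambda_hypersurface \<A> X N X0 t0 lam"
proof -
  define \<phi> where "\<phi> = (\<lambda>p. ((1 / t0) *\<^sub>R (X p - X0)) \<bullet> N p + mean_curvature \<A> X N p)"
  have "\<phi> constant_on UNIV"
  proof (rule locally_constant_imp_constant[OF conn])
    fix a
    let ?c = "chart_at \<A> a"
    note c = chart_at[of a]
    have eq: "\<phi> p = \<phi> a" if "p \<in> fst ?c" for p
    proof -
      have "\<phi> p \<le> \<phi> q" if "p \<in> fst ?c" "q \<in> fst ?c" for p q
        using critical_imp_equal_in_chart[OF X N crit c(1) imageI[OF that(1)] imageI[OF that(2)] \<phi>_def]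
          that by (simp add: chart_inv_chart[OF c(1)])
      then show ?thesis using that c(2) by (intro antisym) auto
    qed
    have "openin (top_of_set UNIV) (fst ?c)" using open_chart(1)[OF c(1)] by simp
    then show "\<exists>T. openin (top_of_set UNIV) T \<and> a \<in> T \<and> (\<forall>x\<in>T. \<phi> x = \<phi> a)"
      using c(2) eq by blast
  qed
  then obtain lam where "\<And>p. \<phi> p = lam" unfolding constant_on_def by blast
  then show ?thesis unfolding lambda_hypersurface_def \<phi>_def by blast
qed

text \<open>Here \<open>A'(0) = - lam * V'(0)\<close>.\<close>

theorem lambda_hypersurface_imp_critical:
  assumes X: "immersion \<A> X" and N: "unit_normal \<A> X N" and lam: "lambda_hypersurface \<A> X N X0 t0 lam"
  shows "critical_weighted_area \<A> X N X0 t0"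
  unfolding critical_weighted_area_def
proof (intro allI impI, elim conjE)
  fix K \<epsilon> F
  assume V: "normal_variation \<A> X N K \<epsilon> F"
    and vol: "\<forall>t\<in>{-\<epsilon><..<\<epsilon>}. weighted_volume \<A> X N K X0 t0 F t = weighted_volume \<A> X N K X0 t0 F 0"
  let ?w = "\<lambda>p. exp (- (norm (X p - X0))\<^sup>2 / (2 * t0))"
  have \<epsilon>: "0 < \<epsilon>" using V by (simp add: normal_variation_def)
  obtain f where f: "\<And>p. ((\<lambda>t. F t p) has_vector_derivative f p *\<^sub>R N p) (at 0)"
    using V unfolding normal_variation_def by blast
  have "(weighted_volume \<A> X N K X0 t0 F has_real_derivative 0) (at 0)"
  proof (rule has_field_derivative_transform_within_open[OF DERIV_const, where S = "{-\<epsilon><..<\<epsilon>}"])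
    fix t
    assume "t \<in> {-\<epsilon><..<\<epsilon>}"
    from bspec[OF vol this]
    show "weighted_volume \<A> X N K X0 t0 F 0 = weighted_volume \<A> X N K X0 t0 F t" by (rule sym)
  qed (use \<epsilon> in simp_all)
  then have 0: "(LINT p:K|area_measure \<A> X. f p * ?w p) = 0"
    using first_variation_weighted_volume[OF X N V f] DERIV_unique by blast
  have "(LINT p:K|area_measure \<A> X. - (f p * (((1 / t0) *\<^sub>R (X p - X0)) \<bullet> N p + mean_curvature \<A> X N p) * ?w p)) =
      (LINT p:K|area_measure \<A> X. - lam * (f p * ?w p))"
    using lam by (simp add: lambda_hypersurface_def mult_ac)
  also have "\<dots> = 0" unfolding set_integral_mult_right 0 by simp
  finally show "(weighted_area \<A> K X0 t0 F has_real_derivative 0) (at 0)"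
    using first_variation_weighted_area[OF X N V f, of X0 t0] by simp
qed

end

theorem theorem2p1:
  fixes \<A> :: "('p::{t2_space,second_countable_topology}, 'n::finite) chart set"
    and X N :: "'p \<Rightarrow> real ^ 'm::finite"
    and X0 :: "real ^ 'm"
    and t0 :: real
  assumes "CARD('m) = CARD('n) + 1"
    and "connected (UNIV :: 'p set)"
    and "smooth_atlas \<A>"
    and "immersion \<A> X"
    and "unit_normal \<A> X N"
    and "t0 \<noteq> 0"
  shows "((\<exists>lam. lambda_hypersurface \<A> X N X0 t0 lam) \<longleftrightarrow> critical_weighted_area \<A> X N X0 t0) \<and>
    (critical_weighted_area \<A> X N X0 t0 \<longleftrightarrow>
       (\<exists>lam. \<forall>p. weighted_mean_curvature \<A> X N X0 t0 p = lam)) \<and>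
    (\<forall>lam. lambda_hypersurface \<A> X N X0 t0 lam \<longleftrightarrow>
       (\<forall>p. weighted_mean_curvature \<A> X N X0 t0 p = lam))"
proof -
  interpret smooth_manifold \<A> by unfold_locales (rule assms(3))
  have 1: "(\<exists>lam. lambda_hypersurface \<A> X N X0 t0 lam) \<longleftrightarrow> critical_weighted_area \<A> X N X0 t0"
    using critical_imp_lambda_hypersurface[OF assms(4,5) _ assms(2)]
      lambda_hypersurface_imp_critical[OF assms(4,5)] by blast
  have 2: "lambda_hypersurface \<A> X N X0 t0 lam \<longleftrightarrow> (\<forall>p. weighted_mean_curvature \<A> X N X0 t0 p = lam)" for lam
    by (simp add: lambda_hypersurface_def weighted_mean_curvature_eq[OF assms(4,5,6)])
  show ?thesis using 1 2 by blast
qed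

end
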